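(* Let $P$ be the group defined by the presentation $\langle a, b \mid b^{-1} a^2 b = a^{-2},\ a^{-1} b^2 a = b^{-2} \rangle$. The group of units of the group ring $\mathbb{F}_2[P]$ is a torsion-free linear group that is not finitely generated and contains non-abelian free subgroups.
   Context: $\mathbb{F}_2$ is the field with two elements. A group is linear if it is isomorphic to a subgroup of $\operatorname{GL}_n(F)$ for some positive integer $n$ and some field $F$. *)

theory Defs
  imports "HOL-Algebra.Generated_Fields" "HOL-Algebra.Weak_Morphisms" "HOL-Number_Theory.Residues"
begin

section \<open>Free groups and presentations\<close>

text \<open>The letter \<open>(x, True)\<close> stands for the generator \<open>x\<close> and \<open>(x, False)\<close> for its
  formal inverse.\<close>

definition inv_letter :: "'x \<times> bool \<Rightarrow> 'x \<times> bool"
  where "inv_letter l = (fst l, \<not> snd l)"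

fun reduced :: "('x \<times> bool) list \<Rightarrow> bool" where
  "reduced (l # m # w) \<longleftrightarrow> m \<noteq> inv_letter l \<and> reduced (m # w)"
| "reduced _ \<longleftrightarrow> True"

fun push_letter :: "'x \<times> bool \<Rightarrow> ('x \<times> bool) list \<Rightarrow> ('x \<times> bool) list" where
  "push_letter l (m # w) = (if m = inv_letter l then w else l # m # w)"
| "push_letter l [] = [l]"

definition free_group :: "'x set \<Rightarrow> ('x \<times> bool) list monoid"
  where "free_group S =
    \<lparr>carrier = {w. reduced w \<and> fst ` set w \<subseteq> S},
     monoid.mult = (\<lambda>v w. foldr push_letter v w),
     one = []\<rparr>"

definition normal_closure :: "('a, 'b) monoid_scheme \<Rightarrow> 'a set \<Rightarrow> 'a set"
  where "normal_closure G S = \<Inter>{N. N \<lhd> G \<and> S \<subseteq> N}"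

text \<open>The group presented by the generators \<open>S\<close> and the relations \<open>u = v\<close> for \<open>(u, v) \<in> R\<close>.\<close>

definition presented_group ::
    "'x set \<Rightarrow> (('x \<times> bool) list \<times> ('x \<times> bool) list) set \<Rightarrow> ('x \<times> bool) list set monoid"
  where "presented_group S R =
    free_group S Mod normal_closure (free_group S)
      {u \<otimes>\<^bsub>free_group S\<^esub> inv\<^bsub>free_group S\<^esub> v | u v. (u, v) \<in> R}"

datatype gen_ab = gen_a | gen_b

definition promislow_group :: "(gen_ab \<times> bool) list set monoid"
  where "promislow_group =
    (let F = free_group UNIV; a = [(gen_a, True)]; b = [(gen_b, True)] in
     presented_group UNIV
      {(inv\<^bsub>F\<^esub> b \<otimes>\<^bsub>F\<^esub> a [^]\<^bsub>F\<^esub> (2::int) \<otimes>\<^bsub>F\<^esub> b, a [^]\<^bsub>F\<^esub> (- 2::int)),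
       (inv\<^bsub>F\<^esub> a \<otimes>\<^bsub>F\<^esub> b [^]\<^bsub>F\<^esub> (2::int) \<otimes>\<^bsub>F\<^esub> a, b [^]\<^bsub>F\<^esub> (- 2::int))})"

lemma inv_letter_simps [simp]:
  "inv_letter (inv_letter l) = l" "fst (inv_letter l) = fst l"
  "inv_letter l \<noteq> l" "l \<noteq> inv_letter l"
  by (auto simp: inv_letter_def prod_eq_iff)

lemma reduced_ConsD: "reduced (l # w) \<Longrightarrow> reduced w"
  by (cases w) auto

lemma reduced_push: "reduced w \<Longrightarrow> reduced (push_letter l w)"
  by (cases w) (auto dest: reduced_ConsD)

lemma push_cancel: "reduced w \<Longrightarrow> push_letter (inv_letter l) (push_letter l w) = w"
  by (cases w rule: reduced.cases) auto

lemma push_reduced_Cons: "reduced (l # w) \<Longrightarrow> push_letter l w = l # w"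
  by (cases w) auto

lemma reduced_foldr: "reduced w \<Longrightarrow> reduced (foldr push_letter v w)"
  by (induction v) (auto intro: reduced_push)

lemma foldr_push_letter:
  "reduced v \<Longrightarrow> reduced w \<Longrightarrow>
    foldr push_letter (push_letter l v) w = push_letter l (foldr push_letter v w)"
  using push_cancel[of "foldr push_letter (tl v) w" "inv_letter l"]
  by (cases v) (auto simp: reduced_foldr)

lemma foldr_push_assoc:
  "reduced v \<Longrightarrow> reduced w \<Longrightarrow>
    foldr push_letter (foldr push_letter u v) w = foldr push_letter u (foldr push_letter v w)"
  by (induction u) (auto simp: foldr_push_letter reduced_foldr)

lemma foldr_push_Nil: "reduced w \<Longrightarrow> foldr push_letter w [] = w"
proof (induction w)
  case (Cons l w)
  then show ?case using push_reduced_Cons[of l w] reduced_ConsD[of l w] by simp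
qed simp

lemma fst_push_letter: "fst ` set (push_letter l w) \<subseteq> insert (fst l) (fst ` set w)"
  by (cases w) auto

lemma fst_foldr_push: "fst ` set (foldr push_letter v w) \<subseteq> fst ` set v \<union> fst ` set w"
proof (induction v)
  case (Cons l v)
  then show ?case
    using order_trans[OF fst_push_letter[of l "foldr push_letter v w"] insert_mono[OF Cons]] by simp
qed auto

lemma foldr_push_inverse:
  "reduced u \<Longrightarrow> foldr push_letter (rev (map inv_letter w)) (foldr push_letter w u) = u"
  by (induction w arbitrary: u) (auto simp: push_cancel reduced_foldr)

lemma group_free_group: "group (free_group S)"
proof (rule groupI)
  fix v w assume "v \<in> carrier (free_group S)" "w \<in> carrier (free_group S)"
  then show "v \<otimes>\<^bsub>free_group S\<^esub> w \<in> carrier (free_group S)"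
    using order_trans[OF fst_foldr_push[of v w], of S] by (simp add: free_group_def reduced_foldr)
next
  fix w assume w: "w \<in> carrier (free_group S)"
  define v where "v = foldr push_letter (rev (map inv_letter w)) []"
  have "foldr push_letter v w
      = foldr push_letter (rev (map inv_letter w)) (foldr push_letter [] w)"
    unfolding v_def using w by (intro foldr_push_assoc) (auto simp: free_group_def)
  also have "\<dots> = foldr push_letter (rev (map inv_letter w)) (foldr push_letter w [])"
    using w by (simp add: foldr_push_Nil free_group_def)
  also have "\<dots> = []" by (simp add: foldr_push_inverse)
  finally have "foldr push_letter v w = []" .
  moreover have "fst ` set v \<subseteq> fst ` set w"
    using fst_foldr_push[of "rev (map inv_letter w)" "[]"] by (auto simp: v_def image_image)
  moreover have "reduced v" by (simp add: v_def reduced_foldr)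
  ultimately show "\<exists>v\<in>carrier (free_group S). v \<otimes>\<^bsub>free_group S\<^esub> w = \<one>\<^bsub>free_group S\<^esub>"
    using w by (intro bexI[of _ v]) (auto simp: free_group_def)
qed (auto simp: free_group_def foldr_push_assoc)

lemma (in group) normal_closure_normal:
  assumes "S \<subseteq> carrier G"
  shows "normal_closure G S \<lhd> G"
proof -
  have "carrier G \<lhd> G" by (simp add: normal_inv_iff subgroup_self)
  with assms have ne: "{N. N \<lhd> G \<and> S \<subseteq> N} \<noteq> {}" by auto
  show ?thesis unfolding normal_closure_def
  proof (rule normal_inv_iff[THEN iffD2], intro conjI ballI)
    show "subgroup (\<Inter>{N. N \<lhd> G \<and> S \<subseteq> N}) G"
      by (rule subgroups_Inter) (use ne in \<open>auto intro: normal_imp_subgroup\<close>)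
  next
    fix x h assume "x \<in> carrier G" "h \<in> \<Inter>{N. N \<lhd> G \<and> S \<subseteq> N}"
    then show "x \<otimes> h \<otimes> inv x \<in> \<Inter>{N. N \<lhd> G \<and> S \<subseteq> N}"
      by (auto intro: normal.inv_op_closed2)
  qed
qed

lemma group_presented_group:
  assumes "R \<subseteq> carrier (free_group S) \<times> carrier (free_group S)"
  shows "group (presented_group S R)"
proof -
  interpret F: group "free_group S" by (rule group_free_group)
  show ?thesis unfolding presented_group_def
    by (intro normal.factorgroup_is_group F.normal_closure_normal) (use assms in blast)
qed

lemma group_promislow_group: "group promislow_group"
proof -
  interpret F: group "free_group (UNIV :: gen_ab set)" by (rule group_free_group)
  have "[(gen_a, True)] \<in> carrier (free_group UNIV)" "[(gen_b, True)] \<in> carrier (free_group UNIV)"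
    by (auto simp: free_group_def)
  then show ?thesis unfolding promislow_group_def Let_def
    by (intro group_presented_group) auto
qed


section \<open>Group rings\<close>

text \<open>An element \<open>\<Sum>g. f g \<cdot> g\<close> is represented by its coefficient function \<open>f\<close>, which is
  \<open>\<zero>\<close> outside \<open>carrier G\<close>.\<close>

definition group_ring ::
    "('r, 'm) ring_scheme \<Rightarrow> ('g, 'n) monoid_scheme \<Rightarrow> ('g \<Rightarrow> 'r) ring"
  where "group_ring R G =
    \<lparr>carrier = {f. range f \<subseteq> carrier R \<and> {x. f x \<noteq> \<zero>\<^bsub>R\<^esub>} \<subseteq> carrier G
                 \<and> finite {x. f x \<noteq> \<zero>\<^bsub>R\<^esub>}},
     monoid.mult = (\<lambda>f g x. finsum R (\<lambda>(y, z). f y \<otimes>\<^bsub>R\<^esub> g z)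
       {(y, z). f y \<noteq> \<zero>\<^bsub>R\<^esub> \<and> g z \<noteq> \<zero>\<^bsub>R\<^esub> \<and> y \<otimes>\<^bsub>G\<^esub> z = x}),
     one = (\<lambda>x. if x = \<one>\<^bsub>G\<^esub> then \<one>\<^bsub>R\<^esub> else \<zero>\<^bsub>R\<^esub>),
     zero = (\<lambda>x. \<zero>\<^bsub>R\<^esub>),
     add = (\<lambda>f g x. f x \<oplus>\<^bsub>R\<^esub> g x)\<rparr>"

abbreviation F2 :: "int ring"
  where "F2 \<equiv> residue_ring 2"

lemma (in abelian_monoid) finsum_swap:
  assumes "finite A" "finite B" "\<And>a b. a \<in> A \<Longrightarrow> b \<in> B \<Longrightarrow> f a b \<in> carrier G"
  shows "(\<Oplus>a\<in>A. \<Oplus>b\<in>B. f a b) = (\<Oplus>b\<in>B. \<Oplus>a\<in>A. f a b)"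
  using assms(1,3)
proof (induction A)
  case (insert x A)
  then have "(\<Oplus>a\<in>insert x A. \<Oplus>b\<in>B. f a b) = (\<Oplus>b\<in>B. f x b) \<oplus> (\<Oplus>b\<in>B. \<Oplus>a\<in>A. f a b)"
    by (subst finsum_insert) (auto intro!: finsum_closed)
  also have "\<dots> = (\<Oplus>b\<in>B. f x b \<oplus> (\<Oplus>a\<in>A. f a b))"
    using insert by (subst finsum_addf) (auto intro!: finsum_closed)
  also have "\<dots> = (\<Oplus>b\<in>B. \<Oplus>a\<in>insert x A. f a b)"
    using insert by (intro finsum_cong') (auto intro!: finsum_closed simp: finsum_insert Pi_def)
  finally show ?case .
qed simp

lemma group_ring_carrier_iff:
  "f \<in> carrier (group_ring R G) \<longleftrightarrow> (\<forall>x. f x \<in> carrier R) \<and> (\<forall>x. x \<notin> carrier G \<longrightarrow> f x = \<zero>\<^bsub>R\<^esub>)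
     \<and> finite {x. f x \<noteq> \<zero>\<^bsub>R\<^esub>}"
  by (auto simp: group_ring_def)

lemma group_ring_mult_apply:
  assumes "ring R" "group G"
    and f: "f \<in> carrier (group_ring R G)" and g: "g \<in> carrier (group_ring R G)"
    and A: "finite A" "A \<subseteq> carrier G" "\<And>u. f u \<noteq> \<zero>\<^bsub>R\<^esub> \<Longrightarrow> u \<in> A" and x: "x \<in> carrier G"
  shows "(f \<otimes>\<^bsub>group_ring R G\<^esub> g) x = (\<Oplus>\<^bsub>R\<^esub>u\<in>A. f u \<otimes>\<^bsub>R\<^esub> g (inv\<^bsub>G\<^esub> u \<otimes>\<^bsub>G\<^esub> x))"
proof -
  interpret R: ring R by fact
  interpret G: group G by fact
  note fg = f[unfolded group_ring_carrier_iff] g[unfolded group_ring_carrier_iff]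
  define D where "D = {u. f u \<noteq> \<zero>\<^bsub>R\<^esub> \<and> g (inv\<^bsub>G\<^esub> u \<otimes>\<^bsub>G\<^esub> x) \<noteq> \<zero>\<^bsub>R\<^esub>}"
  have D: "D \<subseteq> A" using A(3) by (auto simp: D_def)
  have "{(y, z). f y \<noteq> \<zero>\<^bsub>R\<^esub> \<and> g z \<noteq> \<zero>\<^bsub>R\<^esub> \<and> y \<otimes>\<^bsub>G\<^esub> z = x}
      = (\<lambda>u. (u, inv\<^bsub>G\<^esub> u \<otimes>\<^bsub>G\<^esub> x)) ` D" (is "?L = ?S")
  proof (intro equalityI subsetI)
    fix p assume "p \<in> ?L"
    then obtain y z where p: "p = (y, z)" "f y \<noteq> \<zero>\<^bsub>R\<^esub>" "g z \<noteq> \<zero>\<^bsub>R\<^esub>" "y \<otimes>\<^bsub>G\<^esub> z = x" by auto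
    then have "y \<in> carrier G" "z \<in> carrier G" using fg by blast+
    then have "inv\<^bsub>G\<^esub> y \<otimes>\<^bsub>G\<^esub> x = z" using p(4) G.inv_solve_left' by auto
    with p show "p \<in> ?S" by (auto simp: D_def)
  next
    fix p assume "p \<in> ?S"
    then obtain u where p: "p = (u, inv\<^bsub>G\<^esub> u \<otimes>\<^bsub>G\<^esub> x)" "u \<in> D" by auto
    then have "u \<in> carrier G" using D A(2) by auto
    with p x show "p \<in> ?L" by (auto simp: D_def simp flip: G.m_assoc)
  qed
  then have "(f \<otimes>\<^bsub>group_ring R G\<^esub> g) x
      = finsum R (\<lambda>(y, z). f y \<otimes>\<^bsub>R\<^esub> g z) ((\<lambda>u. (u, inv\<^bsub>G\<^esub> u \<otimes>\<^bsub>G\<^esub> x)) ` D)"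
    by (simp add: group_ring_def)
  also have "\<dots> = (\<Oplus>\<^bsub>R\<^esub>u\<in>D. f u \<otimes>\<^bsub>R\<^esub> g (inv\<^bsub>G\<^esub> u \<otimes>\<^bsub>G\<^esub> x))"
    by (subst R.finsum_reindex) (use fg in \<open>auto intro: inj_onI\<close>)
  also have "\<dots> = (\<Oplus>\<^bsub>R\<^esub>u\<in>A. f u \<otimes>\<^bsub>R\<^esub> g (inv\<^bsub>G\<^esub> u \<otimes>\<^bsub>G\<^esub> x))"
    using D A(1) fg by (intro R.add.finprod_mono_neutral_cong_left) (auto simp: D_def Pi_def)
  finally show ?thesis .
qed

lemma group_ring_mult_closed:
  assumes "ring R" "group G"
    and f: "f \<in> carrier (group_ring R G)" and g: "g \<in> carrier (group_ring R G)"
  shows "f \<otimes>\<^bsub>group_ring R G\<^esub> g \<in> carrier (group_ring R G)"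
proof -
  interpret R: ring R by fact
  interpret G: group G by fact
  note fg = f[unfolded group_ring_carrier_iff] g[unfolded group_ring_carrier_iff]
  let ?S = "(\<lambda>(y, z). y \<otimes>\<^bsub>G\<^esub> z) ` ({x. f x \<noteq> \<zero>\<^bsub>R\<^esub>} \<times> {x. g x \<noteq> \<zero>\<^bsub>R\<^esub>})"
  have nz: "x \<in> ?S" if "(f \<otimes>\<^bsub>group_ring R G\<^esub> g) x \<noteq> \<zero>\<^bsub>R\<^esub>" for x
  proof (rule ccontr)
    assume "x \<notin> ?S"
    then have "{(y, z). f y \<noteq> \<zero>\<^bsub>R\<^esub> \<and> g z \<noteq> \<zero>\<^bsub>R\<^esub> \<and> y \<otimes>\<^bsub>G\<^esub> z = x} = {}" by force
    then have "(f \<otimes>\<^bsub>group_ring R G\<^esub> g) x = \<zero>\<^bsub>R\<^esub>"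
      unfolding group_ring_def monoid.simps by (simp only: R.finsum_empty)
    with that show False by simp
  qed
  have S: "?S \<subseteq> carrier G" using fg by auto
  have finS: "finite ?S" using fg by auto
  have cl: "(f \<otimes>\<^bsub>group_ring R G\<^esub> g) x \<in> carrier R" for x
    using fg unfolding group_ring_def monoid.simps by (intro R.finsum_closed) auto
  have sub: "{x. (f \<otimes>\<^bsub>group_ring R G\<^esub> g) x \<noteq> \<zero>\<^bsub>R\<^esub>} \<subseteq> ?S" using nz by (intro subsetI) simp
  show ?thesis unfolding group_ring_carrier_iff
    using cl finite_subset[OF sub finS] order_trans[OF sub S] by blast
qed

lemma ring_group_ring:
  assumes "ring R" "group G"
  shows "ring (group_ring R G)"
proof -
  interpret R: ring R by fact
  interpret G: group G by fact
  let ?A = "group_ring R G"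
  note [simp] = group_ring_carrier_iff
  have eqI: "f = g" if "f \<in> carrier ?A" "g \<in> carrier ?A" "\<And>x. x \<in> carrier G \<Longrightarrow> f x = g x" for f g
    using that by (intro ext) (metis group_ring_carrier_iff)
  have mult: "f \<otimes>\<^bsub>?A\<^esub> g \<in> carrier ?A" if "f \<in> carrier ?A" "g \<in> carrier ?A" for f g
    by (rule group_ring_mult_closed[OF assms that])
  have add_apply: "(f \<oplus>\<^bsub>?A\<^esub> g) x = f x \<oplus>\<^bsub>R\<^esub> g x" for f g x
    by (simp add: group_ring_def)
  have add: "f \<oplus>\<^bsub>?A\<^esub> g \<in> carrier ?A" if "f \<in> carrier ?A" "g \<in> carrier ?A" for f g
  proof -
    have "finite ({x. f x \<noteq> \<zero>\<^bsub>R\<^esub>} \<union> {x. g x \<noteq> \<zero>\<^bsub>R\<^esub>})" using that by simp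
    then have "finite {x. (f \<oplus>\<^bsub>?A\<^esub> g) x \<noteq> \<zero>\<^bsub>R\<^esub>}"
      by (rule rev_finite_subset) (auto simp: add_apply)
    with that show ?thesis by (auto simp: add_apply)
  qed
  have one_apply: "\<one>\<^bsub>?A\<^esub> x = (if x = \<one>\<^bsub>G\<^esub> then \<one>\<^bsub>R\<^esub> else \<zero>\<^bsub>R\<^esub>)" for x
    by (simp add: group_ring_def)
  have one: "\<one>\<^bsub>?A\<^esub> \<in> carrier ?A"
    by (auto simp: one_apply)
  show ?thesis
  proof (rule ringI)
    show "abelian_group ?A"
    proof (rule abelian_groupI)
      fix f assume f: "f \<in> carrier ?A"
      then show "\<exists>g\<in>carrier ?A. g \<oplus>\<^bsub>?A\<^esub> f = \<zero>\<^bsub>?A\<^esub>"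
        by (intro bexI[of _ "\<lambda>x. \<ominus>\<^bsub>R\<^esub> f x"]) (auto simp: group_ring_def R.l_neg image_subset_iff)
    qed (auto simp: add simp del: group_ring_carrier_iff,
         auto simp: group_ring_def R.a_ac image_subset_iff intro!: ext)
    show "Group.monoid ?A"
    proof (rule monoidI)
      fix f assume f: "f \<in> carrier ?A"
      show "\<one>\<^bsub>?A\<^esub> \<otimes>\<^bsub>?A\<^esub> f = f"
      proof (rule eqI)
        fix x assume "x \<in> carrier G"
        then show "(\<one>\<^bsub>?A\<^esub> \<otimes>\<^bsub>?A\<^esub> f) x = f x"
          using f by (subst group_ring_mult_apply[OF assms one f, of "{\<one>\<^bsub>G\<^esub>}"])
            (auto simp: one_apply split: if_splits)
      qed (use f one mult in blast)+
      show "f \<otimes>\<^bsub>?A\<^esub> \<one>\<^bsub>?A\<^esub> = f"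
      proof (rule eqI)
        fix x assume x: "x \<in> carrier G"
        let ?S = "insert x {x. f x \<noteq> \<zero>\<^bsub>R\<^esub>}"
        have fin: "finite ?S" using f by simp
        have sub: "?S \<subseteq> carrier G" using f x by auto
        have "(f \<otimes>\<^bsub>?A\<^esub> \<one>\<^bsub>?A\<^esub>) x
            = (\<Oplus>\<^bsub>R\<^esub>u\<in>?S. f u \<otimes>\<^bsub>R\<^esub> \<one>\<^bsub>?A\<^esub> (inv\<^bsub>G\<^esub> u \<otimes>\<^bsub>G\<^esub> x))"
          by (rule group_ring_mult_apply[OF assms f one fin sub _ x]) auto
        also have "\<dots> = (\<Oplus>\<^bsub>R\<^esub>u\<in>?S. if x = u then f u else \<zero>\<^bsub>R\<^esub>)"
        proof (rule R.finsum_cong')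
          fix u assume "u \<in> ?S"
          then have u: "u \<in> carrier G" using sub by auto
          then have "inv\<^bsub>G\<^esub> u \<otimes>\<^bsub>G\<^esub> x = \<one>\<^bsub>G\<^esub> \<longleftrightarrow> x = u"
            using x by (metis G.inv_closed G.inv_equality G.inv_inv G.l_inv)
          then show "f u \<otimes>\<^bsub>R\<^esub> \<one>\<^bsub>?A\<^esub> (inv\<^bsub>G\<^esub> u \<otimes>\<^bsub>G\<^esub> x) = (if x = u then f u else \<zero>\<^bsub>R\<^esub>)"
            using f by (auto simp: one_apply)
        qed (use f in auto)
        also have "\<dots> = f x"
          using f fin by (subst R.finsum_singleton) auto
        finally show "(f \<otimes>\<^bsub>?A\<^esub> \<one>\<^bsub>?A\<^esub>) x = f x" .
      qed (use f one mult in blast)+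
    next
      fix f g h assume f: "f \<in> carrier ?A" and g: "g \<in> carrier ?A" and h: "h \<in> carrier ?A"
      let ?f = "{x. f x \<noteq> \<zero>\<^bsub>R\<^esub>}" and ?g = "{x. g x \<noteq> \<zero>\<^bsub>R\<^esub>}"
      let ?fg = "{x. (f \<otimes>\<^bsub>?A\<^esub> g) x \<noteq> \<zero>\<^bsub>R\<^esub>} \<union> (\<lambda>(y, z). y \<otimes>\<^bsub>G\<^esub> z) ` (?f \<times> ?g)"
      have fin: "finite ?f" "finite ?g" "finite ?fg"
        using f g mult[OF f g] by simp_all
      have sub: "?f \<subseteq> carrier G" "?g \<subseteq> carrier G" using f g by auto
      have subfg: "?fg \<subseteq> carrier G"
      proof -
        have "{x. (f \<otimes>\<^bsub>?A\<^esub> g) x \<noteq> \<zero>\<^bsub>R\<^esub>} \<subseteq> carrier G" using mult[OF f g] by auto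
        moreover have "(\<lambda>(y, z). y \<otimes>\<^bsub>G\<^esub> z) ` (?f \<times> ?g) \<subseteq> carrier G" using sub by auto
        ultimately show ?thesis by (rule Un_least)
      qed
      have [simp]: "f x \<in> carrier R" "g x \<in> carrier R" "h x \<in> carrier R" for x
        using f g h by auto
      show "f \<otimes>\<^bsub>?A\<^esub> g \<otimes>\<^bsub>?A\<^esub> h = f \<otimes>\<^bsub>?A\<^esub> (g \<otimes>\<^bsub>?A\<^esub> h)"
      proof (rule eqI)
        fix x assume x: "x \<in> carrier G"
        have "(f \<otimes>\<^bsub>?A\<^esub> g \<otimes>\<^bsub>?A\<^esub> h) x
            = (\<Oplus>\<^bsub>R\<^esub>w\<in>?fg. (f \<otimes>\<^bsub>?A\<^esub> g) w \<otimes>\<^bsub>R\<^esub> h (inv\<^bsub>G\<^esub> w \<otimes>\<^bsub>G\<^esub> x))"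
          by (rule group_ring_mult_apply[OF assms mult[OF f g] h fin(3) subfg _ x]) auto
        also have "\<dots> = (\<Oplus>\<^bsub>R\<^esub>w\<in>?fg. (\<Oplus>\<^bsub>R\<^esub>u\<in>?f.
            f u \<otimes>\<^bsub>R\<^esub> (g (inv\<^bsub>G\<^esub> u \<otimes>\<^bsub>G\<^esub> w) \<otimes>\<^bsub>R\<^esub> h (inv\<^bsub>G\<^esub> w \<otimes>\<^bsub>G\<^esub> x))))"
        proof (rule R.finsum_cong')
          fix w assume "w \<in> ?fg"
          then have w: "w \<in> carrier G" using subfg by blast
          have "(f \<otimes>\<^bsub>?A\<^esub> g) w = (\<Oplus>\<^bsub>R\<^esub>u\<in>?f. f u \<otimes>\<^bsub>R\<^esub> g (inv\<^bsub>G\<^esub> u \<otimes>\<^bsub>G\<^esub> w))"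
            by (rule group_ring_mult_apply[OF assms f g fin(1) sub(1) _ w]) auto
          then show "(f \<otimes>\<^bsub>?A\<^esub> g) w \<otimes>\<^bsub>R\<^esub> h (inv\<^bsub>G\<^esub> w \<otimes>\<^bsub>G\<^esub> x) = (\<Oplus>\<^bsub>R\<^esub>u\<in>?f.
            f u \<otimes>\<^bsub>R\<^esub> (g (inv\<^bsub>G\<^esub> u \<otimes>\<^bsub>G\<^esub> w) \<otimes>\<^bsub>R\<^esub> h (inv\<^bsub>G\<^esub> w \<otimes>\<^bsub>G\<^esub> x)))"
            using fin(1) by (simp add: R.finsum_ldistr R.m_assoc Pi_def)
        qed (auto intro!: R.finsum_closed)
        also have "\<dots> = (\<Oplus>\<^bsub>R\<^esub>u\<in>?f. (\<Oplus>\<^bsub>R\<^esub>w\<in>?fg.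
            f u \<otimes>\<^bsub>R\<^esub> (g (inv\<^bsub>G\<^esub> u \<otimes>\<^bsub>G\<^esub> w) \<otimes>\<^bsub>R\<^esub> h (inv\<^bsub>G\<^esub> w \<otimes>\<^bsub>G\<^esub> x))))"
          using fin by (intro R.finsum_swap) auto
        also have "\<dots> = (\<Oplus>\<^bsub>R\<^esub>u\<in>?f. f u \<otimes>\<^bsub>R\<^esub> (g \<otimes>\<^bsub>?A\<^esub> h) (inv\<^bsub>G\<^esub> u \<otimes>\<^bsub>G\<^esub> x))"
        proof (rule R.finsum_cong')
          fix u assume uf: "u \<in> ?f"
          then have u: "u \<in> carrier G" using sub by auto
          let ?V = "(\<lambda>w. inv\<^bsub>G\<^esub> u \<otimes>\<^bsub>G\<^esub> w) ` ?fg"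
          have "v \<in> ?V" if "g v \<noteq> \<zero>\<^bsub>R\<^esub>" for v
          proof (rule image_eqI)
            have "v \<in> carrier G" using that sub by auto
            then show "v = inv\<^bsub>G\<^esub> u \<otimes>\<^bsub>G\<^esub> (u \<otimes>\<^bsub>G\<^esub> v)" using u by (simp flip: G.m_assoc)
            show "u \<otimes>\<^bsub>G\<^esub> v \<in> ?fg" using uf that by auto
          qed
          then have "(g \<otimes>\<^bsub>?A\<^esub> h) (inv\<^bsub>G\<^esub> u \<otimes>\<^bsub>G\<^esub> x)
              = (\<Oplus>\<^bsub>R\<^esub>v\<in>?V. g v \<otimes>\<^bsub>R\<^esub> h (inv\<^bsub>G\<^esub> v \<otimes>\<^bsub>G\<^esub> (inv\<^bsub>G\<^esub> u \<otimes>\<^bsub>G\<^esub> x)))"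
            using u x fin subfg by (intro group_ring_mult_apply[OF assms g h]) blast+
          also have "\<dots> = (\<Oplus>\<^bsub>R\<^esub>w\<in>?fg. g (inv\<^bsub>G\<^esub> u \<otimes>\<^bsub>G\<^esub> w) \<otimes>\<^bsub>R\<^esub>
              h (inv\<^bsub>G\<^esub> (inv\<^bsub>G\<^esub> u \<otimes>\<^bsub>G\<^esub> w) \<otimes>\<^bsub>G\<^esub> (inv\<^bsub>G\<^esub> u \<otimes>\<^bsub>G\<^esub> x)))"
          proof (rule R.finsum_reindex)
            show "inj_on (\<lambda>w. inv\<^bsub>G\<^esub> u \<otimes>\<^bsub>G\<^esub> w) ?fg"
              by (rule inj_on_subset[OF _ subfg]) (use u in \<open>auto intro!: inj_onI\<close>)
          qed auto
          also have "\<dots> = (\<Oplus>\<^bsub>R\<^esub>w\<in>?fg. g (inv\<^bsub>G\<^esub> u \<otimes>\<^bsub>G\<^esub> w) \<otimes>\<^bsub>R\<^esub> h (inv\<^bsub>G\<^esub> w \<otimes>\<^bsub>G\<^esub> x))"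
          proof (rule R.finsum_cong')
            fix w assume "w \<in> ?fg"
            then have w: "w \<in> carrier G" using subfg by blast
            have "u \<otimes>\<^bsub>G\<^esub> (inv\<^bsub>G\<^esub> u \<otimes>\<^bsub>G\<^esub> x) = x"
              using u x by (simp flip: G.m_assoc)
            then have "inv\<^bsub>G\<^esub> (inv\<^bsub>G\<^esub> u \<otimes>\<^bsub>G\<^esub> w) \<otimes>\<^bsub>G\<^esub> (inv\<^bsub>G\<^esub> u \<otimes>\<^bsub>G\<^esub> x) = inv\<^bsub>G\<^esub> w \<otimes>\<^bsub>G\<^esub> x"
              using u w x by (simp add: G.inv_mult_group G.m_assoc)
            then show "g (inv\<^bsub>G\<^esub> u \<otimes>\<^bsub>G\<^esub> w) \<otimes>\<^bsub>R\<^esub>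
                h (inv\<^bsub>G\<^esub> (inv\<^bsub>G\<^esub> u \<otimes>\<^bsub>G\<^esub> w) \<otimes>\<^bsub>G\<^esub> (inv\<^bsub>G\<^esub> u \<otimes>\<^bsub>G\<^esub> x)) =
                g (inv\<^bsub>G\<^esub> u \<otimes>\<^bsub>G\<^esub> w) \<otimes>\<^bsub>R\<^esub> h (inv\<^bsub>G\<^esub> w \<otimes>\<^bsub>G\<^esub> x)"
              by simp
          qed auto
          finally show "(\<Oplus>\<^bsub>R\<^esub>w\<in>?fg.
                f u \<otimes>\<^bsub>R\<^esub> (g (inv\<^bsub>G\<^esub> u \<otimes>\<^bsub>G\<^esub> w) \<otimes>\<^bsub>R\<^esub> h (inv\<^bsub>G\<^esub> w \<otimes>\<^bsub>G\<^esub> x))) =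
              f u \<otimes>\<^bsub>R\<^esub> (g \<otimes>\<^bsub>?A\<^esub> h) (inv\<^bsub>G\<^esub> u \<otimes>\<^bsub>G\<^esub> x)"
            using fin(3) by (simp only:) (subst R.finsum_rdistr; auto)
        qed (use mult[OF g h] in auto)
        also have "\<dots> = (f \<otimes>\<^bsub>?A\<^esub> (g \<otimes>\<^bsub>?A\<^esub> h)) x"
          by (rule group_ring_mult_apply[OF assms f mult[OF g h] fin(1) sub(1) _ x, symmetric]) auto
        finally show "(f \<otimes>\<^bsub>?A\<^esub> g \<otimes>\<^bsub>?A\<^esub> h) x = (f \<otimes>\<^bsub>?A\<^esub> (g \<otimes>\<^bsub>?A\<^esub> h)) x" .
      qed (use f g h mult in blast)+
    qed (use one mult in blast)+
  next
    fix f g h assume f: "f \<in> carrier ?A" and g: "g \<in> carrier ?A" and h: "h \<in> carrier ?A"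
    have [simp]: "f x \<in> carrier R" "g x \<in> carrier R" "h x \<in> carrier R" for x
      using f g h by auto
    let ?S = "{x. f x \<noteq> \<zero>\<^bsub>R\<^esub>} \<union> {x. g x \<noteq> \<zero>\<^bsub>R\<^esub>}" and ?h = "{x. h x \<noteq> \<zero>\<^bsub>R\<^esub>}"
    have S: "finite ?S" "?S \<subseteq> carrier G" "finite ?h" "?h \<subseteq> carrier G" using f g h by auto
    show "(f \<oplus>\<^bsub>?A\<^esub> g) \<otimes>\<^bsub>?A\<^esub> h = f \<otimes>\<^bsub>?A\<^esub> h \<oplus>\<^bsub>?A\<^esub> g \<otimes>\<^bsub>?A\<^esub> h"
    proof (rule eqI)
      fix x assume x: "x \<in> carrier G"
      have "((f \<oplus>\<^bsub>?A\<^esub> g) \<otimes>\<^bsub>?A\<^esub> h) x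
          = (\<Oplus>\<^bsub>R\<^esub>u\<in>?S. (f \<oplus>\<^bsub>?A\<^esub> g) u \<otimes>\<^bsub>R\<^esub> h (inv\<^bsub>G\<^esub> u \<otimes>\<^bsub>G\<^esub> x))"
        by (rule group_ring_mult_apply[OF assms add[OF f g] h S(1,2) _ x]) (auto simp: add_apply)
      also have "\<dots> = (\<Oplus>\<^bsub>R\<^esub>u\<in>?S. f u \<otimes>\<^bsub>R\<^esub> h (inv\<^bsub>G\<^esub> u \<otimes>\<^bsub>G\<^esub> x)) \<oplus>\<^bsub>R\<^esub>
          (\<Oplus>\<^bsub>R\<^esub>u\<in>?S. g u \<otimes>\<^bsub>R\<^esub> h (inv\<^bsub>G\<^esub> u \<otimes>\<^bsub>G\<^esub> x))"
        by (subst R.finsum_addf[symmetric]) (auto simp: add_apply R.l_distr)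
      also have "(\<Oplus>\<^bsub>R\<^esub>u\<in>?S. f u \<otimes>\<^bsub>R\<^esub> h (inv\<^bsub>G\<^esub> u \<otimes>\<^bsub>G\<^esub> x)) = (f \<otimes>\<^bsub>?A\<^esub> h) x"
        by (rule group_ring_mult_apply[OF assms f h S(1,2) _ x, symmetric]) auto
      also have "(\<Oplus>\<^bsub>R\<^esub>u\<in>?S. g u \<otimes>\<^bsub>R\<^esub> h (inv\<^bsub>G\<^esub> u \<otimes>\<^bsub>G\<^esub> x)) = (g \<otimes>\<^bsub>?A\<^esub> h) x"
        by (rule group_ring_mult_apply[OF assms g h S(1,2) _ x, symmetric]) auto
      finally show "((f \<oplus>\<^bsub>?A\<^esub> g) \<otimes>\<^bsub>?A\<^esub> h) x = (f \<otimes>\<^bsub>?A\<^esub> h \<oplus>\<^bsub>?A\<^esub> g \<otimes>\<^bsub>?A\<^esub> h) x"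
        by (rule trans[OF _ add_apply[symmetric]])
    qed (use f g h mult add in blast)+
    show "h \<otimes>\<^bsub>?A\<^esub> (f \<oplus>\<^bsub>?A\<^esub> g) = h \<otimes>\<^bsub>?A\<^esub> f \<oplus>\<^bsub>?A\<^esub> h \<otimes>\<^bsub>?A\<^esub> g"
    proof (rule eqI)
      fix x assume x: "x \<in> carrier G"
      have "(h \<otimes>\<^bsub>?A\<^esub> (f \<oplus>\<^bsub>?A\<^esub> g)) x
          = (\<Oplus>\<^bsub>R\<^esub>u\<in>?h. h u \<otimes>\<^bsub>R\<^esub> (f \<oplus>\<^bsub>?A\<^esub> g) (inv\<^bsub>G\<^esub> u \<otimes>\<^bsub>G\<^esub> x))"
        by (rule group_ring_mult_apply[OF assms h add[OF f g] S(3,4) _ x]) auto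
      also have "\<dots> = (\<Oplus>\<^bsub>R\<^esub>u\<in>?h. h u \<otimes>\<^bsub>R\<^esub> f (inv\<^bsub>G\<^esub> u \<otimes>\<^bsub>G\<^esub> x)) \<oplus>\<^bsub>R\<^esub>
          (\<Oplus>\<^bsub>R\<^esub>u\<in>?h. h u \<otimes>\<^bsub>R\<^esub> g (inv\<^bsub>G\<^esub> u \<otimes>\<^bsub>G\<^esub> x))"
        by (subst R.finsum_addf[symmetric]) (auto simp: add_apply R.r_distr)
      also have "(\<Oplus>\<^bsub>R\<^esub>u\<in>?h. h u \<otimes>\<^bsub>R\<^esub> f (inv\<^bsub>G\<^esub> u \<otimes>\<^bsub>G\<^esub> x)) = (h \<otimes>\<^bsub>?A\<^esub> f) x"
        by (rule group_ring_mult_apply[OF assms h f S(3,4) _ x, symmetric]) auto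
      also have "(\<Oplus>\<^bsub>R\<^esub>u\<in>?h. h u \<otimes>\<^bsub>R\<^esub> g (inv\<^bsub>G\<^esub> u \<otimes>\<^bsub>G\<^esub> x)) = (h \<otimes>\<^bsub>?A\<^esub> g) x"
        by (rule group_ring_mult_apply[OF assms h g S(3,4) _ x, symmetric]) auto
      finally show "(h \<otimes>\<^bsub>?A\<^esub> (f \<oplus>\<^bsub>?A\<^esub> g)) x = (h \<otimes>\<^bsub>?A\<^esub> f \<oplus>\<^bsub>?A\<^esub> h \<otimes>\<^bsub>?A\<^esub> g) x"
        by (rule trans[OF _ add_apply[symmetric]])
    qed (use f g h mult add in blast)+
  qed
qed

lemma group_units_group_ring:
  "ring R \<Longrightarrow> group G \<Longrightarrow> group (units_of (group_ring R G))"
  by (intro monoid.units_group ring.is_monoid ring_group_ring)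

lemma field_F2: "field F2"
proof -
  interpret residues_prime 2 "residue_ring (int 2)"
    by unfold_locales auto
  show ?thesis using is_field by simp
qed

section \<open>Properties of groups\<close>

definition torsion_free :: "('a, 'b) monoid_scheme \<Rightarrow> bool"
  where "torsion_free G \<longleftrightarrow>
    (\<forall>x\<in>carrier G. \<forall>n::nat. n > 0 \<longrightarrow> x [^]\<^bsub>G\<^esub> n = \<one>\<^bsub>G\<^esub> \<longrightarrow> x = \<one>\<^bsub>G\<^esub>)"

definition finitely_generated :: "('a, 'b) monoid_scheme \<Rightarrow> bool"
  where "finitely_generated G \<longleftrightarrow>
    (\<exists>S. finite S \<and> S \<subseteq> carrier G \<and> generate G S = carrier G)"

text \<open>A basis of a free group \<open>G\<close> embeds into \<open>G\<close>, so it can be taken in the type of \<open>G\<close>.\<close>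

definition is_free_group :: "('a, 'b) monoid_scheme \<Rightarrow> bool"
  where "is_free_group G \<longleftrightarrow> (\<exists>S :: 'a set. G \<cong> free_group S)"

definition matrix_monoid :: "nat \<Rightarrow> ('k, 'm) ring_scheme \<Rightarrow> (nat \<times> nat \<Rightarrow> 'k) monoid"
  where "matrix_monoid n F =
    \<lparr>carrier = {..<n} \<times> {..<n} \<rightarrow>\<^sub>E carrier F,
     monoid.mult = (\<lambda>A B. \<lambda>(i, j)\<in>{..<n} \<times> {..<n}. \<Oplus>\<^bsub>F\<^esub>k\<in>{..<n}. A (i, k) \<otimes>\<^bsub>F\<^esub> B (k, j)),
     one = (\<lambda>(i, j)\<in>{..<n} \<times> {..<n}. if i = j then \<one>\<^bsub>F\<^esub> else \<zero>\<^bsub>F\<^esub>)\<rparr>"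

definition GL :: "nat \<Rightarrow> ('k, 'm) ring_scheme \<Rightarrow> (nat \<times> nat \<Rightarrow> 'k) monoid"
  where "GL n F = units_of (matrix_monoid n F)"

text \<open>HOL cannot quantify over the type of the field. If \<open>G\<close> embeds into \<open>GL n F\<close>, it embeds into
  \<open>GL n K\<close> for the subfield \<open>K\<close> generated by the matrix entries, and \<open>K\<close> injects into
  \<open>(nat + 'a) list\<close>. Hence fixing this type loses no generality; see \<open>linear_groupI\<close> below.\<close>

definition linear_group :: "('a, 'b) monoid_scheme \<Rightarrow> bool"
  where "linear_group G \<longleftrightarrow>
    (\<exists>n > 0. \<exists>F :: (nat + 'a) list ring. field F \<and> (\<exists>H. subgroup H (GL n F) \<and> G \<cong> (GL n F)\<lparr>carrier := H\<rparr>))"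

lemma monoid_matrix_monoid:
  assumes "ring R"
  shows "Group.monoid (matrix_monoid n R)"
proof -
  interpret R: ring R by fact
  let ?M = "matrix_monoid n R" and ?I = "{..<n} \<times> {..<n}"
  have entry: "A (i, j) \<in> carrier R" if "A \<in> carrier ?M" "i < n" "j < n" for A i j
    using that by (auto simp: matrix_monoid_def PiE_iff)
  have mult_apply: "(A \<otimes>\<^bsub>?M\<^esub> B) (i, j) = (\<Oplus>\<^bsub>R\<^esub>k\<in>{..<n}. A (i, k) \<otimes>\<^bsub>R\<^esub> B (k, j))"
    if "i < n" "j < n" for A B i j
    using that by (simp add: matrix_monoid_def)
  have one_apply: "\<one>\<^bsub>?M\<^esub> (i, j) = (if i = j then \<one>\<^bsub>R\<^esub> else \<zero>\<^bsub>R\<^esub>)" if "i < n" "j < n" for i j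
    using that by (simp add: matrix_monoid_def)
  have closed: "A \<otimes>\<^bsub>?M\<^esub> B \<in> carrier ?M" if "A \<in> carrier ?M" "B \<in> carrier ?M" for A B
    using that unfolding matrix_monoid_def
    by (auto simp: PiE_iff extensional_def intro!: R.finsum_closed)
  have one: "\<one>\<^bsub>?M\<^esub> \<in> carrier ?M"
    by (auto simp: matrix_monoid_def)
  have eqI: "A = B"
    if "A \<in> carrier ?M" "B \<in> carrier ?M" "\<And>i j. i < n \<Longrightarrow> j < n \<Longrightarrow> A (i, j) = B (i, j)" for A B
    using that by (intro extensionalityI[of A ?I B]) (auto simp: matrix_monoid_def PiE_iff)
  show ?thesis
  proof (rule monoidI)
    fix A assume A: "A \<in> carrier ?M"
    show "\<one>\<^bsub>?M\<^esub> \<otimes>\<^bsub>?M\<^esub> A = A"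
    proof (rule eqI)
      fix i j assume ij: "i < n" "j < n"
      have "(\<one>\<^bsub>?M\<^esub> \<otimes>\<^bsub>?M\<^esub> A) (i, j) = (\<Oplus>\<^bsub>R\<^esub>k\<in>{..<n}. if i = k then A (k, j) else \<zero>\<^bsub>R\<^esub>)"
        unfolding mult_apply[OF ij]
        by (rule R.finsum_cong') (use A ij in \<open>auto simp: one_apply entry\<close>)
      also have "\<dots> = A (i, j)"
        using ij A by (subst R.finsum_singleton) (auto simp: entry)
      finally show "(\<one>\<^bsub>?M\<^esub> \<otimes>\<^bsub>?M\<^esub> A) (i, j) = A (i, j)" .
    qed (use A one closed in auto)
    show "A \<otimes>\<^bsub>?M\<^esub> \<one>\<^bsub>?M\<^esub> = A"
    proof (rule eqI)
      fix i j assume ij: "i < n" "j < n"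
      have "(A \<otimes>\<^bsub>?M\<^esub> \<one>\<^bsub>?M\<^esub>) (i, j) = (\<Oplus>\<^bsub>R\<^esub>k\<in>{..<n}. if j = k then A (i, k) else \<zero>\<^bsub>R\<^esub>)"
        unfolding mult_apply[OF ij]
        by (rule R.finsum_cong') (use A ij in \<open>auto simp: one_apply entry\<close>)
      also have "\<dots> = A (i, j)"
        using ij A by (subst R.finsum_singleton) (auto simp: entry)
      finally show "(A \<otimes>\<^bsub>?M\<^esub> \<one>\<^bsub>?M\<^esub>) (i, j) = A (i, j)" .
    qed (use A one closed in auto)
  next
    fix A B C assume A: "A \<in> carrier ?M" and B: "B \<in> carrier ?M" and C: "C \<in> carrier ?M"
    show "A \<otimes>\<^bsub>?M\<^esub> B \<otimes>\<^bsub>?M\<^esub> C = A \<otimes>\<^bsub>?M\<^esub> (B \<otimes>\<^bsub>?M\<^esub> C)"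
    proof (rule eqI)
      fix i j assume ij: "i < n" "j < n"
      have "(A \<otimes>\<^bsub>?M\<^esub> B \<otimes>\<^bsub>?M\<^esub> C) (i, j)
          = (\<Oplus>\<^bsub>R\<^esub>l\<in>{..<n}. \<Oplus>\<^bsub>R\<^esub>k\<in>{..<n}. A (i, k) \<otimes>\<^bsub>R\<^esub> (B (k, l) \<otimes>\<^bsub>R\<^esub> C (l, j)))"
        unfolding mult_apply[OF ij]
      proof (rule R.finsum_cong')
        fix l assume "l \<in> {..<n}"
        then have l: "l < n" by simp
        have "(A \<otimes>\<^bsub>?M\<^esub> B) (i, l) \<otimes>\<^bsub>R\<^esub> C (l, j) = (\<Oplus>\<^bsub>R\<^esub>k\<in>{..<n}. A (i, k) \<otimes>\<^bsub>R\<^esub> B (k, l) \<otimes>\<^bsub>R\<^esub> C (l, j))"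
          using A B C ij l by (simp add: mult_apply R.finsum_ldistr entry Pi_def)
        also have "\<dots> = (\<Oplus>\<^bsub>R\<^esub>k\<in>{..<n}. A (i, k) \<otimes>\<^bsub>R\<^esub> (B (k, l) \<otimes>\<^bsub>R\<^esub> C (l, j)))"
          using A B C ij l by (intro R.finsum_cong') (auto simp: entry R.m_assoc)
        finally show "(A \<otimes>\<^bsub>?M\<^esub> B) (i, l) \<otimes>\<^bsub>R\<^esub> C (l, j)
          = (\<Oplus>\<^bsub>R\<^esub>k\<in>{..<n}. A (i, k) \<otimes>\<^bsub>R\<^esub> (B (k, l) \<otimes>\<^bsub>R\<^esub> C (l, j)))" .
      qed (use A B C ij in \<open>auto simp: entry intro!: R.finsum_closed\<close>)
      also have "\<dots> = (\<Oplus>\<^bsub>R\<^esub>k\<in>{..<n}. \<Oplus>\<^bsub>R\<^esub>l\<in>{..<n}. A (i, k) \<otimes>\<^bsub>R\<^esub> (B (k, l) \<otimes>\<^bsub>R\<^esub> C (l, j)))"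
        using A B C ij by (intro R.finsum_swap) (auto simp: entry)
      also have "\<dots> = (A \<otimes>\<^bsub>?M\<^esub> (B \<otimes>\<^bsub>?M\<^esub> C)) (i, j)"
        unfolding mult_apply[OF ij] using A B C ij
        by (intro R.finsum_cong')
          (auto simp: mult_apply R.finsum_rdistr entry Pi_def intro!: R.finsum_closed)
      finally show "(A \<otimes>\<^bsub>?M\<^esub> B \<otimes>\<^bsub>?M\<^esub> C) (i, j) = (A \<otimes>\<^bsub>?M\<^esub> (B \<otimes>\<^bsub>?M\<^esub> C)) (i, j)" .
    qed (use A B C closed in auto)
  qed (use one closed in auto)
qed

lemma group_GL: "ring R \<Longrightarrow> group (GL n R)"
  unfolding GL_def by (intro monoid.units_group monoid_matrix_monoid)

datatype 'h field_term = T_One | T_Gen 'h | T_Neg "'h field_term" | T_Inv "'h field_term"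
  | T_Add "'h field_term" "'h field_term" | T_Mult "'h field_term" "'h field_term"

primrec eval_term :: "('k, 'm) ring_scheme \<Rightarrow> ('h \<Rightarrow> 'k) \<Rightarrow> 'h field_term \<Rightarrow> 'k" where
  "eval_term F e T_One = \<one>\<^bsub>F\<^esub>"
| "eval_term F e (T_Gen h) = e h"
| "eval_term F e (T_Neg s) = \<ominus>\<^bsub>F\<^esub> eval_term F e s"
| "eval_term F e (T_Inv s) = inv\<^bsub>F\<^esub> eval_term F e s"
| "eval_term F e (T_Add s t) = eval_term F e s \<oplus>\<^bsub>F\<^esub> eval_term F e t"
| "eval_term F e (T_Mult s t) = eval_term F e s \<otimes>\<^bsub>F\<^esub> eval_term F e t"

primrec code_term :: "('a \<times> nat \<times> nat) field_term \<Rightarrow> (nat + 'a) list" where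
  "code_term T_One = [Inl 0]"
| "code_term (T_Gen h) = [Inl 1, Inr (fst h), Inl (fst (snd h)), Inl (snd (snd h))]"
| "code_term (T_Neg s) = Inl 2 # code_term s"
| "code_term (T_Inv s) = Inl 3 # code_term s"
| "code_term (T_Add s t) = Inl 4 # code_term s @ code_term t"
| "code_term (T_Mult s t) = Inl 5 # code_term s @ code_term t"

lemma code_term_prefix: "code_term s @ v = code_term t @ w \<Longrightarrow> s = t \<and> v = w"
proof (induction s arbitrary: t v w)
  case (T_Add s1 s2)
  show ?case
  proof (cases t)
    case t: (T_Add t1 t2)
    have "s1 = t1 \<and> code_term s2 @ v = code_term t2 @ w"
      using T_Add.prems by (intro T_Add.IH(1)) (simp add: t)
    then show ?thesis using T_Add.IH(2)[of v t2 w] by (simp add: t)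
  qed (use T_Add.prems in auto)
next
  case (T_Mult s1 s2)
  show ?case
  proof (cases t)
    case t: (T_Mult t1 t2)
    have "s1 = t1 \<and> code_term s2 @ v = code_term t2 @ w"
      using T_Mult.prems by (intro T_Mult.IH(1)) (simp add: t)
    then show ?thesis using T_Mult.IH(2)[of v t2 w] by (simp add: t)
  qed (use T_Mult.prems in auto)
next
  case T_One
  then show ?case by (cases t) auto
next
  case (T_Gen h)
  then show ?case by (cases t) (auto simp: prod_eq_iff)
next
  case (T_Neg s)
  then show ?case by (cases t) auto
next
  case (T_Inv s)
  then show ?case by (cases t) auto
qed

lemma inj_code_term: "inj code_term"
  using code_term_prefix[of _ "[]" _ "[]"] by (auto intro: injI)

lemma generate_field_eval_term:
  "x \<in> generate_field F (range e) \<Longrightarrow> \<exists>t. eval_term F e t = x"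
proof (induction rule: generate_field.induct)
  case (incl h)
  then show ?case by (metis eval_term.simps(2) imageE)
qed (metis eval_term.simps)+

lemma linear_groupI:
  fixes G :: "('a, 'b) monoid_scheme" and F :: "('k, 'm) ring_scheme"
  assumes "group G" "field F" "n > 0" "subgroup H (GL n F)" "G \<cong> (GL n F)\<lparr>carrier := H\<rparr>"
  shows "linear_group G"
proof -
  interpret G: group G by fact
  interpret F: field F by fact
  let ?I = "{..<n} \<times> {..<n}" and ?M = "matrix_monoid n F"
  have grF: "group (GL n F)" by (rule group_GL) (rule F.ring_axioms)
  from assms(5) obtain \<phi> where \<phi>: "\<phi> \<in> iso G ((GL n F)\<lparr>carrier := H\<rparr>)" by (auto simp: is_iso_def)
  have H: "H \<subseteq> Units ?M"
    using subgroup.subset[OF assms(4)] by (simp add: GL_def units_of_carrier)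
  have \<phi>_mat: "\<phi> g \<in> carrier ?M" if "g \<in> carrier G" for g
    using \<phi> H that by (auto simp: iso_def hom_def Units_def)
  have \<phi>_hom: "\<phi> \<in> hom G (GL n F)"
    using \<phi> subgroup.subset[OF assms(4)] by (auto simp: iso_def hom_def)
  have \<phi>_mult: "\<phi> (g \<otimes>\<^bsub>G\<^esub> h) = \<phi> g \<otimes>\<^bsub>?M\<^esub> \<phi> h" if "g \<in> carrier G" "h \<in> carrier G" for g h
    using hom_mult[OF \<phi>_hom that] by (simp add: GL_def units_of_mult)
  have \<phi>_one: "\<phi> \<one>\<^bsub>G\<^esub> = \<one>\<^bsub>?M\<^esub>"
    using hom_one[OF \<phi>_hom assms(1) grF] by (simp add: GL_def units_of_one)
  have \<phi>_inj: "inj_on \<phi> (carrier G)" using \<phi> by (auto simp: iso_def bij_betw_def)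

  define e where "e = (\<lambda>(g, i, j). if g \<in> carrier G \<and> i < n \<and> j < n then \<phi> g (i, j) else \<one>\<^bsub>F\<^esub>)"
  define E where "E = generate_field F (range e)"
  define F0 where "F0 = F\<lparr>carrier := E\<rparr>"
  have e: "range e \<subseteq> carrier F"
    using \<phi>_mat by (auto simp: e_def matrix_monoid_def PiE_iff)
  interpret F0: field F0
    unfolding F0_def E_def by (rule F.generate_field_is_field[OF e])
  have EF: "E \<subseteq> carrier F" unfolding E_def by (rule F.generate_field_incl[OF e])
  have \<phi>_E: "\<phi> g (i, j) \<in> E" if "g \<in> carrier G" "i < n" "j < n" for g i j
  proof -
    have "e (g, i, j) \<in> E" unfolding E_def by (intro generate_field.incl) auto
    with that show ?thesis by (simp add: e_def)
  qed
  define f where "f x = code_term (SOME t. eval_term F e t = x)" for x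
  have f_inj: "inj_on f (carrier F0)"
  proof (rule inj_onI)
    fix x y assume xy: "x \<in> carrier F0" "y \<in> carrier F0" "f x = f y"
    have "(SOME t. eval_term F e t = x) = (SOME t. eval_term F e t = y)"
      by (rule injD[OF inj_code_term]) (use xy(3) in \<open>simp only: f_def\<close>)
    moreover have "eval_term F e (SOME t. eval_term F e t = z) = z" if "z \<in> carrier F0" for z
    proof -
      have "z \<in> generate_field F (range e)" using that by (simp add: F0_def E_def)
      then show ?thesis by (rule someI_ex[OF generate_field_eval_term])
    qed
    ultimately show "x = y" using xy(1,2) by metis
  qed
  define K where "K = image_ring f F0"
  interpret K: field K unfolding K_def by (rule F0.inj_imp_image_ring_is_field[OF f_inj])
  have "f \<in> ring_hom F0 K"
    using inj_imp_image_ring_iso[OF f_inj] by (simp add: K_def ring_iso_def)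
  then interpret f: ring_hom_ring F0 K f
    by (intro ring_hom_ringI2 F0.ring_axioms K.ring_axioms)
  have f_K: "f x \<in> carrier K" if "x \<in> E" for x
    using f.hom_closed that by (simp add: F0_def)
  have f_sum: "finsum F u A \<in> E \<and> f (finsum F u A) = (\<Oplus>\<^bsub>K\<^esub>x\<in>A. f (u x))"
    if "finite A" "u \<in> A \<rightarrow> E" for A and u :: "nat \<Rightarrow> 'k"
    using that
  proof (induction A)
    case empty
    then show ?case using f.hom_zero F0.zero_closed by (simp add: F0_def)
  next
    case (insert x A)
    then have "finsum F u (insert x A) = u x \<oplus>\<^bsub>F0\<^esub> finsum F u A"
      using EF by (subst F.finsum_insert) (auto simp: F0_def)
    moreover have "(\<Oplus>\<^bsub>K\<^esub>x\<in>insert x A. f (u x)) = f (u x) \<oplus>\<^bsub>K\<^esub> (\<Oplus>\<^bsub>K\<^esub>x\<in>A. f (u x))"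
      using insert f_K by (subst K.finsum_insert) (auto simp: Pi_def)
    ultimately show ?case
      using insert f.hom_add[of "u x" "finsum F u A"] F0.a_closed[of "u x" "finsum F u A"]
      by (simp add: F0_def)
  qed
  have f_mult: "x \<otimes>\<^bsub>F\<^esub> y \<in> E \<and> f (x \<otimes>\<^bsub>F\<^esub> y) = f x \<otimes>\<^bsub>K\<^esub> f y" if "x \<in> E" "y \<in> E" for x y
    using that f.hom_mult[of x y] F0.m_closed[of x y] by (simp add: F0_def)

  let ?N = "matrix_monoid n K"
  define \<psi> where "\<psi> g = (\<lambda>p\<in>?I. f (\<phi> g p))" for g
  have \<psi>_mat: "\<psi> g \<in> carrier ?N" if "g \<in> carrier G" for g
    using that \<phi>_E f_K by (auto simp: \<psi>_def matrix_monoid_def)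
  have \<psi>_mult: "\<psi> (g \<otimes>\<^bsub>G\<^esub> h) = \<psi> g \<otimes>\<^bsub>?N\<^esub> \<psi> h" if gh: "g \<in> carrier G" "h \<in> carrier G" for g h
  proof (rule ext, clarify)
    fix i j
    show "\<psi> (g \<otimes>\<^bsub>G\<^esub> h) (i, j) = (\<psi> g \<otimes>\<^bsub>?N\<^esub> \<psi> h) (i, j)"
    proof (cases "i < n \<and> j < n")
      case True
      then have ij: "i < n" "j < n" by auto
      have "\<psi> (g \<otimes>\<^bsub>G\<^esub> h) (i, j) = f (\<Oplus>\<^bsub>F\<^esub>k\<in>{..<n}. \<phi> g (i, k) \<otimes>\<^bsub>F\<^esub> \<phi> h (k, j))"
        using ij gh by (simp add: \<psi>_def \<phi>_mult) (simp add: matrix_monoid_def)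
      also have "\<dots> = (\<Oplus>\<^bsub>K\<^esub>k\<in>{..<n}. f (\<phi> g (i, k) \<otimes>\<^bsub>F\<^esub> \<phi> h (k, j)))"
        using ij gh \<phi>_E f_mult by (intro f_sum[THEN conjunct2]) auto
      also have "\<dots> = (\<Oplus>\<^bsub>K\<^esub>k\<in>{..<n}. \<psi> g (i, k) \<otimes>\<^bsub>K\<^esub> \<psi> h (k, j))"
        using ij gh \<phi>_E f_mult f_K by (intro K.finsum_cong') (auto simp: \<psi>_def)
      also have "\<dots> = (\<psi> g \<otimes>\<^bsub>?N\<^esub> \<psi> h) (i, j)"
        using ij by (simp add: matrix_monoid_def)
      finally show ?thesis .
    qed (auto simp: \<psi>_def matrix_monoid_def)
  qed
  have \<psi>_one: "\<psi> \<one>\<^bsub>G\<^esub> = \<one>\<^bsub>?N\<^esub>"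
    using f.hom_one f.hom_zero by (auto simp: \<psi>_def \<phi>_one matrix_monoid_def F0_def intro!: restrict_ext)
  have \<psi>_unit: "\<psi> g \<in> Units ?N" if "g \<in> carrier G" for g
    unfolding Units_def using that \<psi>_mat[of g] \<psi>_mat[of "inv\<^bsub>G\<^esub> g"]
      \<psi>_mult[of g "inv\<^bsub>G\<^esub> g"] \<psi>_mult[of "inv\<^bsub>G\<^esub> g" g] \<psi>_one by auto
  have \<psi>_inj: "inj_on \<psi> (carrier G)"
  proof (rule inj_onI)
    fix g h assume gh: "g \<in> carrier G" "h \<in> carrier G" "\<psi> g = \<psi> h"
    have "\<phi> g = \<phi> h"
    proof (rule extensionalityI)
      show "\<phi> g \<in> extensional ?I" "\<phi> h \<in> extensional ?I"
        using \<phi>_mat gh by (auto simp: matrix_monoid_def PiE_iff)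
      fix p assume p: "p \<in> ?I"
      then have "f (\<phi> g p) = f (\<phi> h p)"
        using fun_cong[OF gh(3), of p] by (simp add: \<psi>_def)
      then show "\<phi> g p = \<phi> h p"
        using f_inj gh p \<phi>_E by (auto simp: F0_def dest!: inj_onD)
    qed
    then show "g = h" using \<phi>_inj gh by (auto dest: inj_onD)
  qed
  have grK: "group (GL n K)" by (rule group_GL) (rule K.ring_axioms)
  have hom: "\<psi> \<in> hom G (GL n K)"
    using \<psi>_unit \<psi>_mult by (auto simp: hom_def GL_def units_of_carrier units_of_mult)
  then interpret \<psi>: group_hom G "GL n K" \<psi>
    using assms(1) grK by (simp add: group_hom_def group_hom_axioms_def)
  have "\<psi> \<in> iso G ((GL n K)\<lparr>carrier := \<psi> ` carrier G\<rparr>)"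
    using \<psi>_inj hom by (auto simp: iso_def bij_betw_def hom_def)
  then show ?thesis
    unfolding linear_group_def using assms(3) K.field_axioms \<psi>.img_is_subgroup is_isoI by blast
qed

end

theory Submission
  imports Defs "HOL-Library.Poly_Mapping" "HOL-Library.Z2" "HOL-Library.Product_Plus"
    "HOL-Computational_Algebra.Computational_Algebra"
begin

text \<open>Let \<open>x = a\<^sup>2\<close>, \<open>y = b\<^sup>2\<close>, \<open>z = (ab)\<^sup>2\<close> and \<open>R = \<bbbF>\<^sub>2[x\<^sup>\<plusminus>\<^sup>1, y\<^sup>\<plusminus>\<^sup>1, z\<^sup>\<plusminus>\<^sup>1]\<close>. The group ring is the crossed
  product \<open>R \<oplus> R a \<oplus> R b \<oplus> R ab\<close>, and its regular representation over \<open>R\<close> is linear.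

  Give \<open>a - 1\<close> and \<open>b - 1\<close> weight 2 and \<open>c - 1\<close>, where \<open>c\<close> is the commutator of \<open>a\<close> and \<open>b\<close>, weight 5. The
  associated graded ring is a commutative polynomial ring, so there are no nilpotent elements. A unit
  of odd order \<open>m\<close> has augmentation 1, and \<open>(1 + w)\<^sup>m = 1 + w\<close> up to twice the weight of \<open>w\<close>, so it is trivial.

  The quotient of \<open>P\<close> by \<open>\<langle>y, z\<rangle>\<close> is infinite dihedral, and its group ring embeds into the \<open>2 \<times> 2\<close> matrices over
  \<open>\<bbbF>\<^sub>2[s]\<close>, where \<open>s\<close> is the image of \<open>a + a\<^sup>-\<^sup>1\<close>. Hence the units map to \<open>SL\<^sub>2(\<bbbF>\<^sub>2[s])\<close>. By Nagao's theorem
  this is an amalgam which maps onto \<open>\<bbbF>\<^sub>2[s] / \<bbbF>\<^sub>2\<close>. Gardam's unit and its images under \<open>a \<mapsto> a\<^bsup>2n+1\<^esup>\<close> have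
  images of unbounded degree there, so the group of units is not finitely generated. The images of
  \<open>a\<close> and of Gardam's unit are \<open>w E(s)\<close> and \<open>w E(s\<^sup>3)\<close>, with \<open>w\<close> the swap matrix and \<open>E(f)\<close> elementary, and
  their squares generate a free group by ping-pong.\<close>

text \<open>The weights are forced. Since (a - 1)^2 = x - 1 and (b - 1)^2 = y - 1, these squares
  weigh 4. For a - 1 and b - 1 to commute in the graded ring, c - 1 must weigh more than 4. For
  elements of R to commute with a - 1 there, conjugation by a must change each of them by something
  at least 3 heavier; it changes c by a unit times (1 + y z^-1)^2, of weight 8, so c - 1 weighs at
  most 5. The absence of nilpotents disposes of 2-power order, because (1 + u)^(2^k) = 1 + u^(2^k)
  in characteristic 2. The dihedral quotient has torsion, so it serves only the last two claims.
  There the elements of P would not suffice: P is finitely generated, and its image in SL_2 has an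
  abelian subgroup of index 2. Ping-pong is played with squares because the product of w E(f) with
  the inverse of w E(g) is w E(f + g) w, an involution in characteristic 2.\<close>

class ring_char_2 = ring_1 +
  assumes one_add_one_eq_0: "1 + 1 = 0"
begin

lemma add_self [simp]: "x + x = 0"
proof -
  have "x + x = (1 + 1) * x" by (simp only: distrib_right mult_1_left)
  also have "\<dots> = 0" by (simp only: one_add_one_eq_0 mult_zero_left)
  finally show ?thesis .
qed

lemma add_self_left [simp]: "x + (x + y) = y"
  by (simp add: add_assoc [symmetric])

lemma uminus_char_2: "- x = x"
  by (rule minus_unique) simp

lemma diff_char_2: "x - y = x + y"
  using add_uminus_conv_diff [of x y] by (simp only: uminus_char_2)

lemma add_eq_0_char_2: "x + y = 0 \<longleftrightarrow> x = y"
  using diff_char_2 [of x y] by (metis right_minus_eq)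

lemma of_nat_char_2: "of_nat n = (if even n then 0 else 1)"
  by (induction n) (auto simp: one_add_one_eq_0 simp del: one_add_one)

text \<open>A formal sum over the field with two elements is determined by its support, and adding
  formal sums takes the symmetric difference. The terms over \<open>A \<inter> B\<close> occur twice
  and cancel.\<close>

lemma sum_insert_sym_diff:
  fixes f :: "'b \<Rightarrow> 'a"
  assumes "finite A" "finite B"
  shows "sum f ((A - B) \<union> (B - A)) = sum f A + sum f B"
proof -
  have "sum f A = sum f (A - B) + sum f (A \<inter> B)" 
    using assms by (subst sum.union_disjoint [symmetric]) (auto intro: sum.cong)
  moreover have "sum f B = sum f (B - A) + sum f (A \<inter> B)"
    using assms by (subst sum.union_disjoint [symmetric]) (auto intro: sum.cong)
  moreover have "sum f ((A - B) \<union> (B - A)) = sum f (A - B) + sum f (B - A)"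
    using assms by (subst sum.union_disjoint) auto
  ultimately show ?thesis by (simp add: ac_simps)
qed

end

instance bit :: ring_char_2
  by standard simp

instance poly_mapping :: (monoid_add, ring_char_2) ring_char_2
proof
  have "(1 + 1 :: 'b) = 0" by (rule one_add_one_eq_0)
  then show "(1 + 1 :: 'a \<Rightarrow>\<^sub>0 'b) = 0"
    by (simp flip: single_one single_add)
qed

instance poly :: ("{ring_char_2, comm_ring_1}") ring_char_2
proof
  show "(1 + 1 :: 'a poly) = 0"
    by (simp add: one_pCons one_add_one_eq_0)
qed

instance fps :: ("{ring_char_2, comm_ring_1}") ring_char_2
proof
  show "(1 + 1 :: 'a fps) = 0"
    by (simp only: fps_one_def fps_eq_iff fps_add_nth fps_nth_Abs_fps) (auto simp del: one_add_one simp: one_add_one_eq_0)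
qed


section \<open>Laurent polynomials over the field with two elements\<close>

text \<open>As 1 is the only nonzero coefficient, there is no case for scalar multiples: an identity
  additive in \<open>r\<close> need only be checked on monomials.\<close>

lemma poly_mapping_bit_induct [case_names zero single add]:
  fixes r :: "'a \<Rightarrow>\<^sub>0 bit"
  assumes "P 0" "\<And>k. P (Poly_Mapping.single k 1)" "\<And>r s. P r \<Longrightarrow> P s \<Longrightarrow> P (r + s)"
  shows "P r"
proof -
  have "P (\<Sum>k\<in>A. Poly_Mapping.single k (Poly_Mapping.lookup r k))"
    if "finite A" "A \<subseteq> Poly_Mapping.keys r" for A
    using that
  proof (induction A)
    case (insert k A)
    then have "Poly_Mapping.lookup r k = 1" by (auto simp: in_keys_iff)
    then show ?case using insert assms(2)[of k] by (simp add: assms(3))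
  qed (simp add: assms(1))
  moreover have "(\<Sum>k\<in>Poly_Mapping.keys r. Poly_Mapping.single k (Poly_Mapping.lookup r k)) = r"
    by (rule poly_mapping_eqI) (auto simp: lookup_sum lookup_single when_def in_keys_iff)
  ultimately show ?thesis by (metis finite_keys order_refl)
qed

text \<open>Extension of \<open>\<phi>\<close> from monomials; all coefficients on the support are
  1, so none appears. It is additive once the target has characteristic 2.\<close>

definition lift :: "('a \<Rightarrow> 'b::comm_monoid_add) \<Rightarrow> ('a \<Rightarrow>\<^sub>0 bit) \<Rightarrow> 'b"
  where "lift \<phi> r = sum \<phi> (Poly_Mapping.keys r)"

lemma lift_0 [simp]: "lift \<phi> 0 = 0"
  by (simp add: lift_def)

lemma lift_single [simp]: "lift \<phi> (Poly_Mapping.single k 1) = \<phi> k"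
  by (simp add: lift_def)

lemma lift_1 [simp]: "lift \<phi> 1 = \<phi> 0"
  by (simp flip: single_one)

lemma keys_add_bit:
  fixes r s :: "'a \<Rightarrow>\<^sub>0 bit"
  shows "Poly_Mapping.keys (r + s) = (Poly_Mapping.keys r - Poly_Mapping.keys s) \<union>
    (Poly_Mapping.keys s - Poly_Mapping.keys r)"
  by (auto simp: in_keys_iff lookup_add)

lemma lift_add [simp]: "lift \<phi> (r + s) = lift \<phi> r + (lift \<phi> s :: 'b::ring_char_2)"
  by (simp add: lift_def keys_add_bit sum_insert_sym_diff)

lemma lift_mult:
  fixes \<phi> :: "'a::monoid_add \<Rightarrow> 'b::ring_char_2"
  assumes "\<And>k l. \<phi> (k + l) = \<phi> k * \<phi> l"
  shows "lift \<phi> (r * s) = lift \<phi> r * lift \<phi> s"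
proof (induction r rule: poly_mapping_bit_induct)
  case (single k)
  show ?case
    by (induction s rule: poly_mapping_bit_induct) (simp_all add: mult_single assms distrib_left)
qed (simp_all add: distrib_right)

text \<open>To be used when \<open>v\<close> is the inverse of \<open>u\<close>.\<close>

definition upow :: "'a::monoid_mult \<Rightarrow> 'a \<Rightarrow> int \<Rightarrow> 'a"
  where "upow u v i = (if i \<ge> 0 then u ^ nat i else v ^ nat (- i))"

lemma upow_0 [simp]: "upow u v 0 = 1"
  and upow_1 [simp]: "upow u v 1 = u"
  and upow_m1 [simp]: "upow u v (- 1) = v"
  by (auto simp: upow_def)

lemma upow_plus_one:
  assumes "u * v = 1" "v * u = (1::'a::monoid_mult)"
  shows "upow u v (i + 1) = u * upow u v i"
proof (cases "i \<ge> 0")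
  case True
  then show ?thesis by (simp add: upow_def nat_add_distrib)
next
  case False
  then have "nat (- i) = Suc (nat (- (i + 1)))" by auto
  then have "upow u v i = v * v ^ nat (- (i + 1))" using False by (simp add: upow_def)
  moreover have "upow u v (i + 1) = v ^ nat (- (i + 1))"
    using False by (auto simp: upow_def)
  ultimately show ?thesis using assms by (simp add: mult.assoc [symmetric])
qed

lemma upow_add:
  assumes "u * v = 1" "v * u = (1::'a::monoid_mult)"
  shows "upow u v (i + j) = upow u v i * upow u v j"
proof (induction i rule: int_induct [of _ 0])
  case (step1 i)
  have "upow u v (i + 1 + j) = u * upow u v (i + j)"
    using upow_plus_one [OF assms, of "i + j"] by (simp add: ac_simps)
  then show ?case by (simp add: step1 upow_plus_one [OF assms] mult.assoc)
next
  case (step2 i)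
  have *: "upow u v k = v * upow u v (k + 1)" for k
    by (simp add: upow_plus_one [OF assms] assms mult.assoc [symmetric])
  show ?case using step2 *[of "i - 1"] *[of "i - 1 + j"]
    by (simp add: ac_simps add_diff_eq diff_add_eq)
qed simp

section \<open>Laurent polynomials in x, y, z and conjugation by a and b\<close>

type_synonym laurent = "(int \<times> int \<times> int) \<Rightarrow>\<^sub>0 bit"

abbreviation lmono :: "int \<Rightarrow> int \<Rightarrow> int \<Rightarrow> laurent"
  where "lmono i j k \<equiv> Poly_Mapping.single (i, j, k) 1"

lemma mono_mult: "lmono i j k * lmono i' j' k' = lmono (i + i') (j + j') (k + k')"
  by (simp add: mult_single)

lemma mono_mult_left: "lmono i j k * (lmono i' j' k' * r) = lmono (i + i') (j + j') (k + k') * r"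
  by (simp add: mult_single flip: mult.assoc)

lemma mono_0 [simp]: "lmono 0 0 0 = 1"
  by (simp add: zero_prod_def flip: single_one)

text \<open>Conjugation r -> a r a^-1 on R, with \<open>twist_b\<close> doing the same for b: each
  of a and b commutes with its own square and inverts the other two of x, y, z.\<close>

definition twist_a :: "laurent \<Rightarrow> laurent"
  where "twist_a = lift (\<lambda>(i, j, k). lmono i (- j) (- k))"

definition twist_b :: "laurent \<Rightarrow> laurent"
  where "twist_b = lift (\<lambda>(i, j, k). lmono (- i) j (- k))"

lemma twist_simps [simp]:
  "twist_a 0 = 0" "twist_a 1 = 1" "twist_a (r + s) = twist_a r + twist_a s"
  "twist_a (lmono i j k) = lmono i (- j) (- k)"
  "twist_b 0 = 0" "twist_b 1 = 1" "twist_b (r + s) = twist_b r + twist_b s"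
  "twist_b (lmono i j k) = lmono (- i) j (- k)"
  by (simp_all add: twist_a_def twist_b_def zero_prod_def)

lemma twist_mult [simp]:
  "twist_a (r * s) = twist_a r * twist_a s" "twist_b (r * s) = twist_b r * twist_b s"
  by (auto simp: twist_a_def twist_b_def mult_single intro!: lift_mult)

lemma twist_twist [simp]:
  "twist_a (twist_a r) = r" "twist_b (twist_b r) = r" "twist_b (twist_a r) = twist_a (twist_b r)"
proof -
  have *: "twist_a (twist_a r) = r \<and> twist_b (twist_b r) = r \<and> twist_b (twist_a r) = twist_a (twist_b r)"
  proof (induction r rule: poly_mapping_bit_induct)
    case (single k)
    show ?case by (cases k) simp
  qed simp_all
  from * show "twist_a (twist_a r) = r" "twist_b (twist_b r) = r" "twist_b (twist_a r) = twist_a (twist_b r)"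
    by auto
qed

text \<open>A monomial factor as an operator rather than as a product: \<open>shift_simps\<close>
  moves such factors to the front and merges their exponents, which turns associativity of the
  crossed product into a matter of rewriting.\<close>

definition shift :: "int \<Rightarrow> int \<Rightarrow> int \<Rightarrow> laurent \<Rightarrow> laurent"
  where "shift i j k r = lmono i j k * r"

lemma shift_simps [simp]:
  "shift i j k (r + s) = shift i j k r + shift i j k s"
  "shift i j k r * s = shift i j k (r * s)"
  "r * shift i j k s = shift i j k (r * s)"
  "shift i j k (shift i' j' k' r) = shift (i + i') (j + j') (k + k') r"
  "shift 0 0 0 r = r" "shift i j k 0 = 0"
  "twist_a (shift i j k r) = shift i (- j) (- k) (twist_a r)"
  "twist_b (shift i j k r) = shift (- i) j (- k) (twist_b r)"
  by (simp_all add: shift_def mono_mult_left mult_single algebra_simps)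

lemma shift_mono: "shift i j k (lmono i' j' k') = lmono (i + i') (j + j') (k + k')"
  by (simp add: shift_def mono_mult)

text \<open>The crossed product \<open>R \<oplus> R a \<oplus> R b \<oplus> R ab\<close>, in which \<open>a\<^sup>2 = x\<close>, \<open>b\<^sup>2 = y\<close> and \<open>(ab)\<^sup>2 = z\<close>,
  hence \<open>ba = x\<^sup>-\<^sup>1 y z\<^sup>-\<^sup>1 ab\<close>.\<close>

datatype crossed = Crossed (ce: laurent) (ca: laurent) (cb: laurent) (cab: laurent)

lemma crossed_eq_iff: "u = v \<longleftrightarrow> ce u = ce v \<and> ca u = ca v \<and> cb u = cb v \<and> cab u = cab v"
  by (auto intro: crossed.expand)

instantiation crossed :: ring_1
begin

definition "0 = Crossed 0 0 0 0"
definition "1 = Crossed 1 0 0 0"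
definition "u + v = Crossed (ce u + ce v) (ca u + ca v) (cb u + cb v) (cab u + cab v)"
definition "- u = Crossed (- ce u) (- ca u) (- cb u) (- cab u)"
definition "u - v = Crossed (ce u - ce v) (ca u - ca v) (cb u - cb v) (cab u - cab v)"

text \<open>Coefficients stand on the left, so those of \<open>v\<close> are conjugated by the basis
  element of \<open>u\<close> that they pass. The shifts are the products of basis elements, for
  instance b ab = x^-1 y z^-1 ab b = x^-1 z^-1 a.\<close>

definition "u * v = Crossed
  (ce u * ce v + shift 1 0 0 (ca u * twist_a (ca v)) + shift 0 1 0 (cb u * twist_b (cb v))
    + shift 0 0 1 (cab u * twist_a (twist_b (cab v))))
  (ce u * ca v + ca u * twist_a (ce v) + shift (- 1) 0 (- 1) (cb u * twist_b (cab v))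
    + shift 0 (- 1) 0 (cab u * twist_a (twist_b (cb v))))
  (ce u * cb v + cb u * twist_b (ce v) + shift 1 0 0 (ca u * twist_a (cab v))
    + shift 0 (- 1) 1 (cab u * twist_a (twist_b (ca v))))
  (ce u * cab v + cab u * twist_a (twist_b (ce v)) + ca u * twist_a (cb v)
    + shift (- 1) 1 (- 1) (cb u * twist_b (ca v)))"

lemma crossed_sel [simp]:
  "ce 0 = 0" "ca 0 = 0" "cb 0 = 0" "cab 0 = 0"
  "ce 1 = 1" "ca 1 = 0" "cb 1 = 0" "cab 1 = 0"
  "ce (u + v) = ce u + ce v" "ca (u + v) = ca u + ca v"
  "cb (u + v) = cb u + cb v" "cab (u + v) = cab u + cab v"
  "ce (u - v) = ce u - ce v" "ca (u - v) = ca u - ca v"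
  "cb (u - v) = cb u - cb v" "cab (u - v) = cab u - cab v"
  "ce (- u) = - ce u" "ca (- u) = - ca u" "cb (- u) = - cb u" "cab (- u) = - cab u"
  by (simp_all add: zero_crossed_def one_crossed_def plus_crossed_def minus_crossed_def
      uminus_crossed_def)

lemma crossed_mult_sel:
  "ce (u * v) = ce u * ce v + shift 1 0 0 (ca u * twist_a (ca v)) + shift 0 1 0 (cb u * twist_b (cb v))
    + shift 0 0 1 (cab u * twist_a (twist_b (cab v)))"
  "ca (u * v) = ce u * ca v + ca u * twist_a (ce v) + shift (- 1) 0 (- 1) (cb u * twist_b (cab v))
    + shift 0 (- 1) 0 (cab u * twist_a (twist_b (cb v)))"
  "cb (u * v) = ce u * cb v + cb u * twist_b (ce v) + shift 1 0 0 (ca u * twist_a (cab v))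
    + shift 0 (- 1) 1 (cab u * twist_a (twist_b (ca v)))"
  "cab (u * v) = ce u * cab v + cab u * twist_a (twist_b (ce v)) + ca u * twist_a (cb v)
    + shift (- 1) 1 (- 1) (cb u * twist_b (ca v))"
  by (simp_all add: times_crossed_def)

instance
proof
  fix u v w :: crossed
  show "u * v * w = u * (v * w)"
    by (simp only: crossed_eq_iff crossed_mult_sel, intro conjI;
        simp add: algebra_simps)
qed (simp_all add: crossed_eq_iff crossed_mult_sel algebra_simps)

end

instance crossed :: ring_char_2
  by standard (simp only: crossed_eq_iff crossed_sel one_add_one_eq_0 add_self)

section \<open>The weight filtration\<close>

text \<open>The filtration is by ideals: \<open>x - 1\<close> and \<open>y - 1\<close> have weight 4 and \<open>c - 1\<close> has
  weight 5, where \<open>c = x y\<^sup>-\<^sup>1 z\<close> is the commutator of \<open>a\<close> and \<open>b\<close>.\<close>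

abbreviation "lX \<equiv> lmono 1 0 0 + 1"
abbreviation "lY \<equiv> lmono 0 1 0 + 1"
abbreviation "lC \<equiv> lmono 1 (- 1) 1 + 1"

inductive filt :: "int \<Rightarrow> laurent \<Rightarrow> bool" where
  \<comment> \<open>Nonpositive levels are the whole ring, so the shifted levels n - 2 and n - 4 in
    \<open>cfilt\<close> need no case distinction.\<close>
  base: "n \<le> 0 \<Longrightarrow> filt n r"
| X: "filt n r \<Longrightarrow> filt (n + 4) (lX * r)"
| Y: "filt n r \<Longrightarrow> filt (n + 4) (lY * r)"
| C: "filt n r \<Longrightarrow> filt (n + 5) (lC * r)"
| add: "filt n r \<Longrightarrow> filt n s \<Longrightarrow> filt n (r + s)"
| less: "filt n r \<Longrightarrow> m \<le> n \<Longrightarrow> filt m r"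

lemma filt_smult: "filt n r \<Longrightarrow> filt n (t * r)"
proof (induction rule: filt.induct)
  case (X n r)
  then show ?case using filt.X[of n "t * r"] by (simp only: ac_simps)
next
  case (Y n r)
  then show ?case using filt.Y[of n "t * r"] by (simp only: ac_simps)
next
  case (C n r)
  then show ?case using filt.C[of n "t * r"] by (simp only: ac_simps)
next
  case (add n r s)
  then show ?case by (simp only: distrib_left filt.add)
qed (auto intro: filt.base filt.less)

lemma filt_mult: "filt m r \<Longrightarrow> filt n s \<Longrightarrow> filt (m + n) (r * s)"
proof (induction rule: filt.induct)
  case (base m r)
  then show ?case by (auto intro: filt.less [OF filt_smult])
next
  case (X m r)
  then show ?case using filt.X[of "m + n" "r * s"] by (simp only: ac_simps)
next
  case (Y m r)
  then show ?case using filt.Y[of "m + n" "r * s"] by (simp only: ac_simps)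
next
  case (C m r)
  then show ?case using filt.C[of "m + n" "r * s"] by (simp only: ac_simps)
next
  case (add m r r')
  then show ?case by (simp only: distrib_right filt.add)
next
  case (less m r m')
  then show ?case by (auto intro: filt.less)
qed

lemma filt_mult_le: "filt m r \<Longrightarrow> filt n s \<Longrightarrow> k \<le> m + n \<Longrightarrow> filt k (r * s)"
  by (rule filt.less [OF filt_mult])

lemma filt_0: "filt n 0"
proof -
  have "filt (int k * 4) 0" for k
  proof (induction k)
    case (Suc k)
    then show ?case using filt.X[of "int k * 4" 0] by (simp add: algebra_simps)
  qed (simp add: filt.base)
  from this [of "nat n"] show ?thesis by (rule filt.less) auto
qed

lemma filt_lX: "filt 4 lX" and filt_lY: "filt 4 lY" and filt_lC: "filt 5 lC"
  using filt.X[of 0 1] filt.Y[of 0 1] filt.C[of 0 1] by (simp_all add: filt.base)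

lemma filt_cong_iff: "filt n (r + s) \<Longrightarrow> filt n r \<longleftrightarrow> filt n s"
  using filt.add[of n "r + s" s] filt.add[of n "r + s" r]
  by (auto simp: ac_simps)

lemma filt_mono_plus_1:
  assumes "filt n (lmono i j k + 1)"
  shows "filt n (lmono (m * i) (m * j) (m * k) + 1)"
proof -
  have *: "filt n (lmono (int m * i) (int m * j) (int m * k) + 1)" for m
  proof (induction m)
    case 0
    show ?case by (simp add: filt_0)
  next
    case (Suc m)
    let ?u = "lmono (int m * i) (int m * j) (int m * k)"
    have "lmono (int (Suc m) * i) (int (Suc m) * j) (int (Suc m) * k) + 1
        = lmono i j k * (?u + 1) + (lmono i j k + 1)"
      by (simp add: algebra_simps mult_single)
    with Suc show ?case by (metis filt.add filt_smult assms)
  qed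
  show ?thesis
  proof (cases "m \<ge> 0")
    case True
    then show ?thesis using *[of "nat m"] by simp
  next
    case False
    have "lmono (m * i) (m * j) (m * k) + 1
      = lmono (m * i) (m * j) (m * k) * (lmono (- m * i) (- m * j) (- m * k) + 1)"
      by (simp add: distrib_left mult_single)
    then show ?thesis using *[of "nat (- m)"] False filt_smult by simp
  qed
qed

lemma filt_mono: "filt 4 (lmono i j k + 1)"
proof -
  have x: "filt 4 (lmono i 0 0 + 1)" for i
    using filt_mono_plus_1 [OF filt_lX, of i] by simp
  have y: "filt 4 (lmono 0 j 0 + 1)" for j
    using filt_mono_plus_1 [OF filt_lY, of j] by simp
  have c: "filt 4 (lmono k (- k) k + 1)" for k
    using filt.less[OF filt_mono_plus_1 [OF filt_lC, of k], of 4] by simp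
  \<comment> \<open>The factorization x^i y^j z^k = x^(i-k) y^(j+k) c^k, peeled off one factor at a
    time.\<close>
  have "lmono i j k + 1 = lmono (i - k) 0 0 * (lmono 0 (j + k) 0 * (lmono k (- k) k + 1)
      + (lmono 0 (j + k) 0 + 1)) + (lmono (i - k) 0 0 + 1)"
    by (simp add: distrib_left mult_single add.assoc)
  then show ?thesis using x y c by (metis filt.add filt_smult)
qed

text \<open>All monomials are congruent to 1 modulo weight 4, so the class of \<open>r\<close> is
  its augmentation.\<close>

lemma filt_4_cases: "filt 4 r \<or> filt 4 (r + 1)"
proof (induction r rule: poly_mapping_bit_induct)
  case (single k)
  then show ?case using filt_mono by (cases k) auto
next
  case (add r s)
  have "r + s + 1 = (r + 1) + s" "r + s + 1 = r + (s + 1)" "r + s = (r + 1) + (s + 1)"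
    by (simp_all add: ac_simps)
  with add show ?case by (metis filt.add)
qed (simp add: filt_0)

text \<open>The identity t (g r) + g r = t g (t r + r) + (t g + g) r gains 3 in its first term by
  induction. The second term has weight n + 8 against the required n + w + 3, so a generator g may
  weigh at most w = 5. The case \<open>base\<close> uses that all monomials agree modulo weight
  4.\<close>

lemma filt_twist_diff:
  fixes t :: "laurent \<Rightarrow> laurent"
  assumes t: "\<And>r s. t (r + s) = t r + t s" "\<And>r s. t (r * s) = t r * t s"
    and gen: "\<And>i j k. \<exists>i' j' k'. t (lmono i j k) = lmono i' j' k'"
    and X: "filt 8 (t lX + lX)" and Y: "filt 8 (t lY + lY)" and C: "filt 8 (t lC + lC)"
    and "filt n r"
  shows "filt (n + 3) (t r + r)"
proof -
  have t0: "t 0 = 0" using t(1)[of 0 0] by simp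
  have step: "filt (n + w + 3) (t (g * r) + g * r)"
    if "filt w g" "filt 8 (t g + g)" "filt n r" "filt (n + 3) (t r + r)" "w \<le> 5" for n w g r
  proof -
    have "filt w (t g)"
      using that filt.less[of 8 "t g + g" w] filt_cong_iff by auto
    then have "filt (w + (n + 3)) (t g * (t r + r))" "filt (8 + n) ((t g + g) * r)"
      using that by (auto intro: filt_mult)
    then have "filt (n + w + 3) (t g * (t r + r) + (t g + g) * r)"
      using that by (intro filt.add) (auto elim: filt.less)
    moreover have "t g * (t r + r) + (t g + g) * r = t (g * r) + g * r"
      by (simp add: t algebra_simps)
    ultimately show ?thesis by simp
  qed
  from \<open>filt n r\<close> show ?thesis
  proof (induction rule: filt.induct)
    case (base n r)
    have "filt 4 (t r + r)"
    proof (induction r rule: poly_mapping_bit_induct)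
      case (single k)
      obtain i j l where k: "k = (i, j, l)" by (cases k)
      obtain i' j' l' where t: "t (lmono i j l) = lmono i' j' l'" using gen by blast
      have "filt 4 ((lmono i' j' l' + 1) + (lmono i j l + 1))"
        by (intro filt.add filt_mono)
      then show ?case by (simp add: k t ac_simps)
    next
      case (add r s)
      then show ?case using filt.add[of 4 "t r + r" "t s + s"] by (simp add: t ac_simps)
    qed (simp add: t0 filt_0)
    then show ?case by (rule filt.less) (use base in simp)
  next
    case (X n r)
    then show ?case using step[OF filt_lX \<open>filt 8 (t lX + lX)\<close>] by simp
  next
    case (Y n r)
    then show ?case using step[OF filt_lY \<open>filt 8 (t lY + lY)\<close>] by simp
  next
    case (C n r)
    then show ?case using step[OF filt_lC \<open>filt 8 (t lC + lC)\<close>] by simp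
  next
    case (add n r s)
    then show ?case using filt.add[of "n + 3" "t r + r" "t s + s"] by (simp add: t ac_simps)
  next
    case (less n r m)
    then show ?case by (auto elim: filt.less)
  qed
qed

text \<open>In characteristic 2 the changes of the generators under conjugation have this shape, for
  instance y^-1 + y = y^-1 (y + 1)^2.\<close>

lemma filt_square: "filt 8 (lmono i j k * ((lmono i' j' k' + 1) * (lmono i' j' k' + 1)))"
  by (rule filt_smult, rule filt_mult_le[OF filt_mono filt_mono]) simp

lemma filt_twist_a: "filt n r \<Longrightarrow> filt (n + 3) (twist_a r + r)"
  by (rule filt_twist_diff)
    (use filt_0 filt_square[of 0 "- 1" 0 0 1 0] filt_square[of "- 1" 1 "- 1" 1 0 0]
        filt_square[of 0 "- 1" 0 0 1 0]
        filt_square[of 1 "- 1" 1 0 1 "- 1"] in \<open>auto simp: algebra_simps mult_single\<close>)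

lemma filt_twist_b: "filt n r \<Longrightarrow> filt (n + 3) (twist_b r + r)"
  by (rule filt_twist_diff)
    (use filt_0 filt_square[of "- 1" 0 0 1 0 0] filt_square[of "- 1" "- 1" "- 1" 1 0 1]
       in \<open>auto simp: algebra_simps mult_single\<close>)

lemma filt_twist:
  assumes "filt n r"
  shows "filt n (twist_a r)" "filt n (twist_b r)"
  using filt_twist_a[OF assms] filt_twist_b[OF assms] assms
  by (auto dest: filt.less[of _ _ n] simp: filt_cong_iff)

section \<open>Specialisation to power series and leading forms\<close>

abbreviation alpha :: "bit poly poly" where "alpha \<equiv> [:[:0, 1:]:]"
abbreviation beta :: "bit poly poly" where "beta \<equiv> [:0, 1:]"

definition leadX :: "bit poly poly fps" where "leadX = fps_const alpha * fps_X ^ 4"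
definition leadY :: "bit poly poly fps" where "leadY = fps_const beta * fps_X ^ 4"
definition leadC :: "bit poly poly fps" where "leadC = fps_X ^ 5"

text \<open>The coefficients form no field, so the inverse of a series with constant term 1 is built
  from the inverse 1 of that constant term.\<close>

definition finv :: "bit poly poly fps \<Rightarrow> bit poly poly fps"
  where "finv f = fps_right_inverse f 1"

lemma finv: "f $ 0 = 1 \<Longrightarrow> f * finv f = 1" "f $ 0 = 1 \<Longrightarrow> finv f * f = 1"
  by (simp_all add: finv_def fps_right_inverse mult.commute[of _ f])

definition upw :: "bit poly poly fps \<Rightarrow> int \<Rightarrow> bit poly poly fps"
  where "upw f = upow (1 + f) (finv (1 + f))"

lemma upw_simps [simp]: "upw f 0 = 1" "upw f 1 = 1 + f" 
  by (simp_all add: upw_def)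

lemma upw_add: "f $ 0 = 0 \<Longrightarrow> upw f (i + j) = upw f i * upw f j"
  by (simp add: upw_def upow_add finv)

lemma lead_nth_0 [simp]: "leadX $ 0 = 0" "leadY $ 0 = 0" "leadC $ 0 = 0"
  by (simp_all add: leadX_def leadY_def leadC_def)

text \<open>The specialisation \<open>x = 1 + \<alpha> T\<^sup>4\<close>, \<open>y = 1 + \<beta> T\<^sup>4\<close>, \<open>c = 1 + T\<^sup>5\<close>, so that the order in \<open>T\<close>
  detects the filtration; note that \<open>x\<^sup>i y\<^sup>j z\<^sup>k = x\<^bsup>i-k\<^esup> y\<^bsup>j+k\<^esup> c\<^sup>k\<close>.\<close>

definition spec :: "laurent \<Rightarrow> bit poly poly fps"
  where "spec = lift (\<lambda>(i, j, k). upw leadX (i - k) * upw leadY (j + k) * upw leadC k)"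

lemma spec_0 [simp]: "spec 0 = 0"
  and spec_1 [simp]: "spec 1 = 1"
  and spec_add [simp]: "spec (r + s) = spec r + spec s"
  and spec_mult [simp]: "spec (r * s) = spec r * spec s"
proof -
  show "spec (r * s) = spec r * spec s"
    unfolding spec_def
  proof (rule lift_mult, clarsimp)
    fix i j k i' j' k'
    have "upw leadX (i + i' - (k + k')) = upw leadX (i - k) * upw leadX (i' - k')"
      "upw leadY (j + j' + (k + k')) = upw leadY (j + k) * upw leadY (j' + k')"
      "upw leadC (k + k') = upw leadC k * upw leadC k'"
      by (simp_all add: algebra_simps flip: upw_add)
    then show "upw leadX (i + i' - (k + k')) * upw leadY (j + j' + (k + k')) * upw leadC (k + k') =
       upw leadX (i - k) * upw leadY (j + k) * upw leadC k *
       (upw leadX (i' - k') * upw leadY (j' + k') * upw leadC k')"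
      by (simp only: ac_simps)
  qed
qed (simp_all add: spec_def zero_prod_def)

lemma spec_power [simp]: "spec (r ^ n) = spec r ^ n"
  by (induction n) simp_all

lemma spec_sum: "spec (sum f A) = (\<Sum>i\<in>A. spec (f i))"
  by (induction A rule: infinite_finite_induct) simp_all

lemma spec_lead [simp]: "spec lX = leadX" "spec lY = leadY" "spec lC = leadC"
  by (simp_all add: ac_simps, simp_all add: spec_def ac_simps)

lemma spec_lead_mult:
  "spec (lX * r) = leadX * spec r" "spec (lY * r) = leadY * spec r" "spec (lC * r) = leadC * spec r"
  by (simp_all only: spec_mult spec_lead)

lemma spec_nth_eq_0: "filt n r \<Longrightarrow> int k < n \<Longrightarrow> spec r $ k = 0"
proof (induction arbitrary: k rule: filt.induct)
  case (X n r)
  then show ?case unfolding spec_lead_mult leadX_def mult.assoc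
    by (subst fps_mult_left_const_nth) (simp add: fps_X_power_mult_nth)
next
  case (Y n r)
  then show ?case unfolding spec_lead_mult leadY_def mult.assoc
    by (subst fps_mult_left_const_nth) (simp add: fps_X_power_mult_nth)
next
  case (C n r)
  then show ?case unfolding spec_lead_mult leadC_def by (simp add: fps_X_power_mult_nth)
qed auto

definition leadmono :: "nat \<times> nat \<times> nat \<Rightarrow> laurent"
  where "leadmono = (\<lambda>(i, j, k). lX ^ i * lY ^ j * lC ^ k)"

lemma spec_leadmono:
  "spec (leadmono (i, j, k)) = fps_const (alpha ^ i * beta ^ j) * fps_X ^ (4 * i + 4 * j + 5 * k)"
proof -
  have "spec (leadmono (i, j, k)) = leadX ^ i * leadY ^ j * leadC ^ k"
    by (simp only: leadmono_def case_prod_conv spec_mult spec_power spec_lead)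
  also have "\<dots> = fps_const (alpha ^ i * beta ^ j) * fps_X ^ (4 * i + 4 * j + 5 * k)"
    by (simp only: leadX_def leadY_def leadC_def power_mult_distrib power_add power_mult [symmetric]
        fps_const_power fps_const_mult [symmetric] ac_simps)
  finally show ?thesis .
qed

text \<open>The graded ring is spanned by the monomials in the classes of \<open>lX\<close>,
  \<open>lY\<close> and \<open>lC\<close>. Coefficients being 0 or 1, a leading form is a set
  \<open>F\<close> of exponents, and sums become symmetric differences.\<close>

lemma filt_leading_part:
  assumes "filt n r"
  shows "\<exists>F. finite F \<and> (\<forall>(i, j, k)\<in>F. int (4 * i + 4 * j + 5 * k) = n) \<and>
    filt (n + 1) (r + sum leadmono F)"
  using assms
proof (induction rule: filt.induct)
  case (base n r)
  show ?case
  proof (cases "n < 0")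
    case True
    then show ?thesis by (intro exI[of _ "{}"]) (auto intro: filt.base)
  next
    case False
    with base have [simp]: "n = 0" by simp
    show ?thesis
    proof (cases "filt 4 r")
      case True
      then show ?thesis by (intro exI[of _ "{}"]) (auto intro: filt.less)
    next
      case False
      then have "filt 4 (r + 1)" using filt_4_cases by blast
      then show ?thesis
        by (intro exI[of _ "{(0, 0, 0)}"]) (auto simp: leadmono_def intro: filt.less)
    qed
  qed
next
  case (X n r)
  then obtain F where F: "finite F" "\<forall>(i, j, k)\<in>F. int (4 * i + 4 * j + 5 * k) = n"
    "filt (n + 1) (r + sum leadmono F)" by blast
  have "sum leadmono ((\<lambda>(i, j, k). (Suc i, j, k)) ` F) = lX * sum leadmono F"
    by (subst sum.reindex)
      (auto simp: inj_on_def sum_distrib_left leadmono_def case_prod_unfold ac_simps)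
  with F filt.X[OF F(3)] show ?case
    by (intro exI[of _ "(\<lambda>(i, j, k). (Suc i, j, k)) ` F"]) (auto simp: algebra_simps)
next
  case (Y n r)
  then obtain F where F: "finite F" "\<forall>(i, j, k)\<in>F. int (4 * i + 4 * j + 5 * k) = n"
    "filt (n + 1) (r + sum leadmono F)" by blast
  have "sum leadmono ((\<lambda>(i, j, k). (i, Suc j, k)) ` F) = lY * sum leadmono F"
    by (subst sum.reindex)
      (auto simp: inj_on_def sum_distrib_left leadmono_def case_prod_unfold ac_simps)
  with F filt.Y[OF F(3)] show ?case
    by (intro exI[of _ "(\<lambda>(i, j, k). (i, Suc j, k)) ` F"]) (auto simp: algebra_simps)
next
  case (C n r)
  then obtain F where F: "finite F" "\<forall>(i, j, k)\<in>F. int (4 * i + 4 * j + 5 * k) = n"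
    "filt (n + 1) (r + sum leadmono F)" by blast
  have "sum leadmono ((\<lambda>(i, j, k). (i, j, Suc k)) ` F) = lC * sum leadmono F"
    by (subst sum.reindex)
      (auto simp: inj_on_def sum_distrib_left leadmono_def case_prod_unfold ac_simps)
  with F filt.C[OF F(3)] show ?case
    by (intro exI[of _ "(\<lambda>(i, j, k). (i, j, Suc k)) ` F"]) (auto simp: algebra_simps)
next
  case (add n r s)
  then obtain F G where F: "finite F" "\<forall>(i, j, k)\<in>F. int (4 * i + 4 * j + 5 * k) = n"
    "filt (n + 1) (r + sum leadmono F)"
    and G: "finite G" "\<forall>(i, j, k)\<in>G. int (4 * i + 4 * j + 5 * k) = n"
    "filt (n + 1) (s + sum leadmono G)" by blast
  show ?case
    using F G filt.add[OF F(3) G(3)]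
    by (intro exI[of _ "(F - G) \<union> (G - F)"]) (auto simp: sum_insert_sym_diff ac_simps)
next
  case (less n r m)
  show ?case
  proof (cases "m = n")
    case False
    with less show ?thesis by (intro exI[of _ "{}"]) (auto intro: filt.less)
  qed (use less in blast)
qed

lemma coeff_alpha_beta:
  "poly.coeff (poly.coeff (alpha ^ i * beta ^ j) j') i' = (if i = i' \<and> j = j' then 1 else 0)"
proof -
  have "alpha ^ i = [:Polynomial.monom 1 i:]" "beta ^ j = Polynomial.monom 1 j"
    by (simp_all add: poly_const_pow monom_altdef)
  then show ?thesis by (simp add: Polynomial.coeff_monom)
qed

text \<open>The converse of \<open>spec_nth_eq_0\<close>, one level at a time. Once the weight is
  fixed, i and j determine k, so distinct elements of \<open>F\<close> give distinct monomials
  \<open>alpha ^ i * beta ^ j\<close>, and their sum vanishes only if \<open>F\<close> is empty. For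
  this reason c - 1 gets no variable of its own in \<open>spec\<close>.\<close>

lemma filt_Suc:
  assumes "filt n r" "n \<ge> 0" "spec r $ nat n = 0"
  shows "filt (n + 1) r"
proof -
  obtain F where F': "finite F" "\<forall>(i, j, k)\<in>F. int (4 * i + 4 * j + 5 * k) = n"
    "filt (n + 1) (r + sum leadmono F)"
    using filt_leading_part[OF assms(1)] by blast
  have F: "finite F" "\<And>i j k. (i, j, k) \<in> F \<Longrightarrow> int (4 * i + 4 * j + 5 * k) = n"
    "filt (n + 1) (r + sum leadmono F)"
    using F' by auto
  have "spec (r + sum leadmono F) $ nat n = 0"
    using F(3) assms(2) by (intro spec_nth_eq_0) auto
  then have "(\<Sum>p\<in>F. spec (leadmono p) $ nat n) = 0"
    unfolding spec_add spec_sum fps_add_nth fps_sum_nth assms(3) by (simp only: add_0_left)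
  also have "(\<Sum>p\<in>F. spec (leadmono p) $ nat n) = (\<Sum>(i, j, k)\<in>F. alpha ^ i * beta ^ j)"
  proof (rule sum.cong, simp, clarify)
    fix i j k assume "(i, j, k) \<in> F"
    from F(2)[OF this] have "nat n = 4 * i + 4 * j + 5 * k" by linarith
    then show "spec (leadmono (i, j, k)) $ nat n = alpha ^ i * beta ^ j"
      unfolding spec_leadmono by (simp only: fps_mult_left_const_nth fps_X_power_nth) simp
  qed
  finally have sum: "(\<Sum>(i, j, k)\<in>F. alpha ^ i * beta ^ j) = 0" .
  have "F = {}"
  proof (rule ccontr)
    assume "F \<noteq> {}"
    then obtain i0 j0 k0 where p: "(i0, j0, k0) \<in> F" by (auto simp: ex_in_conv[symmetric])
    have "0 = poly.coeff (poly.coeff (\<Sum>(i, j, k)\<in>F. alpha ^ i * beta ^ j) j0) i0"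
      by (simp only: sum coeff_0)
    also have "\<dots> = (\<Sum>(i, j, k)\<in>F. if i = i0 \<and> j = j0 then 1 else 0)"
      by (simp only: coeff_sum case_prod_unfold coeff_alpha_beta)
    also have "\<dots> = (\<Sum>q\<in>F. if q = (i0, j0, k0) then 1 else 0)"
    proof (rule sum.cong, simp, clarify)
      fix i j k assume "(i, j, k) \<in> F"
      from F(2)[OF this] F(2)[OF p] have "4 * i + 4 * j + 5 * k = 4 * i0 + 4 * j0 + 5 * k0" by linarith
      then show "(if i = i0 \<and> j = j0 then 1 else 0) = (if (i, j, k) = (i0, j0, k0) then 1 else (0::bit))"
        by auto
    qed
    also have "\<dots> = 1" using p F(1) by (simp only: sum.delta sum.delta' if_True)
    finally show False by (simp only: zero_neq_one)
  qed
  then show ?thesis using F(3) by simp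
qed

text \<open>Take leading coefficients in \<beta>: these are polynomials in \<alpha>, and the
  equation would make an even degree equal to an odd one.\<close>

lemma square_eq_mult_square:
  fixes p q :: "bit poly poly"
  assumes "p * p = alpha * (q * q)"
  shows "p = 0 \<and> q = 0"
proof (rule ccontr)
  assume "\<not> (p = 0 \<and> q = 0)"
  moreover from this have "p \<noteq> 0 \<longleftrightarrow> q \<noteq> 0" using assms by (metis mult_eq_0_iff pCons_eq_0_iff zero_neq_one)
  ultimately have nz: "lead_coeff p \<noteq> 0" "lead_coeff q \<noteq> 0" by auto
  have "lead_coeff p * lead_coeff p = [:0, 1:] * (lead_coeff q * lead_coeff q)"
    using arg_cong[OF assms, of lead_coeff] by (simp only: Polynomial.lead_coeff_mult) simp
  then have "Polynomial.degree (lead_coeff p * lead_coeff p) =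
      Polynomial.degree ([:0, 1:] * (lead_coeff q * lead_coeff q))" by (simp only:)
  moreover have "Polynomial.degree ([:0, 1:] * (lead_coeff q * lead_coeff q))
      = 1 + (Polynomial.degree (lead_coeff q) + Polynomial.degree (lead_coeff q))"
    using nz by (simp only: Polynomial.degree_mult_eq mult_eq_0_iff pCons_eq_0_iff zero_neq_one
        one_neq_zero simp_thms) simp
  ultimately have "Polynomial.degree (lead_coeff p) + Polynomial.degree (lead_coeff p)
      = 1 + (Polynomial.degree (lead_coeff q) + Polynomial.degree (lead_coeff q))"
    by (simp only: Polynomial.degree_mult_eq[OF nz(1) nz(1)])
  then show False by presburger
qed

lemma pderiv_square: "pderiv (p * p) = (0 :: bit poly poly)"
  by (simp add: pderiv_mult)

text \<open>\<open>1\<close>, \<open>\<alpha>\<close>, \<open>\<beta>\<close>, \<open>\<alpha>\<beta>\<close> are linearly independent over the squares: differentiate by \<open>\<beta>\<close>.\<close>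

lemma squares_independent:
  fixes p q r s :: "bit poly poly"
  assumes "p * p + alpha * (q * q) + beta * (r * r) + alpha * (beta * (s * s)) = 0"
  shows "p = 0" "q = 0" "r = 0" "s = 0"
proof -
  have "pderiv (p * p + alpha * (q * q) + beta * (r * r) + alpha * (beta * (s * s))) = r * r + alpha * (s * s)"
    by (simp only: pderiv_add pderiv_mult[of alpha] pderiv_mult[of beta] pderiv_square) (simp add: pderiv_pCons)
  then have "r * r = alpha * (s * s)"
    using assms by (simp add: add_eq_0_char_2)
  then have rs: "r = 0 \<and> s = 0" by (rule square_eq_mult_square)
  then have "p * p = alpha * (q * q)" using assms by (simp add: add_eq_0_char_2)
  then have "p = 0 \<and> q = 0" by (rule square_eq_mult_square)
  with rs show "p = 0" "q = 0" "r = 0" "s = 0" by auto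
qed

section \<open>Separatedness of the filtration\<close>

lemma plus_1_power_2_power: "(r + 1) ^ 2 ^ m = r ^ 2 ^ m + (1 :: laurent)"
proof (induction m)
  case (Suc m)
  have "(r + 1) ^ 2 ^ Suc m = ((r + 1) ^ 2 ^ m) ^ 2" by (simp add: power_mult [symmetric] mult.commute)
  also have "\<dots> = r ^ 2 ^ Suc m + 1"
    unfolding Suc.IH by (simp add: power2_eq_square algebra_simps power_add [symmetric] mult_2)
  finally show ?case .
qed simp

lemma mono_power: "lmono i j k ^ n = lmono (int n * i) (int n * j) (int n * k)"
  by (induction n) (simp_all add: mult_single algebra_simps)

text \<open>An element of high weight lies in the ideal generated by \<open>x\<^bsup>N\<^esup> - 1\<close>, \<open>y\<^bsup>N\<^esup> - 1\<close> and \<open>z\<^bsup>N\<^esup> - 1\<close> with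
  \<open>N = 2\<^bsup>m\<^esup>\<close>, so its coefficient sum over each residue class modulo \<open>N\<close> vanishes.\<close>

lemma filt_lift_periodic:
  fixes \<phi> :: "int \<times> int \<times> int \<Rightarrow> bit" and N :: nat
  assumes N_def: "N = 2 ^ m"
  assumes "\<And>i j k. \<phi> (int N + i, j, k) = \<phi> (i, j, k)" "\<And>i j k. \<phi> (i, int N + j, k) = \<phi> (i, j, k)"
    "\<And>i j k. \<phi> (i, j, int N + k) = \<phi> (i, j, k)"
  assumes "filt n r" "int (4 * i + 4 * j + 5 * k) + n \<ge> 13 * int N"
  shows "lift \<phi> (lX ^ i * lY ^ j * lC ^ k * r * t) = 0"
proof -
  have shift: "lift \<phi> (lmono i j k * s) = lift \<phi> s"
    if "\<And>i' j' k'. \<phi> (i + i', j + j', k + k') = \<phi> (i', j', k')" for i j k s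
  proof (induction s rule: poly_mapping_bit_induct)
    case (single l)
    then show ?case by (cases l) (simp add: mult_single that)
  qed (simp_all add: distrib_left)
  have per: "lift \<phi> ((lmono i j k + 1) ^ N * s) = 0"
    if "\<And>i' j' k'. \<phi> (int N * i + i', int N * j + j', int N * k + k') = \<phi> (i', j', k')" for i j k s
    \<comment> \<open>Here (u + 1)^N = u^N + 1, and multiplication by u^N leaves
      \<open>lift \<phi>\<close> unchanged by periodicity, so the two terms cancel.\<close>
    unfolding N_def plus_1_power_2_power mono_power
    using shift[of "int N * i" "int N * j" "int N * k" s] that by (simp add: N_def distrib_right)
  have neg: "\<phi> (i, - int N + j, k) = \<phi> (i, j, k)" for i j k
    using assms(3)[of i "- int N + j" k] by simp
  have X: "lift \<phi> (lX ^ N * s) = 0" and Y: "lift \<phi> (lY ^ N * s) = 0" and C: "lift \<phi> (lC ^ N * s) = 0" for s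
    by (rule per; simp only: assms(2-4) neg mult_1_right mult_zero_right add_0 mult_minus_right)+
  have split: "u ^ i = u ^ N * u ^ (i - N)" if "N \<le> i" for u :: laurent and i
    using that by (simp flip: power_add)
  from assms(5,6) show ?thesis
  proof (induction arbitrary: i j k t rule: filt.induct)
    case (base n r)
    \<comment> \<open>The constant is 13 N = 4 N + 4 N + 5 N: with all three exponents below N the
      accumulated weight would stay below it.\<close>
    then have "N \<le> i \<or> N \<le> j \<or> N \<le> k" by linarith
    then show ?case
    proof (elim disjE)
      assume "N \<le> i"
      then show ?thesis using X[of "lX ^ (i - N) * lY ^ j * lC ^ k * r * t"]
        by (simp only: split[of i] mult.assoc)
    next
      assume "N \<le> j"
      then show ?thesis using Y[of "lX ^ i * lY ^ (j - N) * lC ^ k * r * t"]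
        by (simp only: split[of j] mult.assoc mult.left_commute)
    next
      assume "N \<le> k"
      then show ?thesis using C[of "lX ^ i * lY ^ j * lC ^ (k - N) * r * t"]
        by (simp only: split[of k] mult.assoc mult.left_commute)
    qed
  next
    case (X n r)
    show ?case using X.IH[of "Suc i" j k t] X.prems by (simp only: power_Suc ac_simps) simp
  next
    case (Y n r)
    show ?case using Y.IH[of i "Suc j" k t] Y.prems by (simp only: power_Suc ac_simps) simp
  next
    case (C n r)
    show ?case using C.IH[of i j "Suc k" t] C.prems by (simp only: power_Suc ac_simps) simp
  next
    case (add n r s)
    then show ?case by (simp only: distrib_left distrib_right lift_add) simp
  next
    case (less n r m)
    then show ?case by auto
  qed
qed

text \<open>Fix an exponent \<open>g\<close> in the support. For N = 2^m beyond the total distance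
  \<open>?B\<close> from \<open>g\<close> to the support, no other exponent of \<open>r\<close> is
  congruent to \<open>g\<close> modulo N. The indicator \<open>\<phi>\<close> of that residue class
  then reads off the coefficient at \<open>g\<close>, while \<open>filt_lift_periodic\<close> makes
  the result 0.\<close>

lemma filt_all_imp_0:
  assumes "\<And>n. filt n r"
  shows "r = 0"
proof (rule ccontr)
  assume "r \<noteq> 0"
  then obtain g where g: "g \<in> Poly_Mapping.keys r"
    unfolding in_keys_iff by (metis poly_mapping_eqI lookup_zero)
  obtain g1 g2 g3 where g_eq: "g = (g1, g2, g3)" by (cases g)
  let ?B = "\<Sum>(i, j, k)\<in>Poly_Mapping.keys r. \<bar>i - g1\<bar> + \<bar>j - g2\<bar> + \<bar>k - g3\<bar>"
  define m where "m = nat ?B"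
  define N where "N = (2::nat) ^ m"
  define \<phi> :: "int \<times> int \<times> int \<Rightarrow> bit"
    where "\<phi> = (\<lambda>(i, j, k). of_bool (int N dvd i - g1 \<and> int N dvd j - g2 \<and> int N dvd k - g3))"
  have "?B \<le> int m" by (simp add: m_def)
  also have "int m < int N" by (simp add: N_def)
  finally have B: "?B < int N" .
  have eq: "h = g" if h: "h \<in> Poly_Mapping.keys r" "\<phi> h \<noteq> 0" for h
  proof -
    obtain i j k where [simp]: "h = (i, j, k)" by (cases h)
    have "\<bar>i - g1\<bar> + \<bar>j - g2\<bar> + \<bar>k - g3\<bar> \<le> ?B"
      using member_le_sum[of h "Poly_Mapping.keys r" "\<lambda>(i, j, k). \<bar>i - g1\<bar> + \<bar>j - g2\<bar> + \<bar>k - g3\<bar>"] h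
      by auto
    with B have "\<bar>i - g1\<bar> < int N" "\<bar>j - g2\<bar> < int N" "\<bar>k - g3\<bar> < int N" by linarith+
    moreover have "int N dvd i - g1" "int N dvd j - g2" "int N dvd k - g3"
      using h(2) by (auto simp: \<phi>_def split: if_splits)
    moreover have "u = v" if "\<bar>u - v\<bar> < int N" "int N dvd u - v" for u v
      using dvd_imp_le_int[of "u - v" "int N"] that by linarith
    ultimately have "i = g1" "j = g2" "k = g3" by blast+
    then show ?thesis by (simp add: g_eq)
  qed
  have per: "int N dvd int N + i - l \<longleftrightarrow> int N dvd i - l" for i l
    by (metis add_diff_eq dvd_add_right_iff dvd_refl)
  have "lift \<phi> (lX ^ 0 * lY ^ 0 * lC ^ 0 * r * 1) = 0"
    by (rule filt_lift_periodic[OF N_def, of _ "13 * int N"]) (simp_all add: assms \<phi>_def per N_def[symmetric])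
  then have "lift \<phi> r = 0" by simp
  moreover have "lift \<phi> r = (\<Sum>h\<in>Poly_Mapping.keys r. if h = g then 1 else 0)"
    unfolding lift_def
  proof (rule sum.cong)
    fix h assume h: "h \<in> Poly_Mapping.keys r"
    have "\<phi> g = 1" by (simp add: \<phi>_def g_eq)
    with eq[OF h] show "\<phi> h = (if h = g then 1 else 0)" by (metis (full_types))
  qed simp
  ultimately show False using g by simp
qed

lemma spec_eq_0_imp: "spec r = 0 \<Longrightarrow> r = 0"
proof (rule filt_all_imp_0)
  fix n assume "spec r = 0"
  then have "filt (int k) r" for k
    using filt_Suc[of "int k" r for k] by (induction k) (auto simp: filt.base add.commute)
  then show "filt n r" by (rule filt.less[of "int (nat n)"]) simp
qed

text \<open>So R embeds into a domain, whose fraction field will carry the matrix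
  representation.\<close>

lemma inj_spec: "inj spec"
proof (rule injI)
  fix r s assume "spec r = spec s"
  then have "spec (r + s) = 0" by simp
  then show "r = s" using spec_eq_0_imp add_eq_0_char_2 by metis
qed

text \<open>The extension of the weight filtration to the crossed product, with \<open>a - 1\<close> and \<open>b - 1\<close> of
  weight 2; the four conditions are on the coordinates with respect to the left basis
  \<open>1\<close>, \<open>a - 1\<close>, \<open>b - 1\<close>, \<open>(a - 1)(b - 1)\<close>.\<close>

definition g0 where "g0 w = ce w + ca w + cb w + cab w"
definition g1 where "g1 w = ca w + cab w"
definition g2 where "g2 w = cb w + cab w"

definition cfilt :: "int \<Rightarrow> crossed \<Rightarrow> bool"
  where "cfilt n w \<longleftrightarrow> filt n (g0 w) \<and> filt (n - 2) (g1 w) \<and> filt (n - 2) (g2 w) \<and> filt (n - 4) (cab w)"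

abbreviation scal :: "laurent \<Rightarrow> crossed" where "scal r \<equiv> Crossed r 0 0 0"
abbreviation "cA \<equiv> Crossed 1 1 0 0"
abbreviation "cB \<equiv> Crossed 1 0 1 0"

lemma filt_add_le: "filt m r \<Longrightarrow> filt k s \<Longrightarrow> n \<le> m \<Longrightarrow> n \<le> k \<Longrightarrow> filt n (r + s)"
  by (rule filt.add; rule filt.less)

lemma cfilt_add: "cfilt n u \<Longrightarrow> cfilt n v \<Longrightarrow> cfilt n (u + v)"
proof -
  have "g0 (u + v) = g0 u + g0 v" "g1 (u + v) = g1 u + g1 v" "g2 (u + v) = g2 u + g2 v"
    by (simp_all add: g0_def g1_def g2_def ac_simps)
  then show "cfilt n u \<Longrightarrow> cfilt n v \<Longrightarrow> cfilt n (u + v)"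
    by (simp add: cfilt_def filt.add)
qed

lemma cfilt_add_trans: "cfilt n (u + v) \<Longrightarrow> cfilt n (v + w) \<Longrightarrow> cfilt n (u + w)"
  using cfilt_add[of n "u + v" "v + w"] by (simp add: add.assoc)

lemma cfilt_less: "cfilt n u \<Longrightarrow> m \<le> n \<Longrightarrow> cfilt m u"
  by (auto simp: cfilt_def elim: filt.less)

lemma cfilt_0: "cfilt n 0"
  by (simp add: cfilt_def g0_def g1_def g2_def filt_0)

lemma scal_mult_sel [simp]:
  "ce (scal r * w) = r * ce w" "ca (scal r * w) = r * ca w"
  "cb (scal r * w) = r * cb w" "cab (scal r * w) = r * cab w"
  by (simp_all add: crossed_mult_sel)

lemma cfilt_scal_mult: "filt m r \<Longrightarrow> cfilt n w \<Longrightarrow> cfilt (m + n) (scal r * w)"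
proof -
  have "g0 (scal r * w) = r * g0 w" "g1 (scal r * w) = r * g1 w" "g2 (scal r * w) = r * g2 w"
    by (simp_all add: g0_def g1_def g2_def distrib_left)
  then show "filt m r \<Longrightarrow> cfilt n w \<Longrightarrow> cfilt (m + n) (scal r * w)"
    by (auto simp: cfilt_def intro: filt_mult_le)
qed

lemma cfilt_scal: "filt n r \<Longrightarrow> cfilt n (scal r)"
  by (simp add: cfilt_def g0_def g1_def g2_def filt_0)

text \<open>Move a - 1 past a coefficient by (a - 1) t = \<open>twist_a t\<close> (a - 1) +
  (\<open>twist_a t\<close> - t). The second term gains 3, and where two factors a - 1 meet they
  give x - 1, whose weight 4 is what they counted for.\<close>

lemma cfilt_A_mult:
  assumes "cfilt n w"
  shows "cfilt (n + 2) (cA * w)"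
proof -
  define t0 t1 t2 t3 where "t0 = g0 w" "t1 = g1 w" "t2 = g2 w" "t3 = cab w"
  have w: "ce w = t0 + t1 + t2 + t3" "ca w = t1 + t3" "cb w = t2 + t3" "cab w = t3"
    by (simp_all add: t0_t1_t2_t3_def g0_def g1_def g2_def ac_simps)
  have f: "filt n t0" "filt (n - 2) t1" "filt (n - 2) t2" "filt (n - 4) t3"
    using assms by (simp_all add: cfilt_def t0_t1_t2_t3_def)
  note tw = f[THEN filt_twist(1)] and d = f[THEN filt_twist_a]
  have "g0 (cA * w) = (twist_a t0 + t0) + lX * twist_a t1"
    "g1 (cA * w) = twist_a t0 + (twist_a t1 + t1)"
    "g2 (cA * w) = (twist_a t2 + t2) + lX * twist_a t3"
    "cab (cA * w) = twist_a t2 + (twist_a t3 + t3)"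
    by (simp_all add: g0_def g1_def g2_def crossed_mult_sel w shift_def algebra_simps)
  moreover have "filt (n + 2) (lX * twist_a t1)" "filt n (lX * twist_a t3)"
    by (rule filt_mult_le[OF filt_lX tw(2)], simp) (rule filt_mult_le[OF filt_lX tw(4)], simp)
  ultimately show ?thesis unfolding cfilt_def
    by (auto intro!: filt_add_le[OF d(1)] filt_add_le[OF tw(1) d(2)] filt_add_le[OF d(3)]
        filt_add_le[OF tw(3) d(4)])
qed

text \<open>As in \<open>cfilt_A_mult\<close>, except that b also has to pass a. Since ba = c^-1 ab,
  this produces terms with the factor c^-1 - 1 of weight 5; the factor y^-1 - 1 appears because a
  inverts y = b^2.\<close>

lemma cfilt_B_mult:
  assumes "cfilt n w"
  shows "cfilt (n + 2) (cB * w)"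
proof -
  define t0 t1 t2 t3 where "t0 = g0 w" "t1 = g1 w" "t2 = g2 w" "t3 = cab w"
  have w: "ce w = t0 + t1 + t2 + t3" "ca w = t1 + t3" "cb w = t2 + t3" "cab w = t3"
    by (simp_all add: t0_t1_t2_t3_def g0_def g1_def g2_def ac_simps)
  have f: "filt n t0" "filt (n - 2) t1" "filt (n - 2) t2" "filt (n - 4) t3"
    using assms by (simp_all add: cfilt_def t0_t1_t2_t3_def)
  note tw = f[THEN filt_twist(2)] and d = f[THEN filt_twist_b]
  let ?C = "lmono (- 1) 1 (- 1) + 1" and ?Y = "lmono 0 (- 1) 0 + 1"
  have C: "filt 5 ?C" using filt_mono_plus_1[OF filt_lC, of "- 1"] by simp
  have YY: "filt 8 (lmono 0 (- 1) 0 * (lY * lY))"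
    by (rule filt_square)
  have eq: "g0 (cB * w) = (twist_b t0 + t0) + lY * twist_b t2 + lmono 0 (- 1) 0 * (lY * lY) * twist_b t3
      + ?C * twist_b t1 + ?C * (?Y * twist_b t3)"
    "g1 (cB * w) = (twist_b t1 + t1) + ?C * (lmono 0 (- 1) 0 * twist_b t3 + (twist_b t1 + twist_b t3))
      + ?Y * twist_b t3"
    "g2 (cB * w) = twist_b t0 + (twist_b t2 + t2) + ?C * (twist_b t1 + twist_b t3)"
    "cab (cB * w) = twist_b t1 + (twist_b t3 + t3) + ?C * (twist_b t1 + twist_b t3)"
    by (simp_all add: g0_def g1_def g2_def crossed_mult_sel w shift_def algebra_simps mono_mult_left mult_single)
  have Y3: "filt n (?Y * twist_b t3)" by (rule filt_mult_le[OF filt_mono tw(4)]) simp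
  have s: "filt (n - 4) (twist_b t1 + twist_b t3)"
    by (rule filt_add_le[OF tw(2) tw(4)]) simp_all
  have p: "filt (n + 2) (lY * twist_b t2)" "filt (n + 2) (lmono 0 (- 1) 0 * (lY * lY) * twist_b t3)"
      "filt (n + 2) (?C * twist_b t1)" "filt (n + 2) (?C * (?Y * twist_b t3))"
    by (rule filt_mult_le[OF filt_lY tw(3)] filt_mult_le[OF YY tw(4)] filt_mult_le[OF C tw(2)]
        filt_mult_le[OF C Y3], simp)+
  have q: "filt n (?C * (twist_b t1 + twist_b t3))"
      "filt n (?C * (lmono 0 (- 1) 0 * twist_b t3 + (twist_b t1 + twist_b t3)))"
    by (rule filt_mult_le[OF C s] filt_mult_le[OF C filt.add[OF filt_smult[OF tw(4)] s]], simp)+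
  have "filt (n + 2) (g0 (cB * w))" unfolding eq
    by (rule filt.add[OF filt.add[OF filt.add[OF filt_add_le[OF d(1) p(1)] p(2)] p(3)] p(4)]) simp_all
  moreover have "filt n (g1 (cB * w))" unfolding eq
    by (rule filt.add[OF filt_add_le[OF d(2) q(2)] Y3]) simp_all
  moreover have "filt n (g2 (cB * w))" unfolding eq
    by (rule filt.add[OF filt.add[OF tw(1) filt.less[OF d(3)]] q(1)]) simp_all
  moreover have "filt (n - 2) (cab (cB * w))" unfolding eq
    by (rule filt.add[OF filt.add[OF tw(2) filt.less[OF d(4)]] filt.less[OF q(1)]]) simp_all
  ultimately show ?thesis unfolding cfilt_def by (simp add: add_diff_eq)
qed

lemma crossed_decomp:
  "w = scal (g0 w) + scal (g1 w) * cA + scal (g2 w) * cB + scal (cab w) * (cA * cB)"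
  by (simp only: crossed_eq_iff, intro conjI;
      simp add: crossed_mult_sel g0_def g1_def g2_def ac_simps shift_def)

text \<open>By \<open>crossed_decomp\<close> the left factor is built from scalars, a - 1 and b - 1,
  and left multiplication by each of these is already under control.\<close>

lemma cfilt_mult:
  assumes "cfilt m u" "cfilt n v"
  shows "cfilt (m + n) (u * v)"
proof -
  note f = assms(1)[unfolded cfilt_def, THEN conjunct1]
    assms(1)[unfolded cfilt_def, THEN conjunct2, THEN conjunct1]
    assms(1)[unfolded cfilt_def, THEN conjunct2, THEN conjunct2, THEN conjunct1]
    assms(1)[unfolded cfilt_def, THEN conjunct2, THEN conjunct2, THEN conjunct2]
  have "cfilt (m + n) (scal (g0 u) * v)"
    by (rule cfilt_scal_mult[OF f(1) assms(2)])
  moreover have "cfilt (m + n) (scal (g1 u) * (cA * v))"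
    using cfilt_scal_mult[OF f(2) cfilt_A_mult[OF assms(2)]] by simp
  moreover have "cfilt (m + n) (scal (g2 u) * (cB * v))"
    using cfilt_scal_mult[OF f(3) cfilt_B_mult[OF assms(2)]] by simp
  moreover have "cfilt (m + n) (scal (cab u) * (cA * (cB * v)))"
    using cfilt_scal_mult[OF f(4) cfilt_A_mult[OF cfilt_B_mult[OF assms(2)]]]
    by simp
  moreover have "u * v = scal (g0 u) * v + scal (g1 u) * (cA * v) + scal (g2 u) * (cB * v)
      + scal (cab u) * (cA * (cB * v))"
    by (subst crossed_decomp[of u]) (simp only: distrib_right mult.assoc)
  ultimately show ?thesis by (simp add: cfilt_add)
qed

lemma cfilt_mult_le: "cfilt m u \<Longrightarrow> cfilt n v \<Longrightarrow> k \<le> m + n \<Longrightarrow> cfilt k (u * v)"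
  by (rule cfilt_less[OF cfilt_mult])

text \<open>\<open>u\<close> and \<open>v\<close> commute in the associated graded ring.\<close>

definition comm :: "int \<Rightarrow> crossed \<Rightarrow> int \<Rightarrow> crossed \<Rightarrow> bool"
  where "comm m u n v \<longleftrightarrow> cfilt m u \<and> cfilt n v \<and> cfilt (m + n + 1) (u * v + v * u)"

lemma comm_sym: "comm m u n v \<Longrightarrow> comm n v m u"
  by (simp add: comm_def ac_simps)

text \<open>The Leibniz rule [u, vw] = [u, v] w + v [u, w] for commutators.\<close>

lemma comm_mult: "comm m u n v \<Longrightarrow> comm m u k w \<Longrightarrow> comm m u (n + k) (v * w)"
proof -
  assume *: "comm m u n v" "comm m u k w"
  have "cfilt (m + (n + k) + 1) ((u * v + v * u) * w + v * (u * w + w * u))"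
    using * unfolding comm_def by (intro cfilt_add; elim conjE) (auto intro: cfilt_mult_le)
  also have "(u * v + v * u) * w + v * (u * w + w * u) = u * (v * w) + v * w * u"
    by (simp add: distrib_left distrib_right mult.assoc add.assoc)
  finally show ?thesis using * by (simp add: comm_def cfilt_mult)
qed

lemma comm_mult_left: "comm n v m u \<Longrightarrow> comm k w m u \<Longrightarrow> comm (n + k) (v * w) m u"
  using comm_mult comm_sym by blast

lemma cfilt_square_mult:
  assumes "comm m u n v"
  shows "cfilt (2 * m + 2 * n + 1) (u * v * (u * v) + u * u * (v * v))"
proof -
  have "u * v * (u * v) + u * u * (v * v) = u * ((u * v + v * u) * v)"
    by (simp add: distrib_left distrib_right mult.assoc add.commute)
  moreover have "cfilt (2 * m + 2 * n + 1) (u * ((u * v + v * u) * v))"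
    using assms unfolding comm_def
    by (elim conjE) (rule cfilt_mult_le[OF _ cfilt_mult[of "m + n + 1" _ n]], auto)
  ultimately show ?thesis by simp
qed

lemma cfilt_cA: "cfilt 2 cA" and cfilt_cB: "cfilt 2 cB"
  by (simp_all add: cfilt_def g0_def g1_def g2_def filt_0 filt.base)

lemma comm_scal:
  assumes "filt m r" "filt n s"
  shows "comm m (scal r) n (scal s)"
proof -
  have "scal r * scal s + scal s * scal r = 0"
    by (simp add: crossed_eq_iff mult.commute[of s])
  with assms show ?thesis by (simp add: comm_def cfilt_scal cfilt_0)
qed

lemma comm_scal_cA:
  assumes "filt n r"
  shows "comm n (scal r) 2 cA"
proof -
  have "scal r * cA + cA * scal r = scal (twist_a r + r) * (cA + 1)"
    by (simp add: crossed_eq_iff crossed_mult_sel ac_simps)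
  moreover have "cfilt (n + 3) (scal (twist_a r + r) * (cA + 1))"
    by (rule cfilt_mult_le[OF cfilt_scal[OF filt_twist_a[OF assms]], of 0])
      (simp_all add: cfilt_def g0_def g1_def g2_def filt.base)
  ultimately show ?thesis using assms by (simp add: comm_def cfilt_cA cfilt_scal add.assoc)
qed

lemma comm_scal_cB:
  assumes "filt n r"
  shows "comm n (scal r) 2 cB"
proof -
  have "scal r * cB + cB * scal r = scal (twist_b r + r) * (cB + 1)"
    by (simp add: crossed_eq_iff crossed_mult_sel ac_simps)
  moreover have "cfilt (n + 3) (scal (twist_b r + r) * (cB + 1))"
    by (rule cfilt_mult_le[OF cfilt_scal[OF filt_twist_b[OF assms]], of 0])
      (simp_all add: cfilt_def g0_def g1_def g2_def filt.base)
  ultimately show ?thesis using assms by (simp add: comm_def cfilt_cB cfilt_scal add.assoc)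
qed

lemma comm_cA_cB: "comm 2 cA 2 cB"
proof -
  have C: "filt 5 (lmono (- 1) 1 (- 1) + 1)" using filt_mono_plus_1[OF filt_lC, of "- 1"] by simp
  have "cA * cB + cB * cA = scal (lmono (- 1) 1 (- 1) + 1) * Crossed 0 0 0 1"
    by (simp add: crossed_eq_iff crossed_mult_sel ac_simps shift_def)
  moreover have "cfilt 5 (scal (lmono (- 1) 1 (- 1) + 1) * Crossed 0 0 0 1)"
    by (rule cfilt_mult_le[OF cfilt_scal[OF C], of 0])
      (simp_all add: cfilt_def g0_def g1_def g2_def filt.base)
  ultimately show ?thesis by (simp add: comm_def cfilt_cA cfilt_cB)
qed

lemma cA_cA: "cA * cA = scal lX" and cB_cB: "cB * cB = scal lY"
  by (simp_all add: crossed_eq_iff crossed_mult_sel shift_def ac_simps)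

text \<open>Represents the square of the leading form of \<open>w\<close> in the graded ring, where
  (a - 1)^2 = x - 1 and (b - 1)^2 = y - 1.\<close>

definition normform :: "crossed \<Rightarrow> laurent"
  where "normform w = g0 w * g0 w + g1 w * g1 w * lX + g2 w * g2 w * lY + cab w * cab w * (lX * lY)"

lemma scal_add: "scal (r + s) = scal r + scal s"
  by (simp add: crossed_eq_iff)

lemma square_of_sum_char_2:
  fixes a b c d p q r s :: "'a::ring_char_2"
  shows "(a * b + b * a) + (a * c + c * a) + (a * d + d * a) + (b * c + c * b) + (b * d + d * b)
     + (c * d + d * c) + (b * b + q) + (c * c + r) + (d * d + s)
     = (a + b + c + d) * (a + b + c + d) + (a * a + q + r + s)"
  by (simp add: distrib_left distrib_right add.assoc add.left_commute)

text \<open>The four summands of \<open>crossed_decomp\<close> have weight n and commute pairwise up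
  to weight 2 n + 1, so the mixed products cancel in pairs and only the four squares remain.\<close>

lemma cfilt_square:
  assumes "cfilt n w"
  shows "cfilt (2 * n + 1) (w * w + scal (normform w))"
proof -
  let ?t0 = "scal (g0 w)" and ?t1 = "scal (g1 w) * cA" and ?t2 = "scal (g2 w) * cB"
    and ?t3 = "scal (cab w) * (cA * cB)"
  have f: "filt n (g0 w)" "filt (n - 2) (g1 w)" "filt (n - 2) (g2 w)" "filt (n - 4) (cab w)"
    using assms by (simp_all add: cfilt_def)
  have self: "comm k u k u" if "cfilt k u" for k u using that by (simp add: comm_def cfilt_0)
  note cA = comm_scal_cA and cB = comm_scal_cB
  have sAB: "comm k (scal r) 4 (cA * cB)" if "filt k r" for k r
    using comm_mult[OF cA[OF that] cB[OF that]] by simp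
  have AAB: "comm 2 cA 4 (cA * cB)" and BAB: "comm 2 cB 4 (cA * cB)"
    using comm_mult[OF self[OF cfilt_cA] comm_cA_cB]
      comm_mult[OF comm_cA_cB[THEN comm_sym] self[OF cfilt_cB]] by simp_all
  have t0: "comm n ?t0 n ?t1" "comm n ?t0 n ?t2" "comm n ?t0 n ?t3"
    using comm_mult[OF comm_scal[OF f(1) f(2)] cA[OF f(1)]]
      comm_mult[OF comm_scal[OF f(1) f(3)] cB[OF f(1)]]
      comm_mult[OF comm_scal[OF f(1) f(4)] sAB[OF f(1)]] by simp_all
  have t12: "comm n ?t1 n ?t2"
    using comm_mult[OF comm_mult_left[OF comm_scal[OF f(2) f(3)] cA[OF f(3), THEN comm_sym]]
        comm_mult_left[OF cB[OF f(2)] comm_cA_cB]] by simp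
  have t13: "comm n ?t1 n ?t3"
    using comm_mult[OF comm_mult_left[OF comm_scal[OF f(2) f(4)] cA[OF f(4), THEN comm_sym]]
        comm_mult_left[OF sAB[OF f(2)] AAB]] by simp
  have t23: "comm n ?t2 n ?t3"
    using comm_mult[OF comm_mult_left[OF comm_scal[OF f(3) f(4)] cB[OF f(4), THEN comm_sym]]
        comm_mult_left[OF sAB[OF f(3)] BAB]] by simp
  have ss: "scal p * scal q = scal (p * q)" for p q
    by (simp add: crossed_eq_iff)
  have s0: "?t0 * ?t0 = scal (g0 w * g0 w)" by (rule ss)
  have s1: "cfilt (2 * n + 1) (?t1 * ?t1 + scal (g1 w * g1 w * lX))"
    using cfilt_square_mult[OF cA[OF f(2)]] by (simp only: cA_cA ss) simp
  have s2: "cfilt (2 * n + 1) (?t2 * ?t2 + scal (g2 w * g2 w * lY))"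
    using cfilt_square_mult[OF cB[OF f(3)]] by (simp only: cB_cB ss) simp
  have "cfilt 9 (cA * cB * (cA * cB) + scal (lX * lY))"
    using cfilt_square_mult[OF comm_cA_cB] by (simp only: cA_cA cB_cB ss) simp
  then have "cfilt (2 * n + 1) (scal (cab w * cab w) * (cA * cB * (cA * cB) + scal (lX * lY)))"
    by (rule cfilt_mult_le[OF cfilt_scal[OF filt_mult[OF f(4) f(4)]]]) simp
  then have "cfilt (2 * n + 1) (scal (cab w * cab w) * (cA * cB * (cA * cB)) + scal (cab w * cab w * (lX * lY)))"
    by (simp only: distrib_left ss)
  moreover have "cfilt (2 * n + 1) (?t3 * ?t3 + scal (cab w * cab w) * (cA * cB * (cA * cB)))"
    using cfilt_square_mult[OF sAB[OF f(4)]] by (simp only: ss) simp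
  ultimately have s3: "cfilt (2 * n + 1) (?t3 * ?t3 + scal (cab w * cab w * (lX * lY)))"
    by (rule cfilt_add_trans[rotated])
  let ?c = "\<lambda>u v. u * v + v * u"
  have c: "cfilt (2 * n + 1) (?c u v)" if "comm n u n v" for u v
    using that by (simp add: comm_def)
  have "cfilt (2 * n + 1) (?c ?t0 ?t1 + ?c ?t0 ?t2 + ?c ?t0 ?t3 + ?c ?t1 ?t2 + ?c ?t1 ?t3 + ?c ?t2 ?t3
     + (?t1 * ?t1 + scal (g1 w * g1 w * lX)) + (?t2 * ?t2 + scal (g2 w * g2 w * lY))
     + (?t3 * ?t3 + scal (cab w * cab w * (lX * lY))))"
    by (rule cfilt_add[OF cfilt_add[OF cfilt_add[OF cfilt_add[OF cfilt_add[OF cfilt_add[OF cfilt_add[OF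
      cfilt_add[OF c[OF t0(1)] c[OF t0(2)]] c[OF t0(3)]] c[OF t12]] c[OF t13]] c[OF t23]] s1] s2] s3])
  then show ?thesis
    unfolding square_of_sum_char_2 crossed_decomp[of w, symmetric] s0 normform_def scal_add .
qed

section \<open>Absence of nilpotent elements\<close>

lemma fps_square_nth:
  fixes f :: "'a::semiring_1 fps"
  assumes "\<And>k. k < m \<Longrightarrow> f $ k = 0"
  shows "(f * f) $ (2 * m) = f $ m * f $ m"
proof -
  have "(f * f) $ (2 * m) = (\<Sum>i=0..2 * m. f $ i * f $ (2 * m - i))"
    by (rule fps_mult_nth)
  also have "\<dots> = (\<Sum>i\<in>{m}. f $ i * f $ (2 * m - i))"
  proof (rule sum.mono_neutral_right)
    show "\<forall>i\<in>{0..2 * m} - {m}. f $ i * f $ (2 * m - i) = 0"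
    proof
      fix i assume "i \<in> {0..2 * m} - {m}"
      then have "i < m \<or> 2 * m - i < m" by auto
      then show "f $ i * f $ (2 * m - i) = 0" using assms by auto
    qed
  qed auto
  finally show ?thesis by simp
qed

lemma fps_square_nth_diff:
  fixes f :: "'a::semiring_1 fps"
  assumes "\<And>k. int k < int n - int d \<Longrightarrow> f $ k = 0"
  shows "(f * f * fps_X ^ (2 * d)) $ (2 * n) = (if n < d then 0 else f $ (n - d) * f $ (n - d))"
proof (cases "n < d")
  case False
  then have "2 * n - 2 * d = 2 * (n - d)" by simp
  with False assms show ?thesis by (auto simp: fps_X_power_mult_right_nth fps_square_nth)
qed (simp add: fps_X_power_mult_right_nth)

text \<open>At T^(2n) the series of \<open>normform w\<close> is p^2 + \<alpha> q^2 + \<beta> r^2 +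
  \<alpha> \<beta> s^2, where p, q, r, s are the lowest possible coefficients of the four
  coordinates. By \<open>squares_independent\<close> all of them vanish, and \<open>filt_Suc\<close>
  raises the level of each coordinate.\<close>

lemma cfilt_Suc:
  assumes "cfilt (int n) w" "cfilt (2 * int n + 1) (w * w)"
  shows "cfilt (int n + 1) w"
proof -
  have f: "filt (int n) (g0 w)" "filt (int n - int 2) (g1 w)" "filt (int n - int 2) (g2 w)" "filt (int n - int 4) (cab w)"
    using assms by (simp_all add: cfilt_def)
  have "cfilt (2 * int n + 1) (w * w + (w * w + scal (normform w)))"
    by (rule cfilt_add[OF assms(2) cfilt_square[OF assms(1)]])
  then have "filt (2 * int n + 1) (normform w)"
    by (simp add: cfilt_def g0_def)
  then have *: "spec (normform w) $ (2 * n) = 0"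
    by (rule spec_nth_eq_0) simp
  \<comment> \<open>For n < d the value is 0 by convention: level n + 1 - d is then nonpositive and
    imposes no condition.\<close>
  define e where "e d r = (if n < d then 0 else spec r $ (n - d))" for d r
  have sq: "(spec r * spec r * fps_X ^ (2 * d)) $ (2 * n) = e d r * e d r"
    if "filt (int n - int d) r" for d r
    unfolding e_def by (subst fps_square_nth_diff) (use that in \<open>auto intro: spec_nth_eq_0\<close>)
  have "spec (normform w) = spec (g0 w) * spec (g0 w) * fps_X ^ (2 * 0)
      + fps_const alpha * (spec (g1 w) * spec (g1 w) * fps_X ^ (2 * 2))
      + fps_const beta * (spec (g2 w) * spec (g2 w) * fps_X ^ (2 * 2))
      + fps_const alpha * (fps_const beta * (spec (cab w) * spec (cab w) * fps_X ^ (2 * 4)))"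
  proof -
    have X8: "(fps_X :: bit poly poly fps) ^ (2 * 4) = fps_X ^ 4 * fps_X ^ 4" and X4: "(fps_X :: bit poly poly fps) ^ (2 * 2) = fps_X ^ 4"
      and X0: "(fps_X :: bit poly poly fps) ^ (2 * 0) = 1"
      by (simp_all flip: power_add)
    define x y where "x = lX" "y = lY"
    have xy: "spec x = fps_const alpha * fps_X ^ 4" "spec y = fps_const beta * fps_X ^ 4"
      unfolding x_y_def spec_lead by (simp_all only: leadX_def leadY_def)
    show ?thesis unfolding X8 X4 X0 normform_def x_y_def[symmetric]
      by (simp only: spec_add spec_mult xy ac_simps mult_1_left)
  qed
  then have "spec (normform w) $ (2 * n) = e 0 (g0 w) * e 0 (g0 w) + alpha * (e 2 (g1 w) * e 2 (g1 w))
      + beta * (e 2 (g2 w) * e 2 (g2 w)) + alpha * (beta * (e 4 (cab w) * e 4 (cab w)))"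
    by (simp only: fps_add_nth fps_mult_left_const_nth sq[OF f(2)] sq[OF f(3)] sq[OF f(4)]
        sq[of 0 "g0 w", unfolded of_nat_0 diff_zero, OF f(1)])
  with * have e: "e 0 (g0 w) = 0" "e 2 (g1 w) = 0" "e 2 (g2 w) = 0" "e 4 (cab w) = 0"
    using squares_independent by metis+
  have step: "filt (int n + 1 - int d) r" if "filt (int n - int d) r" "e d r = 0" for d r
  proof (cases "n < d")
    case True
    then show ?thesis by (intro filt.base) simp
  next
    case False
    then have nd: "int n - int d = int (n - d)" by simp
    have "spec r $ nat (int (n - d)) = 0" using that(2) False unfolding e_def nat_int by simp
    then have "filt (int (n - d) + 1) r"
      by (rule filt_Suc[OF that(1)[unfolded nd], rotated]) simp
    moreover have "int (n - d) + 1 = int n + 1 - int d" using nd by linarith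
    ultimately show ?thesis by (simp only:)
  qed
  show ?thesis using step[OF f(2) e(2)] step[OF f(3) e(3)] step[OF f(4) e(4)] step[of 0 "g0 w"] f(1) e(1)
    by (simp add: cfilt_def)
qed

lemma cfilt_all_imp_0: "(\<And>n. cfilt n w) \<Longrightarrow> w = 0"
proof -
  assume *: "\<And>n. cfilt n w"
  have "filt n (g0 w) \<and> filt n (g1 w) \<and> filt n (g2 w) \<and> filt n (cab w)" for n
    using *[of n] *[of "n + 2"] *[of "n + 4"] by (simp add: cfilt_def)
  then have "g0 w = 0" "g1 w = 0" "g2 w = 0" "cab w = 0"
    using filt_all_imp_0 by blast+
  then show ?thesis by (simp add: crossed_eq_iff g0_def g1_def g2_def)
qed

lemma crossed_reduced:
  fixes w :: crossed
  assumes "w * w = 0"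
  shows "w = 0"
proof (rule cfilt_all_imp_0)
  fix n
  have "cfilt (int k) w" for k
  proof (induction k)
    case 0
    show ?case by (simp add: cfilt_def filt.base)
  next
    case (Suc k)
    then show ?case using cfilt_Suc[of k w] assms by (simp add: cfilt_0 add.commute)
  qed
  then show "cfilt n w" by (rule cfilt_less[of "int (nat n)"]) simp
qed

lemma crossed_nilpotent:
  fixes w :: crossed
  shows "w ^ 2 ^ k = 0 \<Longrightarrow> w = 0"
proof (induction k)
  case (Suc k)
  have "w ^ 2 ^ Suc k = w ^ 2 ^ k * w ^ 2 ^ k" by (simp add: mult_2 power_add)
  with Suc show ?case using crossed_reduced by metis
qed simp

section \<open>Elements of finite order\<close>

lemma one_plus_power_2_power:
  fixes w :: crossed
  shows "(1 + w) ^ 2 ^ k = 1 + w ^ 2 ^ k"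
proof (induction k)
  case (Suc k)
  have "(1 + w) ^ 2 ^ Suc k = (1 + w) ^ 2 ^ k * (1 + w) ^ 2 ^ k" by (simp add: mult_2 power_add)
  also have "\<dots> = 1 + w ^ 2 ^ k * w ^ 2 ^ k"
    unfolding Suc.IH by (simp add: distrib_left distrib_right add.assoc)
  also have "w ^ 2 ^ k * w ^ 2 ^ k = w ^ 2 ^ Suc k" by (simp add: mult_2 power_add)
  finally show ?case .
qed simp

lemma cfilt_one_plus_power:
  assumes "cfilt n w" "n \<ge> 0"
  shows "cfilt (2 * n) ((1 + w) ^ m + (1 + of_nat m * w))"
proof (induction m)
  case (Suc m)
  have "(1 + w) ^ Suc m + (1 + of_nat (Suc m) * w)
     = (1 + w) * ((1 + w) ^ m + (1 + of_nat m * w)) + of_nat m * (w * w)"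
    by (simp add: distrib_left distrib_right add.assoc of_nat_char_2) 
  moreover have "cfilt 0 (1 + w)" using assms
    by (intro cfilt_add) (auto elim: cfilt_less simp: cfilt_def filt.base)
  then have "cfilt (2 * n) ((1 + w) * ((1 + w) ^ m + (1 + of_nat m * w)))"
    by (rule cfilt_mult_le[OF _ Suc.IH]) simp
  moreover have "cfilt (2 * n) (of_nat m * (w * w))"
    using cfilt_mult[OF assms(1) assms(1)] by (simp add: of_nat_char_2 cfilt_0)
  ultimately show ?case by (simp only: cfilt_add)
qed (simp add: cfilt_0)

lemma crossed_odd_torsion:
  fixes u :: crossed
  assumes "u ^ m = 1" "odd m" "cfilt 1 (1 + u)"
  shows "u = 1"
proof -
  define w where "w = 1 + u"
  have u: "u = 1 + w" by (simp add: w_def)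
  have double: "cfilt (2 * n) w" if "cfilt n w" "n \<ge> 0" for n
    using cfilt_one_plus_power[OF that, of m] assms(1,2) by (simp add: u of_nat_char_2)
  have "cfilt (2 ^ k) w" for k
    by (induction k) (use assms(3) double in \<open>auto simp: w_def\<close>)
  moreover have "n \<le> 2 ^ nat n" for n :: int
    using of_nat_mono[OF less_imp_le[OF less_exp[of "nat n"]], where 'a = int] by (simp split: if_splits)
  ultimately have "w = 0" using cfilt_all_imp_0 cfilt_less by metis
  then show ?thesis by (simp add: u)
qed

lemma two_power_times_odd:
  fixes n :: nat
  assumes "n > 0"
  shows "\<exists>k m. n = 2 ^ k * m \<and> odd m"
  using assms
proof (induction n rule: less_induct)
  case (less n)
  show ?case
  proof (cases "even n")
    case True
    then obtain d where d: "n = 2 * d" by (elim evenE)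
    with less.prems have "d < n" "d > 0" by auto
    from less.IH[OF this] obtain k m where "d = 2 ^ k * m" "odd m" by blast
    then have "n = 2 ^ Suc k * m \<and> odd m" using d by simp
    then show ?thesis by blast
  next
    case False
    then show ?thesis by (intro exI[of _ 0] exI[of _ n]) simp
  qed
qed

text \<open>With n = 2^k m and m odd, v = u^(2^k) satisfies v^m = 1, hence v = 1. Then (1 + u)^(2^k)
  = 1 + v = 0, and 1 + u is nilpotent.\<close>

lemma crossed_torsion_free:
  fixes u :: crossed
  assumes "u ^ n = 1" "n > 0"
  shows "u = 1"
proof -
  have "cfilt 1 (1 + u)"
  \<comment> \<open>If u had augmentation 0, all its positive powers would have weight at least 1,
    and so would 1, contrary to its specialisation.\<close>
  proof (cases "filt 1 (g0 u)")
    case True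
    then have "cfilt 1 u" by (simp add: cfilt_def filt.base)
    then have "cfilt 1 (u ^ Suc k)" for k
      by (induction k) (auto intro: cfilt_mult_le)
    then have "cfilt 1 1" using assms by (metis gr0_implies_Suc)
    then have "filt 1 1" by (simp add: cfilt_def g0_def)
    then have "spec 1 $ 0 = 0" by (rule spec_nth_eq_0) simp
    then show ?thesis by simp
  next
    case False
    then have "filt 4 (g0 u + 1)" using filt_4_cases filt.less[of 4 "g0 u" 1] by auto
    then show ?thesis
      by (auto simp: cfilt_def filt.base g0_def ac_simps elim: filt.less)
  qed
  obtain k m where n: "n = 2 ^ k * m" "odd m"
    using two_power_times_odd[OF assms(2)] by blast
  define v where "v = u ^ 2 ^ k"
  have w: "(1 + u) ^ 2 ^ k = 1 + v" by (simp add: one_plus_power_2_power v_def)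
  have "cfilt 1 ((1 + u) ^ Suc j)" for j
    by (induction j) (use \<open>cfilt 1 (1 + u)\<close> in \<open>auto intro: cfilt_mult_le\<close>)
  then have "cfilt 1 ((1 + u) ^ 2 ^ k)"
    by (metis Suc_pred zero_less_numeral zero_less_power)
  then have "cfilt 1 (1 + v)" by (simp add: w)
  moreover have "v ^ m = 1" using assms(1) by (simp add: v_def n power_mult)
  ultimately have "v = 1" using n(2) crossed_odd_torsion by blast
  then have "(1 + u) ^ 2 ^ k = 0" using w by simp
  then have "1 + u = 0" by (rule crossed_nilpotent)
  then show ?thesis by (simp add: add_eq_0_char_2)
qed

section \<open>Linearity\<close>

definition type_ring :: "'k::field ring"
  where "type_ring = \<lparr>carrier = UNIV, monoid.mult = (*), one = 1, zero = 0, add = (+)\<rparr>"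

lemma type_ring_simps [simp]:
  "carrier type_ring = UNIV" "x \<otimes>\<^bsub>type_ring\<^esub> y = x * y" "\<one>\<^bsub>type_ring\<^esub> = 1"
  "x \<oplus>\<^bsub>type_ring\<^esub> y = x + y" "\<zero>\<^bsub>type_ring\<^esub> = 0"
  by (simp_all add: type_ring_def)

lemma field_type_ring: "field (type_ring :: 'k::field ring)"
proof (rule cring.cring_fieldI2)
  show "cring (type_ring :: 'k ring)"
  proof (rule cringI)
    show "abelian_group (type_ring :: 'k ring)"
      by (rule abelian_groupI) (auto intro: exI[of _ "- x" for x])
    show "comm_monoid (type_ring :: 'k ring)"
      by (rule comm_monoidI) (auto simp: ac_simps)
  qed (simp add: distrib_right)
  fix x :: 'k
  assume "x \<noteq> \<zero>\<^bsub>type_ring\<^esub>"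
  then show "\<exists>y\<in>carrier type_ring. x \<otimes>\<^bsub>type_ring\<^esub> y = \<one>\<^bsub>type_ring\<^esub>"
    by (intro bexI[of _ "inverse x"]) auto
qed simp

lemma finsum_type_ring:
  fixes f :: "'a \<Rightarrow> 'k::field"
  assumes "finite A"
  shows "finsum type_ring f A = sum f A"
proof -
  interpret field "type_ring :: 'k ring" by (rule field_type_ring)
  show ?thesis using assms by induction auto
qed

definition embed :: "laurent \<Rightarrow> bit poly poly fps fract"
  where "embed r = Fract (spec r) 1"

lemma embed_simps [simp]:
  "embed 0 = 0" "embed 1 = 1" "embed (r + s) = embed r + embed s" "embed (r * s) = embed r * embed s"
  by (simp_all add: embed_def Zero_fract_def One_fract_def)

lemma embed_eq_iff [simp]: "embed r = embed s \<longleftrightarrow> r = s"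
  using inj_spec by (auto simp: embed_def eq_fract inj_eq)

definition coord :: "nat \<Rightarrow> crossed \<Rightarrow> laurent"
  where "coord i w = (if i = 0 then ce w else if i = 1 then ca w else if i = 2 then cb w else cab w)"

definition unit_vec :: "nat \<Rightarrow> crossed"
  where "unit_vec i = (if i = 0 then 1 else if i = 1 then Crossed 0 1 0 0 else
    if i = 2 then Crossed 0 0 1 0 else Crossed 0 0 0 1)"

lemma sum_lessThan_4: "sum f {..<4::nat} = f 0 + f 1 + f 2 + f 3"
  by (simp add: eval_nat_numeral)

lemma less_4_cases: "i < 4 \<Longrightarrow> i = 0 \<or> i = 1 \<or> i = 2 \<or> i = (3::nat)"
  by auto

lemma coord_add: "coord k (u + v) = coord k u + coord k v"
  and coord_scal: "coord k (scal r * u) = r * coord k u"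
  by (simp_all add: coord_def)

lemma coord_mult: "coord k (w * v) = (\<Sum>j<4. coord j w * coord k (unit_vec j * v))"
proof -
  have "w = scal (coord 0 w) * unit_vec 0 + scal (coord 1 w) * unit_vec 1
      + scal (coord 2 w) * unit_vec 2 + scal (coord 3 w) * unit_vec 3"
    by (simp add: crossed_eq_iff unit_vec_def coord_def)
  then have "w * v = (scal (coord 0 w) * unit_vec 0 + scal (coord 1 w) * unit_vec 1
      + scal (coord 2 w) * unit_vec 2 + scal (coord 3 w) * unit_vec 3) * v"
    by (rule arg_cong)
  then show ?thesis
    by (simp only: distrib_right mult.assoc coord_add coord_scal sum_lessThan_4)
qed

text \<open>Right multiplication on the free left \<open>R\<close>-module \<open>R \<oplus> R a \<oplus> R b \<oplus> R ab\<close>, acting on row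
  vectors.\<close>

definition regular_rep :: "crossed \<Rightarrow> nat \<times> nat \<Rightarrow> bit poly poly fps fract"
  where "regular_rep u = (\<lambda>(i, j)\<in>{..<4} \<times> {..<4}. embed (coord j (unit_vec i * u)))"

lemma regular_rep_carrier: "regular_rep u \<in> carrier (matrix_monoid 4 type_ring)"
  by (simp add: regular_rep_def matrix_monoid_def)

lemma regular_rep_mult:
  "regular_rep (u * v) = regular_rep u \<otimes>\<^bsub>matrix_monoid 4 type_ring\<^esub> regular_rep v"
proof (rule ext, clarify)
  fix i j :: nat
  have "embed (coord j (unit_vec i * u * v))
      = (\<Sum>k<4. embed (coord k (unit_vec i * u)) * embed (coord j (unit_vec k * v)))"
    by (subst coord_mult) (simp add: sum_lessThan_4)
  then show "regular_rep (u * v) (i, j) = (regular_rep u \<otimes>\<^bsub>matrix_monoid 4 type_ring\<^esub> regular_rep v) (i, j)"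
    by (auto simp: regular_rep_def matrix_monoid_def finsum_type_ring mult.assoc intro!: sum.cong)
qed

lemma regular_rep_1: "regular_rep 1 = \<one>\<^bsub>matrix_monoid 4 type_ring\<^esub>"
proof -
  have "embed (coord j (unit_vec i)) = (if i = j then 1 else 0)" if "i < 4" "j < 4" for i j
    using less_4_cases[OF that(1)] less_4_cases[OF that(2)]
    by (auto simp: coord_def unit_vec_def)
  then show ?thesis by (auto simp: regular_rep_def matrix_monoid_def intro!: restrict_ext)
qed

text \<open>Row 0 lists the coordinates of 1 u = u.\<close>

lemma inj_regular_rep: "inj regular_rep"
proof (rule injI)
  fix u v assume eq: "regular_rep u = regular_rep v"
  have "coord j u = coord j v" if "j < 4" for j
    using fun_cong[OF eq, of "(0, j)"] that by (simp add: regular_rep_def unit_vec_def)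
  from this[of 0] this[of 1] this[of 2] this[of 3] show "u = v"
    by (simp add: crossed_eq_iff coord_def)
qed

lemma linear_group_crossedI:
  assumes "group G" and inj: "inj_on \<phi> (carrier G)"
    and mult: "\<And>g h. g \<in> carrier G \<Longrightarrow> h \<in> carrier G \<Longrightarrow> \<phi> (g \<otimes>\<^bsub>G\<^esub> h) = \<phi> g * (\<phi> h :: crossed)"
    and one: "\<phi> \<one>\<^bsub>G\<^esub> = 1"
  shows "linear_group G"
proof -
  interpret G: group G by fact
  let ?F = "type_ring :: bit poly poly fps fract ring"
  let ?M = "matrix_monoid 4 ?F"
  define \<psi> where "\<psi> g = regular_rep (\<phi> g)" for g
  have unit: "\<psi> g \<in> Units ?M" if g: "g \<in> carrier G" for g
  proof -
    have "\<psi> g \<otimes>\<^bsub>?M\<^esub> \<psi> (inv\<^bsub>G\<^esub> g) = \<one>\<^bsub>?M\<^esub>" "\<psi> (inv\<^bsub>G\<^esub> g) \<otimes>\<^bsub>?M\<^esub> \<psi> g = \<one>\<^bsub>?M\<^esub>"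
      using g by (simp_all add: \<psi>_def one regular_rep_1 flip: regular_rep_mult mult)
    then show ?thesis unfolding Units_def by (auto simp: \<psi>_def regular_rep_carrier)
  qed
  have hom: "\<psi> \<in> hom G (GL 4 ?F)"
    using unit by (auto simp: hom_def GL_def units_of_carrier units_of_mult)
      (simp add: \<psi>_def mult regular_rep_mult)
  have grF: "group (GL 4 ?F)"
    using field.axioms(1)[OF field_type_ring] by (intro group_GL cring.axioms(1) domain.axioms(1))
  interpret \<psi>: group_hom G "GL 4 ?F" \<psi>
    using assms(1) grF hom by (simp add: group_hom_def group_hom_axioms_def)
  have "inj_on \<psi> (carrier G)"
    unfolding \<psi>_def using inj inj_regular_rep by (auto simp: inj_on_def)
  then have "\<psi> \<in> iso G ((GL 4 ?F)\<lparr>carrier := \<psi> ` carrier G\<rparr>)"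
    using hom by (auto simp: iso_def bij_betw_def hom_def)
  then show ?thesis
    using linear_groupI[OF assms(1) field_type_ring _ \<psi>.img_is_subgroup] is_isoI by fastforce
qed

section \<open>Matrices over the polynomial ring\<close>

datatype mat2 = Mat2 (m11: "bit poly") (m12: "bit poly") (m21: "bit poly") (m22: "bit poly")

lemma mat2_eq_iff: "A = B \<longleftrightarrow> m11 A = m11 B \<and> m12 A = m12 B \<and> m21 A = m21 B \<and> m22 A = m22 B"
  by (auto intro: mat2.expand)

instantiation mat2 :: ring_1
begin

definition "0 = Mat2 0 0 0 0"
definition "1 = Mat2 1 0 0 1"
definition "A + B = Mat2 (m11 A + m11 B) (m12 A + m12 B) (m21 A + m21 B) (m22 A + m22 B)"
definition "- A = Mat2 (- m11 A) (- m12 A) (- m21 A) (- m22 A)"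
definition "A - B = Mat2 (m11 A - m11 B) (m12 A - m12 B) (m21 A - m21 B) (m22 A - m22 B)"
definition "A * B = Mat2 (m11 A * m11 B + m12 A * m21 B) (m11 A * m12 B + m12 A * m22 B)
  (m21 A * m11 B + m22 A * m21 B) (m21 A * m12 B + m22 A * m22 B)"

lemma mat2_sel [simp]:
  "m11 0 = 0" "m12 0 = 0" "m21 0 = 0" "m22 0 = 0"
  "m11 1 = 1" "m12 1 = 0" "m21 1 = 0" "m22 1 = 1"
  "m11 (A + B) = m11 A + m11 B" "m12 (A + B) = m12 A + m12 B"
  "m21 (A + B) = m21 A + m21 B" "m22 (A + B) = m22 A + m22 B"
  "m11 (A - B) = m11 A - m11 B" "m12 (A - B) = m12 A - m12 B"
  "m21 (A - B) = m21 A - m21 B" "m22 (A - B) = m22 A - m22 B"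
  "m11 (- A) = - m11 A" "m12 (- A) = - m12 A" "m21 (- A) = - m21 A" "m22 (- A) = - m22 A"
  "m11 (A * B) = m11 A * m11 B + m12 A * m21 B" "m12 (A * B) = m11 A * m12 B + m12 A * m22 B"
  "m21 (A * B) = m21 A * m11 B + m22 A * m21 B" "m22 (A * B) = m21 A * m12 B + m22 A * m22 B"
  by (simp_all add: zero_mat2_def one_mat2_def plus_mat2_def minus_mat2_def uminus_mat2_def
      times_mat2_def)

instance
  by standard (simp_all add: mat2_eq_iff algebra_simps)

end

instance mat2 :: ring_char_2
  by standard (simp only: mat2_eq_iff mat2_sel one_add_one_eq_0 add_self)

definition det2 :: "mat2 \<Rightarrow> bit poly"
  where "det2 A = m11 A * m22 A + m12 A * m21 A"

lemma det2_mult: "det2 (A * B) = det2 A * det2 B"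
  by (simp add: det2_def algebra_simps)

lemma bit_poly_mult_eq_1:
  fixes p q :: "bit poly"
  assumes "p * q = 1"
  shows "p = 1" "q = 1"
proof -
  have "is_unit p" "is_unit q" using assms by (metis dvd_triv_left dvd_triv_right)+
  then obtain c d where "p = [:c:]" "c \<noteq> 0" "q = [:d:]" "d \<noteq> 0"
    by (metis is_unit_poly_iff not_is_unit_0)
  then show "p = 1" "q = 1" by (simp_all add: one_pCons)
qed

text \<open>The only unit among the polynomials is 1, so every invertible matrix lies in
  SL_2.\<close>

lemma det2_unit: "A * B = 1 \<Longrightarrow> det2 A = 1"
proof (rule bit_poly_mult_eq_1)
  assume "A * B = 1"
  then have "det2 A * det2 B = det2 1" by (simp only: det2_mult [symmetric])
  then show "det2 A * det2 B = 1" by (simp add: det2_def)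
qed

section \<open>A homomorphism from SL_2 to the additive group of polynomials\<close>

abbreviation shear :: "bit poly \<Rightarrow> mat2" where "shear f \<equiv> Mat2 1 f 0 1"
abbreviation swap :: mat2 where "swap \<equiv> Mat2 0 1 1 0"

text \<open>Represents the class of \<open>f\<close> modulo constants. Constants have to be killed:
  \<open>swap * shear 1\<close> has order 3, which in characteristic 2 forces \<open>shear 1\<close>
  to have the same value as \<open>swap\<close>, namely 0.\<close>

definition nonconst :: "bit poly \<Rightarrow> bit poly"
  where "nonconst f = f + [:poly.coeff f 0:]"

lemma nonconst_add [simp]: "nonconst (f + g) = nonconst f + nonconst g"
proof -
  have "[:x + y:] = [:x:] + [:y:]" for x y :: bit by simp
  then show ?thesis by (simp only: nonconst_def Polynomial.coeff_add ac_simps)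
qed

lemma nonconst_0 [simp]: "nonconst 0 = 0" and nonconst_1 [simp]: "nonconst 1 = 0"
  by (simp_all add: nonconst_def one_pCons)

text \<open>The sum of the non-constant parts of the partial quotients in the Euclidean algorithm for the
  first column. As \<open>SL\<^sub>2(\<bbbF>\<^sub>2[s])\<close> is the amalgam of \<open>SL\<^sub>2(\<bbbF>\<^sub>2)\<close> and the group of upper triangular
  matrices, this is a homomorphism to the additive group.\<close>

function euclid :: "bit poly \<Rightarrow> bit poly \<Rightarrow> bit poly \<Rightarrow> bit poly \<Rightarrow> bit poly" where
  \<comment> \<open>For c = 0 and determinant 1 the matrix is \<open>shear b\<close>. Otherwise it
    is \<open>shear (a div c) * swap\<close> times the matrix of the recursive call.\<close>
  "euclid a b c d = (if c = 0 then nonconst b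
     else nonconst (a div c) + euclid c d (a mod c) (b + (a div c) * d))"
  by auto
termination
  by (relation "measure (\<lambda>(a, b, c, d). if c = 0 then 0 else Suc (Polynomial.degree c))")
    (auto dest: degree_mod_less)

declare euclid.simps [simp del]

definition euclid_hom :: "mat2 \<Rightarrow> bit poly"
  where "euclid_hom A = euclid (m11 A) (m12 A) (m21 A) (m22 A)"

lemma euclid_hom_shear_mult:
  assumes "det2 A = 1"
  shows "euclid_hom (shear f * A) = nonconst f + euclid_hom A"
proof (cases "m21 A = 0")
  case True
  then have "m11 A * m22 A = 1" using assms by (simp add: det2_def)
  then have "m22 A = 1" by (rule bit_poly_mult_eq_1)
  then show ?thesis
    by (simp add: euclid_hom_def euclid.simps[of _ _ 0] True)
next
  case False
  have "(f * m21 A + m11 A) div m21 A = f + m11 A div m21 A"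
    using False by (simp add: poly_div_add_left)
  moreover have "(f * m21 A + m11 A) mod m21 A = m11 A mod m21 A" by simp
  moreover have "(m12 A + f * m22 A) + (f + m11 A div m21 A) * m22 A = m12 A + m11 A div m21 A * m22 A"
    by (simp add: algebra_simps)
  ultimately show ?thesis using False
    by (simp add: euclid_hom_def euclid.simps[of _ _ "m21 A"] ac_simps)
qed

lemma lead_coeff_bit: "p \<noteq> 0 \<Longrightarrow> lead_coeff p = (1::bit)"
  by (metis bit_not_one_iff leading_coeff_0_iff)

text \<open>If the degrees in the first column differ, starting with the smaller entry on top gives
  quotient 0, so the first step merely swaps the rows. If they agree, both leading coefficients are
  1 and both quotients are 1; the two remainders of the computation then differ by
  \<open>shear 1\<close>, which has value 0.\<close>

lemma euclid_hom_swap_mult: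
  assumes "det2 A = 1"
  shows "euclid_hom (swap * A) = euclid_hom A"
proof -
  obtain a b c d where A: "A = Mat2 a b c d" by (cases A)
  have small: "euclid a b c d = euclid c d a b" if "Polynomial.degree a < Polynomial.degree c \<or> a = 0" "c \<noteq> 0" for a b c d
  proof -
    have "a div c = 0" "a mod c = a" using that by (auto simp: div_poly_less mod_poly_less)
    then show ?thesis using that by (simp add: euclid.simps[of a b c d])
  qed
  consider "c = 0" | "a = 0" | "c \<noteq> 0" "Polynomial.degree a < Polynomial.degree c"
    | "a \<noteq> 0" "Polynomial.degree c < Polynomial.degree a"
    | "a \<noteq> 0" "c \<noteq> 0" "Polynomial.degree a = Polynomial.degree c" by linarith
  then have "euclid c d a b = euclid a b c d"
  proof cases
    case 1
    with assms have "a \<noteq> 0" by (auto simp: A det2_def)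
    with 1 show ?thesis using small[of c a d b] by simp
  next
    case 2
    with assms have "c \<noteq> 0" by (auto simp: A det2_def)
    with 2 show ?thesis using small[of a c b d] by simp
  next
    case 3
    then show ?thesis using small[of a c b d] by simp
  next
    case 4
    then show ?thesis using small[of c a d b] by simp
  next
    case 5
    have r: "a + c = 0 \<or> Polynomial.degree (a + c) < Polynomial.degree c"
    proof (rule ccontr)
      assume n: "\<not> ?thesis"
      moreover have "Polynomial.degree (a + c) \<le> Polynomial.degree c"
        using 5 Polynomial.degree_add_le[of a "Polynomial.degree c" c] by simp
      ultimately have "Polynomial.degree (a + c) = Polynomial.degree c" by auto
      then have "lead_coeff (a + c) = lead_coeff a + lead_coeff c" using 5 by simp
      with 5 n lead_coeff_bit[of a] lead_coeff_bit[of c] lead_coeff_bit[of "a + c"] show False by simp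
    qed
    have div: "u div v = 1" "u mod v = u + v"
      if "u + v = 0 \<or> Polynomial.degree (u + v) < Polynomial.degree v" "v \<noteq> 0" for u v :: "bit poly"
    proof -
      have "r div v = 0 \<and> r mod v = r" if "r = 0 \<or> Polynomial.degree r < Polynomial.degree v" for r
        using that by (auto simp: div_poly_less mod_poly_less)
      from this[OF that(1)] have "(u + v) div v = 0" "(u + v) mod v = u + v" by blast+
      moreover have "(u + v + v) div v = (u + v) div v + 1" "(u + v + v) mod v = (u + v) mod v"
        by (rule div_add_self2[OF that(2)], rule mod_add_self2)
      ultimately show "u div v = 1" "u mod v = u + v" by (simp_all add: add.assoc)
    qed
    have "a div c = 1" "a mod c = a + c" "c div a = 1" "c mod a = a + c"
      using div[where u=a and v=c] div[where u=c and v=a] r 5 by (simp_all add: add.commute)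
    moreover have "euclid a b (a + c) (b + d) = euclid c d (a + c) (b + d)"
      using euclid_hom_shear_mult[of "Mat2 c d (a + c) (b + d)" 1] assms
      by (simp add: euclid_hom_def A det2_def algebra_simps)
    ultimately show ?thesis
      using 5 by (simp add: euclid.simps[of a b c d] euclid.simps[of c d a b] ac_simps)
  qed
  then show ?thesis by (simp add: A euclid_hom_def)
qed

text \<open>Induction along the Euclidean algorithm of the left factor, which writes it as a product
  of \<open>shear\<close> and \<open>swap\<close> matrices. This yields the homomorphism without any
  use of the amalgam structure.\<close>

lemma euclid_hom_mult:
  assumes "det2 A = 1" "det2 B = 1"
  shows "euclid_hom (A * B) = euclid_hom A + euclid_hom B"
proof -
  have "euclid_hom (Mat2 a b c d * B) = euclid a b c d + euclid_hom B" if "a * d + b * c = 1" for a b c d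
    using that
  proof (induction a b c d rule: euclid.induct)
    case (1 a b c d)
    show ?case
    proof (cases "c = 0")
      case True
      then have "a * d = 1" using 1(2) by simp
      then have "a = 1" "d = 1" by (rule bit_poly_mult_eq_1)+
      then show ?thesis
        using True euclid_hom_shear_mult[OF assms(2)] by (simp add: euclid.simps[of _ _ 0])
    next
      case False
      define q where "q = a div c"
      let ?A' = "Mat2 c d (a mod c) (b + q * d)"
      have a: "a mod c + q * c = a" by (simp add: q_def)
      have "Mat2 a b c d = shear q * (swap * ?A')"
        using a by (simp add: mat2_eq_iff algebra_simps)
      then have eq: "Mat2 a b c d * B = shear q * (swap * (?A' * B))" by (simp only: mult.assoc)
      have "a mod c = a + q * c" using a by (metis add.commute add_self_left)
      then have det: "c * (b + q * d) + d * (a mod c) = 1" using 1(2) by (simp add: algebra_simps)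
      then have d: "det2 (?A' * B) = 1" using assms(2) by (simp add: det2_mult) (simp add: det2_def)
      then have "det2 (swap * (?A' * B)) = 1" by (simp add: det2_mult[of swap]) (simp add: det2_def)
      then have "euclid_hom (Mat2 a b c d * B) = nonconst q + euclid_hom (?A' * B)"
        unfolding eq using d by (simp only: euclid_hom_shear_mult euclid_hom_swap_mult)
      also have "euclid_hom (?A' * B) = euclid c d (a mod c) (b + q * d) + euclid_hom B"
        unfolding q_def by (rule 1(1)[OF False]) (use det in \<open>simp add: q_def\<close>)
      finally show ?thesis using False by (simp add: euclid.simps[of a b c d] q_def ac_simps)
    qed
  qed
  from this[of "m11 A" "m22 A" "m12 A" "m21 A"] assms(1) show ?thesis
    by (simp add: euclid_hom_def det2_def)
qed

section \<open>The infinite dihedral quotient\<close>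

abbreviation svar :: "bit poly" where "svar \<equiv> [:0, 1:]"

text \<open>A companion matrix of t^2 + s t + 1, so that \<open>dt + dti\<close> is the scalar s. In
  characteristic 2 the shear \<open>db\<close> is an involution, and it conjugates \<open>dt\<close>
  to its inverse.\<close>

definition dt :: mat2 where "dt = Mat2 0 1 1 svar"
definition dti :: mat2 where "dti = Mat2 svar 1 1 0"
abbreviation db :: mat2 where "db \<equiv> shear svar"

lemma dihedral_relations:
  "dt * dti = 1" "dti * dt = 1" "db * db = 1" "db * dt = dti * db" "db * dti = dt * db"
  by (simp_all only: mat2_eq_iff mat2_sel dt_def dti_def mat2.sel mult_1_left mult_1_right
      mult_zero_left mult_zero_right add_0_left add_0_right add_self add.commute simp_thms)

lemma dihedral_relations_left:
  "dt * (dti * A) = A" "dti * (dt * A) = A" "db * (db * A) = A"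
  "db * (dt * A) = dti * (db * A)" "db * (dti * A) = dt * (db * A)"
  by (simp_all only: mult.assoc [symmetric] dihedral_relations mult_1_left)

definition tpow :: "int \<Rightarrow> mat2" where "tpow = upow dt dti"

lemma tpow_add: "tpow (i + j) = tpow i * tpow j"
  unfolding tpow_def by (rule upow_add) (simp_all add: dihedral_relations)

lemma tpow_simps [simp]: "tpow 0 = 1" "tpow 1 = dt" "tpow (- 1) = dti"
  by (simp_all add: tpow_def)

lemma db_tpow: "db * tpow i = tpow (- i) * db"
proof -
  have "db * dt ^ n = dti ^ n * db" "db * dti ^ n = dt ^ n * db" for n
    by (induction n) (simp_all only: power_0 power_Suc mult.assoc mult_1_left mult_1_right
        dihedral_relations_left dihedral_relations)
  then show ?thesis by (auto simp: tpow_def upow_def)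
qed

definition lmat :: "laurent \<Rightarrow> mat2" where "lmat = lift (\<lambda>(i, j, k). tpow (2 * i))"

lemma lmat_add: "lmat (r + s) = lmat r + lmat s"
  and lmat_mono: "lmat (lmono i j k) = tpow (2 * i)"
  and lmat_0: "lmat 0 = 0"
  by (simp_all add: lmat_def)

lemma lmat_1: "lmat 1 = 1"
  using lmat_mono[of 0 0 0] by simp

lemma lmat_mult: "lmat (r * s) = lmat r * lmat s"
  unfolding lmat_def by (rule lift_mult) (auto simp: tpow_add distrib_left)

lemma lmat_twist_a: "lmat (twist_a r) = lmat r"
  and dt_lmat: "dt * lmat r = lmat r * dt"
  and db_lmat: "db * lmat r = lmat (twist_b r) * db"
proof -
  have "lmat (twist_a r) = lmat r \<and> dt * lmat r = lmat r * dt \<and> db * lmat r = lmat (twist_b r) * db"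
  proof (induction r rule: poly_mapping_bit_induct)
    case (single k)
    obtain i j l where k: "k = (i, j, l)" by (cases k)
    have "dt * tpow (2 * i) = tpow (2 * i) * dt"
      using tpow_add[of 1 "2 * i"] tpow_add[of "2 * i" 1] by (simp add: add.commute)
    then show ?case by (simp add: k lmat_mono db_tpow)
  qed (simp_all add: lmat_0 lmat_add distrib_left distrib_right)
  then show "lmat (twist_a r) = lmat r" "dt * lmat r = lmat r * dt" "db * lmat r = lmat (twist_b r) * db"
    by auto
qed

lemma lmat_left:
  "dt * (lmat r * A) = lmat r * (dt * A)" "db * (lmat r * A) = lmat (twist_b r) * (db * A)"
  by (simp_all only: mult.assoc [symmetric] dt_lmat db_lmat)

lemma lmat_shift:
  "lmat (shift 1 j k r) = lmat r * (dt * dt)" "lmat (shift 0 j k r) = lmat r"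
  "lmat (shift (- 1) j k r) = lmat r * (dti * dti)"
proof -
  have "lmat (shift i j k r) = lmat r * tpow (2 * i)" for i
    unfolding shift_def by (subst mult.commute) (simp only: lmat_mult lmat_mono)
  note * = this[of 1] this[of 0] this[of "- 1"]
  show "lmat (shift 1 j k r) = lmat r * (dt * dt)" "lmat (shift 0 j k r) = lmat r"
    "lmat (shift (- 1) j k r) = lmat r * (dti * dti)"
    unfolding * using tpow_add[of 1 1] tpow_add[of "- 1" "- 1"] by simp_all
qed

text \<open>The representation of \<open>\<bbbF>\<^sub>2[P]\<close> through the infinite dihedral quotient of \<open>P\<close> by \<open>y\<close> and \<open>z\<close>.\<close>

definition dihedral_rep :: "crossed \<Rightarrow> mat2"
  where "dihedral_rep w = lmat (ce w) + lmat (ca w) * dt + lmat (cb w) * db + lmat (cab w) * (dt * db)"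

lemma dihedral_rep_1: "dihedral_rep 1 = 1"
  by (simp add: dihedral_rep_def lmat_0 lmat_1)

lemma dihedral_rep_mult: "dihedral_rep (u * v) = dihedral_rep u * dihedral_rep v"
  unfolding dihedral_rep_def crossed_mult_sel
  by (simp only: lmat_add lmat_shift lmat_mult lmat_twist_a distrib_left distrib_right mult.assoc
      lmat_left dt_lmat db_lmat dihedral_relations_left dihedral_relations mult_1_left mult_1_right
      add.assoc add.commute add.left_commute)

section \<open>Dickson polynomials and the images of Gardam's units\<close>

fun dickson :: "nat \<Rightarrow> bit poly" where
  "dickson 0 = 0"
| "dickson (Suc 0) = svar"
| "dickson (Suc (Suc n)) = svar * dickson (Suc n) + dickson n"

abbreviation smat :: "bit poly \<Rightarrow> mat2" where "smat f \<equiv> Mat2 f 0 0 f"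

text \<open>Multiplying t^(n+1) + t^(-n-1) by t + t^-1 gives the sums for n + 2 and n, which is the
  recursion of \<open>dickson\<close>; its value at 0 is 2 = 0.\<close>

lemma dt_power_add_dti_power: "dt ^ n + dti ^ n = smat (dickson n)"
proof (induction n rule: dickson.induct)
  case (3 n)
  have s: "dt + dti = smat svar" by (simp only: mat2_eq_iff mat2_sel dt_def dti_def mat2.sel) simp
  have "(dt + dti) * (dt ^ Suc n + dti ^ Suc n)
      = dt ^ Suc (Suc n) + dti ^ Suc (Suc n) + (dt ^ n + dti ^ n)"
    by (simp add: distrib_left distrib_right dihedral_relations_left mult.assoc ac_simps)
  then have "dt ^ Suc (Suc n) + dti ^ Suc (Suc n)
     = (dt + dti) * (dt ^ Suc n + dti ^ Suc n) + (dt ^ n + dti ^ n)"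
    by (simp add: add.assoc)
  also have "\<dots> = smat svar * smat (dickson (Suc n)) + smat (dickson n)"
    unfolding s 3 ..
  also have "\<dots> = smat (dickson (Suc (Suc n)))"
    unfolding dickson.simps by (simp only: mat2_eq_iff mat2_sel mat2.sel mult_zero_left mult_zero_right add_0_left add_0_right simp_thms)
  finally show ?case .
qed (simp_all only: mat2_eq_iff mat2_sel dt_def dti_def mat2.sel power_0 power_Suc dickson.simps, simp_all)

lemma degree_dickson: "n > 0 \<Longrightarrow> Polynomial.degree (dickson n) = n"
proof (induction n rule: dickson.induct)
  case (3 n)
  then have "Polynomial.degree (dickson (Suc n)) = Suc n" by simp
  moreover from this have "dickson (Suc n) \<noteq> 0" by auto
  ultimately have d: "Polynomial.degree (svar * dickson (Suc n)) = Suc (Suc n)"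
    by (subst Polynomial.degree_mult_eq) auto
  have "Polynomial.degree (dickson n) < Suc (Suc n)"
    using 3(2) by (cases "n = 0") auto
  then show ?case using d by (simp only: dickson.simps Polynomial.degree_add_eq_left)
qed auto

text \<open>Gardam's unit and its inverse, after the substitution \<open>a \<mapsto> a\<^bsup>2n+1\<^esup> = x\<^sup>n a\<close>, which fixes
  \<open>b\<close>, \<open>y\<close> and \<open>z\<close>.\<close>

definition gardam :: "int \<Rightarrow> crossed" where
  "gardam n = Crossed
    (1 + lmono (1 + 2 * n) 0 0 + lmono 0 1 0 + lmono (1 + 2 * n) 1 0
      + lmono 0 0 (- 1) + lmono (1 + 2 * n) 0 (- 1) + lmono 0 1 (- 1) + lmono (1 + 2 * n) 1 (- 1))
    (lmono (- 1 - n) (- 1) 0 + lmono (1 + 3 * n) 0 0 + lmono n (- 1) 1 + lmono n 0 1)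
    (1 + lmono (1 + 2 * n) 0 0 + lmono 0 (- 1) 1 + lmono (1 + 2 * n) 1 1)
    (lmono n 0 0 + lmono (1 + 3 * n) 0 (- 1) + lmono (- 1 - n) 0 (- 1) + lmono n 1 (- 1) + lmono n (- 1) (- 1))"

definition gardam_inv :: "int \<Rightarrow> crossed" where
  "gardam_inv n = Crossed
    (lmono (- 1 - 2 * n) 0 0 + 1 + lmono (- 1 - 2 * n) (- 1) 0 + lmono 0 (- 1) 0
      + lmono (- 1 - 2 * n) 0 1 + lmono 0 0 1 + lmono (- 1 - 2 * n) (- 1) 1 + lmono 0 (- 1) 1)
    (lmono (- 2 - 3 * n) (- 1) 0 + lmono n 0 0 + lmono (- 1 - n) (- 1) 1 + lmono (- 1 - n) 0 1)
    (lmono 0 (- 1) 0 + lmono (1 + 2 * n) (- 1) 0 + lmono 0 (- 2) 1 + lmono (1 + 2 * n) 0 1)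
    (lmono n 0 (- 1) + lmono (1 + 3 * n) 0 0 + lmono (- 1 - n) 0 0 + lmono n (- 1) 0 + lmono n 1 0)"

lemma gardam_mult: "gardam n * gardam_inv n = 1"
  by (simp add: crossed_eq_iff crossed_mult_sel gardam_def gardam_inv_def shift_mono mult_single
      distrib_left distrib_right add.assoc add.commute add.left_commute)

lemma gardam_inv_mult: "gardam_inv n * gardam n = 1"
  by (simp add: crossed_eq_iff crossed_mult_sel gardam_def gardam_inv_def shift_mono mult_single
      distrib_left distrib_right add.assoc add.commute add.left_commute)

lemma tpow_of_nat: "tpow (int n) = dt ^ n" and tpow_uminus_of_nat: "tpow (- int n) = dti ^ n"
  by (simp_all add: tpow_def upow_def)

text \<open>After y and z become 1, the coefficients of 1 and b cancel in pairs. With d = t^(4n+2) +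
  t^(-4n-2), those of a and ab leave t^(2n+1) (d + (1 + d) b). As d is scalar, the second factor has
  diagonal d + (1 + d) = 1, so it is a shear.\<close>

lemma dihedral_rep_gardam:
  "dihedral_rep (gardam (int n)) = dt ^ (2 * n + 1) * shear ((1 + dickson (4 * n + 2)) * svar)"
proof -
  define t where "t = dt ^ (2 * n + 1)"
  define d where "d = dickson (4 * n + 2)"
  have ints: "int (4 * n + 2) = 4 * int n + 2" "- int (4 * n + 2) = - 2 - 4 * int n" by simp_all
  have d: "smat d = tpow (4 * int n + 2) + tpow (- 2 - 4 * int n)"
    unfolding ints[symmetric] tpow_of_nat tpow_uminus_of_nat dt_power_add_dti_power d_def ..
  have td: "tpow (2 * int n + i) * dt = t * tpow i" for i
  proof -
    have "tpow (2 * int n + i) * dt = tpow ((2 * int n + i) + 1)" by (simp only: tpow_add tpow_simps)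
    also have "(2 * int n + i) + 1 = int (2 * n + 1) + i" by simp
    also have "tpow \<dots> = t * tpow i" by (simp only: tpow_add tpow_of_nat t_def)
    finally show ?thesis .
  qed
  have q: "lmat (ca (gardam (int n))) * dt = t * smat d"
    unfolding d distrib_left td[symmetric]
    by (simp add: gardam_def lmat_add lmat_mono distrib_right add.assoc add.commute add.left_commute)
  have s: "lmat (cab (gardam (int n))) * dt = t + t * smat d"
    unfolding d distrib_left td[symmetric] using td[of 0]
    by (simp add: gardam_def lmat_add lmat_mono distrib_right add.assoc add.commute add.left_commute)
  have pr: "lmat (ce (gardam (int n))) = 0" "lmat (cb (gardam (int n))) = 0"
    by (simp_all add: gardam_def lmat_add lmat_mono lmat_1 add.assoc add.commute add.left_commute)
  have "dihedral_rep (gardam (int n)) = t * (smat d + (1 + smat d) * db)"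
    unfolding dihedral_rep_def pr q mult.assoc[symmetric] s
    by (simp add: distrib_left distrib_right mult.assoc)
  also have "smat d + (1 + smat d) * db = shear ((1 + d) * svar)"
    by (simp only: mat2_eq_iff mat2_sel mat2.sel mult_zero_left mult_zero_right mult_1_left mult_1_right
        add_0_left add_0_right add.assoc add.commute add.left_commute add_self add_self_left distrib_left distrib_right simp_thms)
  finally show ?thesis unfolding t_def d_def .
qed

lemma euclid_hom_shear: "euclid_hom (shear f) = nonconst f"
  by (simp add: euclid_hom_def euclid.simps[of _ _ 0])

lemma det2_simps: "det2 dt = 1" "det2 (shear f) = 1" "det2 swap = 1" "det2 1 = 1"
  by (simp_all add: det2_def dt_def)

lemma det2_dt_power: "det2 (dt ^ n) = 1"
  by (induction n) (simp_all add: det2_simps det2_mult)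

lemma dt_eq: "dt = swap * shear svar"
  by (simp add: mat2_eq_iff dt_def)

lemma euclid_hom_dt_power: "euclid_hom (dt ^ n) = (if even n then 0 else svar)"
proof (induction n)
  case 0
  show ?case using euclid_hom_shear[of 0] by (simp add: one_mat2_def)
next
  case (Suc n)
  have "euclid_hom dt = nonconst svar"
    unfolding dt_eq by (simp add: euclid_hom_swap_mult det2_simps euclid_hom_shear)
  also have "nonconst svar = svar" by (simp add: nonconst_def)
  finally show ?case using Suc by (simp add: euclid_hom_mult det2_simps det2_dt_power)
qed

lemma degree_euclid_hom_gardam:
  "Polynomial.degree (euclid_hom (dihedral_rep (gardam (int n)))) = 4 * n + 3"
proof -
  define d where "d = dickson (4 * n + 2)"
  have d: "Polynomial.degree d = 4 * n + 2" unfolding d_def by (rule degree_dickson) simp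
  then have "Polynomial.degree (1 + d) = 4 * n + 2"
    by (subst Polynomial.degree_add_eq_right) simp_all
  moreover from this have "1 + d \<noteq> 0" by auto
  ultimately have f: "Polynomial.degree ((1 + d) * svar) = 4 * n + 3"
    by (subst Polynomial.degree_mult_eq) auto
  have "euclid_hom (dihedral_rep (gardam (int n))) = svar + nonconst ((1 + d) * svar)"
    unfolding dihedral_rep_gardam d_def
    by (subst euclid_hom_mult) (simp_all only: det2_simps det2_dt_power euclid_hom_dt_power euclid_hom_shear, simp)
  also have "\<dots> = (svar + [:poly.coeff ((1 + d) * svar) 0:]) + (1 + d) * svar"
    by (simp only: nonconst_def ac_simps)
  also have "Polynomial.degree \<dots> = 4 * n + 3"
    using f by (subst Polynomial.degree_add_eq_right) (auto intro: le_less_trans[OF Polynomial.degree_add_le_max])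
  finally show ?thesis .
qed

section \<open>Free subgroups\<close>

definition apply2 :: "mat2 \<Rightarrow> bit poly \<times> bit poly \<Rightarrow> bit poly \<times> bit poly"
  where "apply2 A v = (m11 A * fst v + m12 A * snd v, m21 A * fst v + m22 A * snd v)"

lemma apply2_mult: "apply2 (A * B) v = apply2 A (apply2 B v)"
  by (simp add: apply2_def algebra_simps)

lemma apply2_1: "apply2 1 v = v"
  by (simp add: apply2_def)

text \<open>Vectors whose quotient p/q is small at infinity: a shear of positive degree makes the
  quotient large, and \<open>swap\<close> makes it small again.\<close>

definition low :: "(bit poly \<times> bit poly) set"
  where "low = {(p, q). q \<noteq> 0 \<and> (p = 0 \<or> Polynomial.degree p < Polynomial.degree q)}"

lemma low_step:
  assumes "v \<in> low" "Polynomial.degree f > 0"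
  shows "apply2 swap (apply2 (shear f) v) \<in> low"
proof -
  obtain p q where v: "v = (p, q)" "q \<noteq> 0" "p = 0 \<or> Polynomial.degree p < Polynomial.degree q"
    using assms(1) by (auto simp: low_def)
  have f: "f \<noteq> 0" using assms(2) by auto
  have fq: "Polynomial.degree (f * q) = Polynomial.degree f + Polynomial.degree q"
    using f v(2) by (rule Polynomial.degree_mult_eq)
  have "Polynomial.degree (p + f * q) = Polynomial.degree f + Polynomial.degree q"
  proof (cases "p = 0")
    case False
    then show ?thesis using v(3) fq by (subst Polynomial.degree_add_eq_right) auto
  qed (simp add: fq)
  moreover from this have "p + f * q \<noteq> 0" using assms(2) by auto
  ultimately show ?thesis using assms(2) by (simp add: v(1) apply2_def low_def)
qed

text \<open>Ping-pong: a positive letter is sent to \<open>(w E(f))\<^sup>2\<close>, and the set attached to a letter contains the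
  images of all vectors in the sets attached to letters that may follow it in a reduced word.\<close>

definition letter_mat :: "('x \<Rightarrow> bit poly) \<Rightarrow> 'x \<times> bool \<Rightarrow> mat2"
  where "letter_mat F l = (if snd l then swap * shear (F (fst l)) * (swap * shear (F (fst l)))
    else shear (F (fst l)) * swap * (shear (F (fst l)) * swap))"

definition pong :: "('x \<Rightarrow> bit poly) \<Rightarrow> 'x \<times> bool \<Rightarrow> (bit poly \<times> bit poly) set"
  where "pong F l = (if snd l then (\<lambda>v. apply2 swap (apply2 (shear (F (fst l))) v)) ` low
    else apply2 (shear (F (fst l))) ` low)"

lemma apply2_shear_shear: "apply2 (shear f) (apply2 (shear g) v) = apply2 (shear (f + g)) v"
  by (simp add: apply2_def algebra_simps)

lemma apply2_swap_swap: "apply2 swap (apply2 swap v) = v"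
  by (simp add: apply2_def)

context
  fixes F :: "'x \<Rightarrow> bit poly" and S :: "'x set"
  assumes F: "\<And>x. x \<in> S \<Longrightarrow> Polynomial.degree (F x) > 0"
    \<comment> \<open>When letters of opposite sign meet, two swaps can cancel and the shears merge
      into \<open>shear (F x + F y)\<close>.\<close>
    "\<And>x y. x \<in> S \<Longrightarrow> y \<in> S \<Longrightarrow> x \<noteq> y \<Longrightarrow> Polynomial.degree (F x + F y) > 0"
begin

text \<open>It suffices that half of the square attached to \<open>l\<close> brings \<open>v\<close>
  into \<open>low\<close>. For equal signs this is \<open>low_step\<close> applied twice; for
  opposite signs \<open>m \<noteq> inv_letter l\<close> makes the generators distinct and
  \<open>low_step\<close> applies to the merged shear.\<close>

lemma pong_step:
  assumes "fst l \<in> S" "fst m \<in> S" "m \<noteq> inv_letter l" "v \<in> pong F m"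
  shows "apply2 (letter_mat F l) v \<in> pong F l"
proof -
  obtain x e where l: "l = (x, e)" by (cases l)
  obtain y e' where m: "m = (y, e')" by (cases m)
  have xy: "x \<in> S" "y \<in> S" "e = e' \<or> x \<noteq> y" using assms by (auto simp: l m inv_letter_def)
  note deg = F(1)[OF xy(1)] F(1)[OF xy(2)]
  from assms(4) obtain u where u: "u \<in> low"
    "v = (if e' then apply2 swap (apply2 (shear (F y)) u) else apply2 (shear (F y)) u)"
    by (auto simp: pong_def m split: if_splits)
  have ux: "apply2 swap (apply2 (shear (F x)) u) \<in> low" and uy: "apply2 swap (apply2 (shear (F y)) u) \<in> low"
    using low_step u(1) deg by blast+
  have uxy: "apply2 swap (apply2 (shear (F x + F y)) u) \<in> low" if "x \<noteq> y"
    using low_step u(1) F(2) xy that by blast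
  show ?thesis
  proof (cases e)
    case True
    have "apply2 swap (apply2 (shear (F x)) v) \<in> low"
    proof (cases e')
      case True
      then show ?thesis using low_step[OF uy deg(1)] by (simp add: u(2))
    next
      case False
      then show ?thesis using uxy xy(3) True by (simp add: u(2) apply2_shear_shear)
    qed
    then show ?thesis using True by (auto simp: l letter_mat_def pong_def apply2_mult)
  next
    case False
    have "apply2 swap (apply2 (shear (F x)) (apply2 swap v)) \<in> low"
    proof (cases e')
      case True
      then show ?thesis using uxy xy(3) False by (simp add: u(2) apply2_swap_swap apply2_shear_shear)
    next
      case False
      then show ?thesis using low_step[OF uy deg(1)] by (simp add: u(2))
    qed
    then show ?thesis using False by (auto simp: l letter_mat_def pong_def apply2_mult)
  qed
qed

text \<open>The base point (1, 1) is fixed by \<open>swap\<close>. It lies in no pong set, since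
  \<open>low_step\<close> would then put it into \<open>low\<close> although its entries have equal
  degree.\<close>

lemma pong_base:
  assumes "fst l \<in> S"
  shows "apply2 (letter_mat F l) (1, 1) \<in> pong F l" "(1, 1) \<notin> pong F l"
proof -
  define f where "f = F (fst l)"
  have f: "Polynomial.degree f > 0" using F(1)[OF assms] by (simp add: f_def)
  then have "Polynomial.degree (1 + f) = Polynomial.degree f"
    by (subst Polynomial.degree_add_eq_right) auto
  moreover from this f have "1 + f \<noteq> 0" by auto
  ultimately have low: "apply2 swap (apply2 (shear f) (1, 1)) \<in> low"
    using f by (simp add: apply2_def low_def)
  have swap: "apply2 swap (1, 1) = (1, 1)" by (simp add: apply2_def)
  show "apply2 (letter_mat F l) (1, 1) \<in> pong F l"
    using low by (auto simp: letter_mat_def pong_def apply2_mult swap simp flip: f_def)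
  show "(1, 1) \<notin> pong F l"
  proof
    assume "(1, 1) \<in> pong F l"
    then obtain v where v: "v \<in> low" "apply2 (shear f) v = (1, 1)"
      using swap by (auto simp: pong_def f_def split: if_splits) (metis apply2_swap_swap)
    have "apply2 swap (1, 1) \<in> low" using low_step[OF v(1) f] v(2) by simp
    then show False by (simp add: swap low_def)
  qed
qed

lemma reduced_word_pong:
  assumes "reduced w" "w \<noteq> []" "fst ` set w \<subseteq> S"
  shows "apply2 (foldr (\<lambda>l A. letter_mat F l * A) w 1) (1, 1) \<in> pong F (hd w)"
  using assms
proof (induction w rule: reduced.induct)
  case (1 l m w)
  then show ?case using pong_step[of l m] by (simp add: apply2_mult)
next
  case ("2_2" l)
  then show ?case using pong_base(1)[of l] by (simp add: apply2_mult apply2_1)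
qed simp

lemma reduced_word_ne_1:
  assumes "reduced w" "w \<noteq> []" "fst ` set w \<subseteq> S"
  shows "foldr (\<lambda>l A. letter_mat F l * A) w 1 \<noteq> 1"
proof
  assume "foldr (\<lambda>l A. letter_mat F l * A) w 1 = 1"
  with reduced_word_pong[OF assms] have "(1, 1) \<in> pong F (hd w)" by (simp add: apply2_1)
  moreover have "fst (hd w) \<in> S" using assms(2,3) by (cases w) auto
  ultimately show False using pong_base(2) by blast
qed

end

section \<open>Normal forms\<close>

lemma upow_commute:
  assumes "g * u = u * g" "g * v = v * (g :: 'a::monoid_mult)"
  shows "g * upow u v i = upow u v i * g"
proof -
  have "g * u ^ n = u ^ n * g" "g * v ^ n = v ^ n * g" for n
    using assms power_commuting_commutes[of u g n] power_commuting_commutes[of v g n] by simp_all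
  then show ?thesis by (simp add: upow_def)
qed

lemma upow_invert:
  assumes "g * u = v * g" "g * v = u * (g :: 'a::monoid_mult)"
  shows "g * upow u v i = upow u v (- i) * g"
proof -
  have "g * u ^ n = v ^ n * g \<and> g * v ^ n = u ^ n * g" for n
    by (induction n) (simp_all add: mult.assoc [symmetric] assms, simp_all add: mult.assoc)
  then show ?thesis by (auto simp: upow_def)
qed

lemma monoid_push_right:
  fixes X Y Z g :: "'a::monoid_mult"
  assumes "Y * g = g * Y" "Z * g = g * Z"
  shows "X * Y * Z * g = X * g * Y * Z"
proof -
  have "X * Y * Z * g = X * (Y * g) * Z" by (simp only: assms(2) mult.assoc)
  also have "\<dots> = X * g * Y * Z" by (simp only: assms(1) mult.assoc)
  finally show ?thesis .
qed

lemma monoid_push_left: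
  fixes X Y Z g :: "'a::monoid_mult"
  assumes "g * X = X' * g" "g * Y = Y' * g" "g * Z = Z' * g"
  shows "g * (X * Y * Z * u) = X' * Y' * Z' * (g * u)"
proof -
  have "g * (X * v) = X' * (g * v)" "g * (Y * v) = Y' * (g * v)" "g * (Z * v) = Z' * (g * v)" for v
    by (simp_all add: assms flip: mult.assoc)
  then show ?thesis by (simp only: mult.assoc)
qed

text \<open>Stated for a monoid with explicit inverses, so that everything is rewriting with
  associativity. The elements \<open>x\<close> to \<open>zi\<close> are parameters tied by
  equations, which lets them stay folded.\<close>

locale promislow_relations =
  fixes a ai b bi x xi y yi z zi :: "'a::monoid_mult"
  assumes inverses: "a * ai = 1" "ai * a = 1" "b * bi = 1" "bi * b = 1"
    and rel_b: "bi * (a * a) * b = ai * ai" and rel_a: "ai * (b * b) * a = bi * bi"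
    and x: "x = a * a" and xi: "xi = ai * ai" and y: "y = b * b" and yi: "yi = bi * bi"
    and z: "z = a * b * a * b" and zi: "zi = bi * ai * bi * ai"
begin

lemma inverses_left: "a * (ai * u) = u" "ai * (a * u) = u" "b * (bi * u) = u" "bi * (b * u) = u"
  by (simp_all add: inverses flip: mult.assoc)

lemma xyz_inverses: "x * xi = 1" "xi * x = 1" "y * yi = 1" "yi * y = 1" "z * zi = 1" "zi * z = 1"
  by (simp_all add: x xi y yi z zi mult.assoc inverses inverses_left)

lemma xyz_inverses_left:
  "x * (xi * u) = u" "xi * (x * u) = u" "y * (yi * u) = u" "yi * (y * u) = u"
  by (simp_all add: xyz_inverses flip: mult.assoc)

lemma conj_a: "a * x = x * a" "a * xi = xi * a" "a * y = yi * a" "a * yi = y * a"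
proof -
  show "a * x = x * a" "a * xi = xi * a"
    by (simp_all add: x xi mult.assoc inverses inverses_left)
  have "a * (ai * y * a) = a * yi" using rel_a by (simp add: y yi)
  then show ayi: "a * yi = y * a" by (simp add: mult.assoc inverses_left)
  have "yi * (a * yi) * y = yi * (y * a) * y" by (simp add: ayi)
  then show "a * y = yi * a" by (simp add: mult.assoc xyz_inverses xyz_inverses_left)
qed

lemma conj_b: "b * x = xi * b" "b * xi = x * b" "b * y = y * b" "b * yi = yi * b"
proof -
  show "b * y = y * b" "b * yi = yi * b"
    by (simp_all add: y yi mult.assoc inverses inverses_left)
  have "b * (bi * x * b) = b * xi" using rel_b by (simp add: x xi)
  then show bxi: "b * xi = x * b" by (simp add: mult.assoc inverses_left)
  have "xi * (b * xi) * x = xi * (x * b) * x" by (simp add: bxi)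
  then show "b * x = xi * b" by (simp add: mult.assoc xyz_inverses xyz_inverses_left)
qed

lemma conj_a_left: "a * (x * u) = x * (a * u)" "a * (xi * u) = xi * (a * u)"
    "a * (y * u) = yi * (a * u)" "a * (yi * u) = y * (a * u)"
  by (simp_all add: conj_a flip: mult.assoc)

lemma conj_b_left: "b * (x * u) = xi * (b * u)" "b * (xi * u) = x * (b * u)"
    "b * (y * u) = y * (b * u)" "b * (yi * u) = yi * (b * u)"
  by (simp_all add: conj_b flip: mult.assoc)

lemma squares: "a * a = x" "b * b = y" "a * (a * u) = x * u" "b * (b * u) = y * u"
  by (simp_all add: x y flip: mult.assoc)

lemma y_x: "y * x = x * y" "y * xi = xi * y" "yi * x = x * yi" "yi * xi = xi * yi"
proof -
  have "y * (a * a) = a * a * y" by (simp add: conj_a conj_a_left mult.assoc)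
  then show 1: "y * x = x * y" by (simp add: x)
  have "yi * (a * a) = a * a * yi" by (simp add: conj_a conj_a_left mult.assoc)
  then show 2: "yi * x = x * yi" by (simp add: x)
  have "xi * (y * x) * xi = xi * (x * y) * xi" "xi * (yi * x) * xi = xi * (x * yi) * xi"
    by (simp_all add: 1 2)
  then show "y * xi = xi * y" "yi * xi = xi * yi"
    by (simp_all add: mult.assoc xyz_inverses xyz_inverses_left)
qed

lemma y_x_left: "y * (x * u) = x * (y * u)" "y * (xi * u) = xi * (y * u)"
    "yi * (x * u) = x * (yi * u)" "yi * (xi * u) = xi * (yi * u)"
  by (simp_all add: y_x flip: mult.assoc)

lemmas collect = mult.assoc squares conj_a conj_a_left conj_b conj_b_left y_x y_x_left
  xyz_inverses(1-4) xyz_inverses_left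

lemma z_xy: "z * x = x * z" "z * xi = xi * z" "z * y = y * z" "z * yi = yi * z"
  by (simp_all add: z collect)

text \<open>These say that a and b invert z, in a form free of \<open>zi\<close> that the rules
  \<open>collect\<close> can decide.\<close>

lemma z_a_z: "z * (a * z) = a" and z_b_z: "z * (b * z) = b"
  by (simp_all add: z collect)

lemma conj_z: "a * z = zi * a" "a * zi = z * a" "b * z = zi * b" "b * zi = z * b"
proof -
  have zl: "zi * (z * u) = u" "z * (zi * u) = u" for u
    by (simp_all add: xyz_inverses flip: mult.assoc)
  show az: "a * z = zi * a" using arg_cong[OF z_a_z, of "(*) zi"] by (simp add: zl)
  show bz: "b * z = zi * b" using arg_cong[OF z_b_z, of "(*) zi"] by (simp add: zl)
  have "z * (a * z) * zi = a * zi" "z * (b * z) * zi = b * zi" by (simp_all add: z_a_z z_b_z)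
  then show "a * zi = z * a" "b * zi = z * b" by (simp_all add: mult.assoc xyz_inverses)
qed

lemma zi_xy: "zi * x = x * zi" "zi * xi = xi * zi" "zi * y = y * zi" "zi * yi = yi * zi"
proof -
  have *: "u * zi = zi * u" if "z * u = u * z" for u
  proof -
    have "u * zi = zi * (z * u) * zi" by (simp add: xyz_inverses flip: mult.assoc)
    also have "\<dots> = zi * u" unfolding that by (simp add: mult.assoc xyz_inverses)
    finally show ?thesis .
  qed
  show "zi * x = x * zi" "zi * xi = xi * zi" "zi * y = y * zi" "zi * yi = yi * zi"
    by (rule *[symmetric], rule z_xy)+
qed

text \<open>Since zi (a b) = bi ai, y bi = b and xi b = b x, the right-hand side collapses to b x ai
  = b a.\<close>

lemma b_a: "b * a = xi * y * zi * (a * b)"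
  by (simp add: zi mult.assoc inverses inverses_left) (simp add: y xi mult.assoc inverses inverses_left, simp add: x [symmetric] mult.assoc [symmetric] xi [symmetric] conj_b[symmetric], simp add: x mult.assoc inverses)

definition lattice :: "int \<Rightarrow> int \<Rightarrow> int \<Rightarrow> 'a"
  where "lattice i j k = upow x xi i * upow y yi j * upow z zi k"

lemma upow_shifts:
  "upow x xi i * x = upow x xi (i + 1)" "upow x xi i * xi = upow x xi (i - 1)"
  "upow y yi i * y = upow y yi (i + 1)" "upow y yi i * yi = upow y yi (i - 1)"
  "upow z zi i * z = upow z zi (i + 1)" "upow z zi i * zi = upow z zi (i - 1)"
  using upow_add[of x xi i 1] upow_add[of x xi i "- 1"] upow_add[of y yi i 1]
    upow_add[of y yi i "- 1"] upow_add[of z zi i 1] upow_add[of z zi i "- 1"]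
  by (simp_all add: xyz_inverses)

lemma lattice_mult:
  "lattice i j k * x = lattice (i + 1) j k" "lattice i j k * xi = lattice (i - 1) j k"
  "lattice i j k * y = lattice i (j + 1) k" "lattice i j k * yi = lattice i (j - 1) k"
  "lattice i j k * z = lattice i j (k + 1)" "lattice i j k * zi = lattice i j (k - 1)"
proof -
  have c: "upow y yi j * x = x * upow y yi j" "upow y yi j * xi = xi * upow y yi j"
    "upow z zi k * x = x * upow z zi k" "upow z zi k * xi = xi * upow z zi k"
    "upow z zi k * y = y * upow z zi k" "upow z zi k * yi = yi * upow z zi k"
    by (simp_all add: upow_commute y_x z_xy zi_xy)
  show "lattice i j k * x = lattice (i + 1) j k" "lattice i j k * xi = lattice (i - 1) j k"
    unfolding lattice_def upow_shifts[symmetric] by (rule monoid_push_right; rule c)+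
  show "lattice i j k * y = lattice i (j + 1) k" "lattice i j k * yi = lattice i (j - 1) k"
    unfolding lattice_def upow_shifts[symmetric] by (simp_all only: mult.assoc c)
  show "lattice i j k * z = lattice i j (k + 1)" "lattice i j k * zi = lattice i j (k - 1)"
    unfolding lattice_def upow_shifts[symmetric] by (simp_all only: mult.assoc)
qed

lemma a_lattice: "a * (lattice i j k * u) = lattice i (- j) (- k) * (a * u)"
proof -
  have "a * upow x xi i = upow x xi i * a" "a * upow y yi j = upow y yi (- j) * a"
    "a * upow z zi k = upow z zi (- k) * a"
    by (simp_all add: upow_commute upow_invert conj_a conj_z)
  then show ?thesis unfolding lattice_def by (rule monoid_push_left)
qed

lemma b_lattice: "b * (lattice i j k * u) = lattice (- i) j (- k) * (b * u)"
proof -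
  have "b * upow x xi i = upow x xi (- i) * b" "b * upow y yi j = upow y yi j * b"
    "b * upow z zi k = upow z zi (- k) * b"
    by (simp_all add: upow_commute upow_invert conj_b conj_z)
  then show ?thesis unfolding lattice_def by (rule monoid_push_left)
qed

definition normal_forms :: "'a set"
  where "normal_forms = {lattice i j k * e | i j k e. e \<in> {1, a, b, a * b}}"

lemma lattice_mult_left:
  "lattice i j k * (x * u) = lattice (i + 1) j k * u" "lattice i j k * (xi * u) = lattice (i - 1) j k * u"
  "lattice i j k * (y * u) = lattice i (j + 1) k * u" "lattice i j k * (yi * u) = lattice i (j - 1) k * u"
  "lattice i j k * (z * u) = lattice i j (k + 1) * u" "lattice i j k * (zi * u) = lattice i j (k - 1) * u"
  by (simp_all add: lattice_mult flip: mult.assoc)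

lemma normal_formsI: "e \<in> {1, a, b, a * b} \<Longrightarrow> lattice i j k * e \<in> normal_forms"
  by (auto simp: normal_forms_def)

lemma normal_forms_closed:
  assumes "g \<in> normal_forms"
  shows "a * g \<in> normal_forms" "b * g \<in> normal_forms" "ai * g \<in> normal_forms" "bi * g \<in> normal_forms"
proof -
  have I: "lattice i j k \<in> normal_forms" "lattice i j k * a \<in> normal_forms"
    "lattice i j k * b \<in> normal_forms" "lattice i j k * (a * b) \<in> normal_forms" for i j k
    using normal_formsI[of 1] normal_formsI by auto
  have bab: "b * (a * b) = xi * (y * (zi * (yi * a)))"
  proof -
    have "b * (a * b) = b * a * b" by (simp add: mult.assoc)
    also have "\<dots> = xi * (y * (zi * (a * y)))" unfolding b_a by (simp add: mult.assoc squares)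
    finally show ?thesis by (simp add: conj_a)
  qed
  have ab: "a * h \<in> normal_forms \<and> b * h \<in> normal_forms" if "h \<in> normal_forms" for h
  proof -
    from that obtain i j k e where h: "h = lattice i j k * e" "e = 1 \<or> e = a \<or> e = b \<or> e = a * b"
      by (auto simp: normal_forms_def)
    from h(2) show ?thesis
      by (elim disjE) (simp_all add: h(1) a_lattice b_lattice squares bab b_a mult.assoc
          lattice_mult lattice_mult_left I a_lattice[where u = 1, simplified] b_lattice[where u = 1, simplified])
  qed
  have xy: "xi * h \<in> normal_forms \<and> yi * h \<in> normal_forms" if "h \<in> normal_forms" for h
  proof -
    from that obtain i j k e where h: "h = lattice i j k * e" "e \<in> {1, a, b, a * b}"
      by (auto simp: normal_forms_def)
    have "xi * (lattice i j k * e) = lattice i j k * (xi * e)" "yi * (lattice i j k * e) = lattice i j k * (yi * e)"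
      unfolding lattice_def
      by (rule monoid_push_left; simp add: upow_commute xyz_inverses y_x z_xy zi_xy)+
    then have "xi * h = lattice (i - 1) j k * e" "yi * h = lattice i (j - 1) k * e"
      unfolding h(1) by (simp_all add: lattice_mult_left)
    then show ?thesis using h(2) normal_formsI by auto
  qed
  have "ai * g = xi * (a * g)" "bi * g = yi * (b * g)"
    by (simp_all add: xi yi mult.assoc inverses_left)
  then show "a * g \<in> normal_forms" "b * g \<in> normal_forms" "ai * g \<in> normal_forms" "bi * g \<in> normal_forms"
    using ab xy assms by simp_all
qed

end

section \<open>Evaluation of words\<close>

definition letter_eval :: "('h, 'm) monoid_scheme \<Rightarrow> ('x \<Rightarrow> 'h) \<Rightarrow> 'x \<times> bool \<Rightarrow> 'h"
  where "letter_eval H f l = (if snd l then f (fst l) else inv\<^bsub>H\<^esub> f (fst l))"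

definition word_eval :: "('h, 'm) monoid_scheme \<Rightarrow> ('x \<Rightarrow> 'h) \<Rightarrow> ('x \<times> bool) list \<Rightarrow> 'h"
  where "word_eval H f w = foldr (\<lambda>l h. letter_eval H f l \<otimes>\<^bsub>H\<^esub> h) w \<one>\<^bsub>H\<^esub>"

lemma word_eval_simps [simp]:
  "word_eval H f [] = \<one>\<^bsub>H\<^esub>" "word_eval H f (l # w) = letter_eval H f l \<otimes>\<^bsub>H\<^esub> word_eval H f w"
  by (simp_all add: word_eval_def)

context group
begin

lemma letter_eval_closed: "f \<in> S \<rightarrow> carrier G \<Longrightarrow> fst l \<in> S \<Longrightarrow> letter_eval G f l \<in> carrier G"
  by (auto simp: letter_eval_def)

lemma word_eval_closed: "f \<in> S \<rightarrow> carrier G \<Longrightarrow> fst ` set w \<subseteq> S \<Longrightarrow> word_eval G f w \<in> carrier G"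
  by (induction w) (auto simp: letter_eval_closed)

lemma letter_eval_inv:
  "f \<in> S \<rightarrow> carrier G \<Longrightarrow> fst l \<in> S \<Longrightarrow> letter_eval G f (inv_letter l) = inv letter_eval G f l"
  using funcset_mem[of f S "carrier G" "fst l"] by (auto simp: letter_eval_def inv_letter_def)

lemma word_eval_push:
  assumes "f \<in> S \<rightarrow> carrier G" "fst l \<in> S" "fst ` set w \<subseteq> S"
  shows "word_eval G f (push_letter l w) = letter_eval G f l \<otimes> word_eval G f w"
proof (cases w)
  case (Cons m v)
  have [simp]: "letter_eval G f l \<in> carrier G" "word_eval G f v \<in> carrier G"
    using assms letter_eval_closed[OF assms(1)] word_eval_closed[OF assms(1), of v] by (auto simp: Cons)
  have "letter_eval G f l \<otimes> (inv letter_eval G f l \<otimes> word_eval G f v) = word_eval G f v"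
    by (simp flip: m_assoc)
  then show ?thesis using assms letter_eval_inv[OF assms(1,2)] by (auto simp: Cons)
qed simp

lemma word_eval_mult:
  assumes "f \<in> S \<rightarrow> carrier G" "fst ` set v \<subseteq> S" "fst ` set w \<subseteq> S"
  shows "word_eval G f (foldr push_letter v w) = word_eval G f v \<otimes> word_eval G f w"
  using assms(2)
proof (induction v)
  case Nil
  then show ?case using word_eval_closed[OF assms(1,3)] by simp
next
  case (Cons l v)
  have "fst ` set (foldr push_letter v w) \<subseteq> S"
    by (rule order_trans[OF fst_foldr_push[of v w]]) (use Cons.prems assms(3) in auto)
  then have "word_eval G f (foldr push_letter (l # v) w)
      = letter_eval G f l \<otimes> (word_eval G f v \<otimes> word_eval G f w)"
    using Cons word_eval_push[OF assms(1)] by simp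
  also have "\<dots> = letter_eval G f l \<otimes> word_eval G f v \<otimes> word_eval G f w"
    using Cons.prems letter_eval_closed[OF assms(1), of l] word_eval_closed[OF assms(1), of v]
      word_eval_closed[OF assms(1,3)] by (simp add: m_assoc)
  finally show ?case by simp
qed

lemma group_hom_word_eval:
  assumes "f \<in> S \<rightarrow> carrier G"
  shows "group_hom (free_group S) G (word_eval G f)"
proof -
  have "word_eval G f \<in> hom (free_group S) G"
    unfolding hom_def using word_eval_closed[OF assms] word_eval_mult[OF assms]
    by (auto simp: free_group_def)
  then show ?thesis
    using group_free_group[of S] by (simp add: group_hom_def group_hom_axioms_def is_group)
qed

section \<open>Criteria for free subgroups and against finite generation\<close>

lemma free_subgroupI:
  assumes S: "S \<subseteq> carrier G"
    and ne: "\<And>w. reduced w \<Longrightarrow> w \<noteq> [] \<Longrightarrow> fst ` set w \<subseteq> S \<Longrightarrow> word_eval G id w \<noteq> \<one>"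
  defines "H \<equiv> word_eval G id ` carrier (free_group S)"
  shows "subgroup H G" "is_free_group (G\<lparr>carrier := H\<rparr>)"
proof -
  interpret W: group_hom "free_group S" G "word_eval G id"
    by (rule group_hom_word_eval) (use S in auto)
  show "subgroup H G" unfolding H_def by (rule W.img_is_subgroup)
  have "inj_on (word_eval G id) (carrier (free_group S))"
    unfolding W.inj_on_one_iff using ne by (auto simp: free_group_def)
  then have "word_eval G id \<in> iso (free_group S) (G\<lparr>carrier := H\<rparr>)"
    using W.homh by (auto simp: iso_def bij_betw_def hom_def H_def)
  then have "free_group S \<cong> G\<lparr>carrier := H\<rparr>" by (rule is_isoI)
  then have "G\<lparr>carrier := H\<rparr> \<cong> free_group S" by (rule group.iso_sym[OF group_free_group])
  then show "is_free_group (G\<lparr>carrier := H\<rparr>)" by (auto simp: is_free_group_def)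
qed

lemma not_comm_free_subgroup:
  assumes S: "S \<subseteq> carrier G" "g \<in> S" "h \<in> S" "g \<noteq> h"
    and ne: "\<And>w. reduced w \<Longrightarrow> w \<noteq> [] \<Longrightarrow> fst ` set w \<subseteq> S \<Longrightarrow> word_eval G id w \<noteq> \<one>"
  shows "\<not> comm_group (G\<lparr>carrier := word_eval G id ` carrier (free_group S)\<rparr>)"
proof
  assume "comm_group (G\<lparr>carrier := word_eval G id ` carrier (free_group S)\<rparr>)"
  then interpret H: comm_group "G\<lparr>carrier := word_eval G id ` carrier (free_group S)\<rparr>" .
  have gh: "g \<in> carrier G" "h \<in> carrier G" using S by auto
  have mem: "u \<in> word_eval G id ` carrier (free_group S)" if "u \<in> S" for u
    using that S(1) by (intro image_eqI[of _ _ "[(u, True)]"]) (auto simp: free_group_def letter_eval_def)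
  have "g \<otimes> h = h \<otimes> g" using H.m_comm mem S(2,3) by simp
  then have "g \<otimes> (h \<otimes> (inv g \<otimes> inv h)) = \<one>"
    using gh by (simp add: m_assoc[symmetric]) (simp add: m_assoc)
  then have "word_eval G id [(g, True), (h, True), (g, False), (h, False)] = \<one>"
    using gh by (simp add: letter_eval_def)
  moreover have "reduced [(g, True), (h, True), (g, False), (h, False)]"
    using S(4) by (auto simp: inv_letter_def)
  ultimately show False using ne S(2,3) by fastforce
qed

text \<open>In characteristic 2 every value of \<open>\<phi>\<close> is a subset sum of the values
  on the generators: inverses give nothing new, and repeated values cancel.\<close>

lemma not_finitely_generatedI:
  fixes \<phi> :: "'a \<Rightarrow> 'r::ring_char_2"
  assumes hom: "\<And>g h. g \<in> carrier G \<Longrightarrow> h \<in> carrier G \<Longrightarrow> \<phi> (g \<otimes> h) = \<phi> g + \<phi> h"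
    and inf: "infinite (\<phi> ` carrier G)"
  shows "\<not> finitely_generated G"
proof
  assume "finitely_generated G"
  then obtain S where S: "finite S" "S \<subseteq> carrier G" "generate G S = carrier G"
    by (auto simp: finitely_generated_def)
  have one: "\<phi> \<one> = 0" using hom[of \<one> \<one>] by simp
  have "\<phi> g \<in> sum id ` Pow (\<phi> ` S)" if "g \<in> generate G S" for g
    using that
  proof (induction rule: generate.induct)
    case one
    then show ?case using \<open>\<phi> \<one> = 0\<close> by (intro image_eqI[of _ _ "{}"]) auto
  next
    case (incl h)
    then show ?case by (intro image_eqI[of _ _ "{\<phi> h}"]) auto
  next
    case (inv h)
    then have "h \<in> carrier G" using S(2) by auto
    then have "\<phi> h + \<phi> (inv h) = 0" using hom[of h "inv h"] one by simp
    then have "\<phi> (inv h) = \<phi> h" by (simp add: add_eq_0_char_2)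
    with inv show ?case by (intro image_eqI[of _ _ "{\<phi> h}"]) auto
  next
    case (eng h1 h2)
    then obtain A B where AB: "A \<subseteq> \<phi> ` S" "B \<subseteq> \<phi> ` S" "\<phi> h1 = sum id A" "\<phi> h2 = sum id B" by blast
    have fin: "finite A" "finite B" using AB S(1) finite_subset by blast+
    have "\<phi> (h1 \<otimes> h2) = sum id ((A - B) \<union> (B - A))"
      using eng.hyps S(3) by (simp add: hom AB sum_insert_sym_diff[OF fin])
    with AB show ?case by blast
  qed
  then have "\<phi> ` carrier G \<subseteq> sum id ` Pow (\<phi> ` S)" using S(3) by auto
  then have "finite (\<phi> ` carrier G)" by (rule finite_subset) (use S(1) in simp)
  with inf show False by contradiction
qed

end

section \<open>The universal property of a presentation\<close>

lemma presented_group_hom: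
  fixes S :: "'x set" and R f
  assumes "group H" and f: "f \<in> S \<rightarrow> carrier H"
    and R: "R \<subseteq> carrier (free_group S) \<times> carrier (free_group S)"
    and rel: "\<And>u v. (u, v) \<in> R \<Longrightarrow> word_eval H f u = word_eval H f v"
  defines "N \<equiv> normal_closure (free_group S)
      {u \<otimes>\<^bsub>free_group S\<^esub> inv\<^bsub>free_group S\<^esub> v | u v. (u, v) \<in> R}"
  shows "\<exists>\<phi>\<in>hom (presented_group S R) H. \<forall>w\<in>carrier (free_group S).
    \<phi> (N #>\<^bsub>free_group S\<^esub> w) = word_eval H f w"
proof -
  interpret H: group H by fact
  interpret W: group_hom "free_group S" H "word_eval H f"
    by (rule H.group_hom_word_eval[OF f])
  let ?F = "free_group S"
  let ?K = "kernel ?F H (word_eval H f)"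
  have rels: "{u \<otimes>\<^bsub>?F\<^esub> inv\<^bsub>?F\<^esub> v | u v. (u, v) \<in> R} \<subseteq> ?K"
    using R rel by (fastforce simp: kernel_def)
  have NK: "N \<subseteq> ?K"
    unfolding N_def normal_closure_def using W.normal_kernel rels by auto
  have "N \<lhd> ?F" unfolding N_def
    by (rule group.normal_closure_normal) (use rels in \<open>auto simp: kernel_def group_free_group\<close>)
  then interpret N: normal N ?F .
  define \<phi> where "\<phi> C = the_elem (word_eval H f ` C)" for C
  have \<phi>: "\<phi> (N #>\<^bsub>?F\<^esub> w) = word_eval H f w" if w: "w \<in> carrier ?F" for w
  proof -
    have "word_eval H f (n \<otimes>\<^bsub>?F\<^esub> w) = word_eval H f w" if "n \<in> N" for n
    proof -
      have "n \<in> carrier ?F" "word_eval H f n = \<one>\<^bsub>H\<^esub>" using NK that by (auto simp: kernel_def)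
      then show ?thesis using w by simp
    qed
    moreover have "w \<in> N #>\<^bsub>?F\<^esub> w" by (rule group.rcos_self[OF group_free_group w N.subgroup_axioms])
    ultimately have "word_eval H f ` (N #>\<^bsub>?F\<^esub> w) = {word_eval H f w}"
      unfolding r_coset_def by auto
    then show ?thesis by (simp add: \<phi>_def)
  qed
  have "\<phi> \<in> hom (presented_group S R) H"
  proof (rule homI)
    fix C assume "C \<in> carrier (presented_group S R)"
    then obtain w where "w \<in> carrier ?F" "C = N #>\<^bsub>?F\<^esub> w"
      by (auto simp: presented_group_def FactGroup_def RCOSETS_def N_def)
    then show "\<phi> C \<in> carrier H" by (simp add: \<phi>)
  next
    fix C D assume "C \<in> carrier (presented_group S R)" "D \<in> carrier (presented_group S R)"
    then obtain v w where vw: "v \<in> carrier ?F" "C = N #>\<^bsub>?F\<^esub> v" "w \<in> carrier ?F" "D = N #>\<^bsub>?F\<^esub> w"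
      by (auto simp: presented_group_def FactGroup_def RCOSETS_def N_def)
    have "C \<otimes>\<^bsub>presented_group S R\<^esub> D = N #>\<^bsub>?F\<^esub> (v \<otimes>\<^bsub>?F\<^esub> w)"
      using N.rcos_sum vw by (simp add: presented_group_def FactGroup_def)
    then show "\<phi> (C \<otimes>\<^bsub>presented_group S R\<^esub> D) = \<phi> C \<otimes>\<^bsub>H\<^esub> \<phi> D"
      using vw by (simp add: \<phi>)
  qed
  with \<phi> show ?thesis by blast
qed

section \<open>The group P and its normal forms\<close>

abbreviation "la \<equiv> (gen_a, True)"
abbreviation "lai \<equiv> (gen_a, False)"
abbreviation "lb \<equiv> (gen_b, True)"
abbreviation "lbi \<equiv> (gen_b, False)"
abbreviation "FG \<equiv> free_group (UNIV :: gen_ab set)"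

definition promislow_rels :: "((gen_ab \<times> bool) list \<times> (gen_ab \<times> bool) list) set"
  where "promislow_rels = {([lbi, la, la, lb], [lai, lai]), ([lai, lb, lb, la], [lbi, lbi])}"

definition promislow_kernel :: "(gen_ab \<times> bool) list set"
  where "promislow_kernel = normal_closure FG {u \<otimes>\<^bsub>FG\<^esub> inv\<^bsub>FG\<^esub> v | u v. (u, v) \<in> promislow_rels}"

lemma promislow_group_eq: "promislow_group = presented_group UNIV promislow_rels"
proof -
  interpret F: group FG by (rule group_free_group)
  have inv: "inv\<^bsub>FG\<^esub> [la] = [lai]" "inv\<^bsub>FG\<^esub> [lb] = [lbi]"
    by (rule F.inv_equality; simp add: free_group_def inv_letter_def)+
  have mem: "[la] \<in> carrier FG" "[lb] \<in> carrier FG" by (simp_all add: free_group_def)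
  have pow2: "x [^]\<^bsub>FG\<^esub> (2::int) = x \<otimes>\<^bsub>FG\<^esub> x" "x [^]\<^bsub>FG\<^esub> (- 2::int) = inv\<^bsub>FG\<^esub> x \<otimes>\<^bsub>FG\<^esub> inv\<^bsub>FG\<^esub> x"
    if "x \<in> carrier FG" for x
  proof -
    have "x [^]\<^bsub>FG\<^esub> (1 + 1 :: int) = x \<otimes>\<^bsub>FG\<^esub> x"
      using that by (subst F.int_pow_mult) simp_all
    then show 2: "x [^]\<^bsub>FG\<^esub> (2::int) = x \<otimes>\<^bsub>FG\<^esub> x" by simp
    show "x [^]\<^bsub>FG\<^esub> (- 2::int) = inv\<^bsub>FG\<^esub> x \<otimes>\<^bsub>FG\<^esub> inv\<^bsub>FG\<^esub> x"
      using F.int_pow_neg[OF that, of 2] that by (simp only: 2 F.inv_mult_group)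
  qed
  show ?thesis
    unfolding promislow_group_def promislow_rels_def Let_def pow2[OF mem(1)] pow2[OF mem(2)] inv
    by (simp add: free_group_def inv_letter_def)
qed

lemma promislow_rels_carrier: "promislow_rels \<subseteq> carrier FG \<times> carrier FG"
  by (auto simp: promislow_rels_def free_group_def inv_letter_def)

lemma promislow_kernel_normal: "promislow_kernel \<lhd> FG"
  unfolding promislow_kernel_def
proof (rule group.normal_closure_normal[OF group_free_group])
  interpret F: group FG by (rule group_free_group)
  show "{u \<otimes>\<^bsub>FG\<^esub> inv\<^bsub>FG\<^esub> v |u v. (u, v) \<in> promislow_rels} \<subseteq> carrier FG"
    using promislow_rels_carrier by auto
qed

lemma promislow_group_Mod: "promislow_group = FG Mod promislow_kernel"
  by (simp add: promislow_group_eq presented_group_def promislow_kernel_def)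

text \<open>A type copy of \<open>P\<close>, to which results on the class \<open>monoid_mult\<close> apply.\<close>

typedef pgroup = "carrier promislow_group"
  using monoid.one_closed[OF group.is_monoid[OF group_promislow_group]] by blast

instantiation pgroup :: monoid_mult
begin

definition "1 = Abs_pgroup \<one>\<^bsub>promislow_group\<^esub>"
definition "g * h = Abs_pgroup (Rep_pgroup g \<otimes>\<^bsub>promislow_group\<^esub> Rep_pgroup h)"

instance
proof
  interpret P: group promislow_group by (rule group_promislow_group)
  fix g h k :: pgroup
  show "g * h * k = g * (h * k)" "1 * g = g" "g * 1 = g"
    using Rep_pgroup[of g] Rep_pgroup[of h] Rep_pgroup[of k]
    by (simp_all add: times_pgroup_def one_pgroup_def Abs_pgroup_inverse P.m_assoc Rep_pgroup_inverse)
qed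

end

definition word_class :: "(gen_ab \<times> bool) list \<Rightarrow> pgroup"
  where "word_class w = Abs_pgroup (promislow_kernel #>\<^bsub>FG\<^esub> w)"

lemma Rep_word_class: "w \<in> carrier FG \<Longrightarrow> Rep_pgroup (word_class w) = promislow_kernel #>\<^bsub>FG\<^esub> w"
  unfolding word_class_def by (rule Abs_pgroup_inverse) (simp add: promislow_group_Mod carrier_FactGroup)

lemma word_class_mult:
  assumes "v \<in> carrier FG" "w \<in> carrier FG"
  shows "word_class (v \<otimes>\<^bsub>FG\<^esub> w) = word_class v * word_class w"
  using assms by (simp add: times_pgroup_def Rep_word_class)
    (simp add: word_class_def promislow_group_Mod normal.rcos_sum[OF promislow_kernel_normal])

lemma word_class_Cons: "reduced (l # w) \<Longrightarrow> word_class (l # w) = word_class [l] * word_class w"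
  using word_class_mult[of "[l]" w] reduced_ConsD[of l w] push_reduced_Cons[of l w] by (simp add: free_group_def)

lemma word_class_Cons_Cons:
  "reduced (l # m # w) \<Longrightarrow> word_class (l # m # w) = word_class [l] * word_class (m # w)"
  by (rule word_class_Cons)

lemma word_class_Nil: "word_class [] = 1"
proof -
  have "\<one>\<^bsub>promislow_group\<^esub> = promislow_kernel" by (simp add: promislow_group_Mod)
  moreover have "promislow_kernel #>\<^bsub>FG\<^esub> \<one>\<^bsub>FG\<^esub> = promislow_kernel"
    by (rule group.coset_mult_one[OF group_free_group])
      (use promislow_kernel_normal in \<open>simp add: normal.axioms(1) normal_imp_subgroup subgroup.subset\<close>)
  ultimately show ?thesis by (simp add: word_class_def one_pgroup_def free_group_def)
qed

lemma word_class_surj: "\<exists>w. reduced w \<and> g = word_class w"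
proof -
  have "Rep_pgroup g \<in> (\<lambda>w. promislow_kernel #>\<^bsub>FG\<^esub> w) ` carrier FG"
    using Rep_pgroup[of g] by (simp add: promislow_group_Mod carrier_FactGroup)
  then obtain w where w: "w \<in> carrier FG" "Rep_pgroup g = promislow_kernel #>\<^bsub>FG\<^esub> w" by blast
  from w(1) have "reduced w" by (simp add: free_group_def)
  moreover have "g = word_class w" by (metis w(2) Rep_pgroup_inverse word_class_def)
  ultimately show ?thesis by blast
qed

lemma word_class_rel:
  assumes "(u, v) \<in> promislow_rels"
  shows "word_class u = word_class v"
proof -
  interpret F: group FG by (rule group_free_group)
  have uv: "u \<in> carrier FG" "v \<in> carrier FG" using assms promislow_rels_carrier by auto
  have "u \<otimes>\<^bsub>FG\<^esub> inv\<^bsub>FG\<^esub> v \<in> promislow_kernel"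
    unfolding promislow_kernel_def normal_closure_def using assms by blast
  moreover have "u = u \<otimes>\<^bsub>FG\<^esub> inv\<^bsub>FG\<^esub> v \<otimes>\<^bsub>FG\<^esub> v" using uv by (simp add: F.m_assoc)
  ultimately have "u \<in> promislow_kernel #>\<^bsub>FG\<^esub> v" unfolding r_coset_def by blast
  then show ?thesis unfolding word_class_def
    using F.repr_independence uv normal_imp_subgroup[OF promislow_kernel_normal] by metis
qed

abbreviation "pa \<equiv> word_class [la]"
abbreviation "pai \<equiv> word_class [lai]"
abbreviation "pb \<equiv> word_class [lb]"
abbreviation "pbi \<equiv> word_class [lbi]"

interpretation P: promislow_relations pa pai pb pbi "pa * pa" "pai * pai" "pb * pb" "pbi * pbi"
  "pa * pb * pa * pb" "pbi * pai * pbi * pai"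
proof
  have "word_class ([l] \<otimes>\<^bsub>FG\<^esub> [inv_letter l]) = 1" for l
    by (simp add: free_group_def word_class_Nil)
  then have inv: "word_class [l] * word_class [inv_letter l] = 1" for l
    by (subst word_class_mult [symmetric]) (simp_all add: free_group_def)
  show "pa * pai = 1" "pai * pa = 1" "pb * pbi = 1" "pbi * pb = 1"
    using inv[of la] inv[of lai] inv[of lb] inv[of lbi] by (simp_all add: inv_letter_def)
  have "word_class [lbi, la, la, lb] = word_class [lai, lai]"
    "word_class [lai, lb, lb, la] = word_class [lbi, lbi]"
    by (rule word_class_rel; simp add: promislow_rels_def)+
  then show "pbi * (pa * pa) * pb = pai * pai" "pai * (pb * pb) * pa = pbi * pbi"
    by (simp_all add: word_class_Cons_Cons inv_letter_def mult.assoc)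
qed simp_all

text \<open>The relations only bound P from above here; that distinct normal forms are distinct
  elements follows from their images in the crossed product.\<close>

lemma pgroup_normal_form: "g \<in> P.normal_forms"
proof -
  have "word_class w \<in> P.normal_forms" if "reduced w" for w
    using that
  proof (induction w)
    case Nil
    have "P.lattice 0 0 0 * 1 \<in> P.normal_forms" by (rule P.normal_formsI) simp
    then show ?case by (simp add: word_class_Nil P.lattice_def)
  next
    case (Cons l w)
    have "l \<in> {la, lai, lb, lbi}"
    proof (cases l)
      case (Pair x e)
      then show ?thesis by (cases x; cases e) auto
    qed
    moreover have "word_class w \<in> P.normal_forms" using Cons reduced_ConsD by blast
    ultimately show ?case
      unfolding word_class_Cons[OF Cons.prems] by (auto intro: P.normal_forms_closed)
  qed
  moreover obtain w where "reduced w" "g = word_class w" using word_class_surj[of g] by (elim exE conjE)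
  ultimately show ?thesis by (simp only:)
qed

section \<open>The embedding into the crossed product\<close>

abbreviation "cgen_a \<equiv> Crossed 0 1 0 0"
abbreviation "cgen_b \<equiv> Crossed 0 0 1 0"

definition crossed_units :: "crossed monoid"
  where "crossed_units = units_of \<lparr>carrier = UNIV, monoid.mult = (*), one = 1\<rparr>"

lemma group_crossed_units: "group crossed_units"
  unfolding crossed_units_def
  by (rule monoid.units_group) (unfold_locales, auto simp: mult.assoc)

lemma crossed_units_simps:
  "carrier crossed_units = {u. \<exists>v. v * u = 1 \<and> u * v = 1}"
  "u \<otimes>\<^bsub>crossed_units\<^esub> v = u * v" "\<one>\<^bsub>crossed_units\<^esub> = 1"
  by (simp_all add: crossed_units_def units_of_def Units_def)

definition gen_image :: "gen_ab \<Rightarrow> crossed"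
  where "gen_image g = (case g of gen_a \<Rightarrow> cgen_a | gen_b \<Rightarrow> cgen_b)"

definition gen_image_inv :: "gen_ab \<Rightarrow> crossed"
  where "gen_image_inv g = (case g of gen_a \<Rightarrow> Crossed 0 (lmono (- 1) 0 0) 0 0 | gen_b \<Rightarrow> Crossed 0 0 (lmono 0 (- 1) 0) 0)"

lemma gen_image_inverse: "gen_image_inv g * gen_image g = 1" "gen_image g * gen_image_inv g = 1"
  by (cases g; simp add: gen_image_def gen_image_inv_def crossed_eq_iff crossed_mult_sel shift_def mult_single)+

lemma gen_image_carrier: "gen_image g \<in> carrier crossed_units" "gen_image_inv g \<in> carrier crossed_units"
  using gen_image_inverse by (auto simp: crossed_units_simps)

lemma letter_eval_crossed: "letter_eval crossed_units gen_image (g, e) = (if e then gen_image g else gen_image_inv g)"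
proof -
  have "inv\<^bsub>crossed_units\<^esub> gen_image g = gen_image_inv g"
    by (rule group.inv_equality[OF group_crossed_units])
      (simp_all add: crossed_units_simps(2,3) gen_image_inverse gen_image_carrier)
  then show ?thesis by (simp add: letter_eval_def)
qed

lemma promislow_hom_exists:
  "\<exists>\<phi>\<in>hom promislow_group crossed_units. \<forall>w\<in>carrier FG.
    \<phi> (promislow_kernel #>\<^bsub>FG\<^esub> w) = word_eval crossed_units gen_image w"
  unfolding promislow_group_eq promislow_kernel_def
proof (rule presented_group_hom[OF group_crossed_units _ promislow_rels_carrier])
  show "gen_image \<in> UNIV \<rightarrow> carrier crossed_units" using gen_image_carrier by auto
  fix u v assume "(u, v) \<in> promislow_rels"
  then show "word_eval crossed_units gen_image u = word_eval crossed_units gen_image v"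
    unfolding promislow_rels_def
    by (auto simp: crossed_units_simps(2,3) letter_eval_crossed gen_image_def gen_image_inv_def
        crossed_eq_iff crossed_mult_sel shift_def mult_single)
qed

definition promislow_hom :: "(gen_ab \<times> bool) list set \<Rightarrow> crossed"
  where "promislow_hom = (SOME \<phi>. \<phi> \<in> hom promislow_group crossed_units \<and> (\<forall>w\<in>carrier FG.
    \<phi> (promislow_kernel #>\<^bsub>FG\<^esub> w) = word_eval crossed_units gen_image w))"

lemma promislow_hom:
  "promislow_hom \<in> hom promislow_group crossed_units"
  "w \<in> carrier FG \<Longrightarrow> promislow_hom (promislow_kernel #>\<^bsub>FG\<^esub> w) = word_eval crossed_units gen_image w"
  using someI_ex[OF promislow_hom_exists[unfolded Bex_def]] unfolding promislow_hom_def[symmetric] by blast+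

definition prep :: "pgroup \<Rightarrow> crossed" where "prep g = promislow_hom (Rep_pgroup g)"

lemma prep_word_class: "w \<in> carrier FG \<Longrightarrow> prep (word_class w) = word_eval crossed_units gen_image w"
  by (simp add: prep_def Rep_word_class promislow_hom(2))

lemma prep_1: "prep 1 = 1"
  using prep_word_class[of "[]"] by (simp add: word_class_Nil free_group_def crossed_units_simps(3))

lemma prep_mult: "prep (g * h) = prep g * prep h"
proof -
  interpret P: group promislow_group by (rule group_promislow_group)
  show ?thesis
    using hom_mult[OF promislow_hom(1) Rep_pgroup Rep_pgroup, of g h]
    by (simp add: prep_def times_pgroup_def Abs_pgroup_inverse Rep_pgroup crossed_units_simps(2))
qed

lemma prep_gens: "prep pa = cgen_a" "prep pb = cgen_b" "prep pai = gen_image_inv gen_a" "prep pbi = gen_image_inv gen_b"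
  by (simp_all add: prep_word_class free_group_def letter_eval_crossed crossed_units_simps(2,3) gen_image_def)

lemma upow_hom:
  assumes "f 1 = 1" "\<And>g h. f (g * h) = f g * f h"
  shows "f (upow u v i) = upow (f u) (f v) i"
proof -
  have "f (u ^ n) = f u ^ n" for u n by (induction n) (simp_all add: assms)
  then show ?thesis by (simp add: upow_def)
qed

lemma scal_mult_scal: "scal r * scal s = scal (r * s)"
  by (simp add: crossed_eq_iff)

lemma upow_scal_mono: "upow (scal (lmono i j k)) (scal (lmono (- i) (- j) (- k))) n = scal (lmono (n * i) (n * j) (n * k))"
proof -
  have "scal r ^ m = scal (r ^ m)" for r m
    by (induction m) (simp_all add: scal_mult_scal, simp add: one_crossed_def)
  then show ?thesis by (auto simp: upow_def mono_power)
qed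

lemma prep_lattice: "prep (P.lattice i j k) = scal (lmono i j k)"
proof -
  have "prep (pa * pa) = scal (lmono 1 0 0)" "prep (pai * pai) = scal (lmono (- 1) (- 0) (- 0))"
    "prep (pb * pb) = scal (lmono 0 1 0)" "prep (pbi * pbi) = scal (lmono (- 0) (- 1) (- 0))"
    "prep (pa * pb * pa * pb) = scal (lmono 0 0 1)" "prep (pbi * pai * pbi * pai) = scal (lmono (- 0) (- 0) (- 1))"
    by (simp_all add: prep_mult prep_gens gen_image_inv_def crossed_eq_iff crossed_mult_sel shift_def mult_single)
  note gens = this
  note hom = upow_hom[of prep, OF prep_1 prep_mult]
  have "prep (upow (pa * pa) (pai * pai) i) = scal (lmono (i * 1) (i * 0) (i * 0))"
    "prep (upow (pb * pb) (pbi * pbi) j) = scal (lmono (j * 0) (j * 1) (j * 0))"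
    "prep (upow (pa * pb * pa * pb) (pbi * pai * pbi * pai) k) = scal (lmono (k * 0) (k * 0) (k * 1))"
    unfolding hom gens by (rule upow_scal_mono)+
  then show ?thesis
    unfolding P.lattice_def prep_mult[of "_ * _" "upow _ _ _"] prep_mult[of "upow _ _ _" "upow _ _ _"]
    by (simp only: scal_mult_scal mono_mult) simp
qed

text \<open>The elements of \<open>P\<close> become the monomials of the crossed product.\<close>

definition cmono :: "int \<Rightarrow> int \<Rightarrow> int \<Rightarrow> nat \<Rightarrow> crossed"
  where "cmono i j k e = scal (lmono i j k) * unit_vec e"

lemma prep_normal_form:
  "prep (P.lattice i j k * 1) = cmono i j k 0" "prep (P.lattice i j k * pa) = cmono i j k 1"
  "prep (P.lattice i j k * pb) = cmono i j k 2" "prep (P.lattice i j k * (pa * pb)) = cmono i j k 3"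
  by (simp_all add: prep_mult prep_lattice prep_1 prep_gens cmono_def unit_vec_def crossed_eq_iff crossed_mult_sel)

lemma coord_cmono: "e < 4 \<Longrightarrow> coord d (cmono i j k e) = (if d = e \<or> (d \<ge> 4 \<and> e = 3) then lmono i j k else 0)"
  by (auto simp: coord_def cmono_def unit_vec_def)

lemma normal_form_cases:
  obtains i j k e where "e < 4" "prep g = cmono i j k e" 
    "g = P.lattice i j k * (if e = 0 then 1 else if e = 1 then pa else if e = 2 then pb else pa * pb)"
proof -
  have "\<exists>i j k e. g = P.lattice i j k * e \<and> e \<in> {1, pa, pb, pa * pb}"
    using pgroup_normal_form[of g] by (simp only: P.normal_forms_def mem_Collect_eq)
  then obtain i j k e where g: "g = P.lattice i j k * e" "e \<in> {1, pa, pb, pa * pb}"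
    by (elim exE conjE)
  from g(2) show ?thesis
    using that[of 0 i j k] that[of 1 i j k] that[of 2 i j k] that[of 3 i j k] g(1)
    by (auto simp: prep_normal_form prep_normal_form(1)[simplified])
qed

lemma cmono_eq_iff:
  assumes "e < 4" "e' < 4"
  shows "cmono i j k e = cmono i' j' k' e' \<longleftrightarrow> i = i' \<and> j = j' \<and> k = k' \<and> e = e'"
proof
  assume "cmono i j k e = cmono i' j' k' e'"
  then have "coord e (cmono i j k e) = coord e (cmono i' j' k' e')" by simp
  then have "lmono i j k = (if e = e' then lmono i' j' k' else 0)"
    using assms by (simp add: coord_cmono)
  then have "Poly_Mapping.keys (lmono i j k) = Poly_Mapping.keys (if e = e' then lmono i' j' k' else 0)"
    by (rule arg_cong)
  then show "i = i' \<and> j = j' \<and> k = k' \<and> e = e'"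
    by (cases "e = e'") simp_all
qed simp

text \<open>Normal forms with different parameters have different monomials as images, so the
  presentation does not collapse.\<close>

lemma inj_prep: "inj prep"
proof (rule injI)
  fix g h assume eq: "prep g = prep h"
  obtain i j k e where g: "e < 4" "prep g = cmono i j k e" 
    "g = P.lattice i j k * (if e = 0 then 1 else if e = 1 then pa else if e = 2 then pb else pa * pb)"
    by (rule normal_form_cases)
  obtain i' j' k' e' where h: "e' < 4" "prep h = cmono i' j' k' e'" 
    "h = P.lattice i' j' k' * (if e' = 0 then 1 else if e' = 1 then pa else if e' = 2 then pb else pa * pb)"
    by (rule normal_form_cases)
  show "g = h" using eq g h cmono_eq_iff[OF g(1) h(1)] by simp
qed

section \<open>Group rings over the field with two elements\<close>

lemma F2_simps:
  "x \<in> carrier F2 \<longleftrightarrow> x = 0 \<or> x = 1" "\<zero>\<^bsub>F2\<^esub> = 0" "\<one>\<^bsub>F2\<^esub> = 1"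
  "x \<oplus>\<^bsub>F2\<^esub> y = (x + y) mod 2" "x \<otimes>\<^bsub>F2\<^esub> y = x * y mod 2"
  by (auto simp: residue_ring_def)

text \<open>The counterpart of \<open>lift\<close> for the group ring, whose coefficients are the
  integers 0 and 1.\<close>

definition extend :: "('g \<Rightarrow> 'r::comm_monoid_add) \<Rightarrow> ('g \<Rightarrow> int) \<Rightarrow> 'r"
  where "extend \<phi> f = sum \<phi> {g. f g \<noteq> 0}"

definition delta :: "'g \<Rightarrow> 'g \<Rightarrow> int"
  where "delta g x = (if x = g then 1 else 0)"

context
  fixes G :: "('g, 'm) monoid_scheme" and A
  assumes G: "group G"
  defines "A \<equiv> group_ring F2 G"
begin

interpretation G: group G by (rule G)
interpretation F2: field F2 by (rule field_F2)
interpretation A: ring A unfolding A_def by (rule ring_group_ring[OF F2.ring_axioms G])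

lemma A_carrier: "f \<in> carrier A \<longleftrightarrow> (\<forall>x. f x = 0 \<or> f x = 1) \<and> (\<forall>x. x \<notin> carrier G \<longrightarrow> f x = 0) \<and> finite {x. f x \<noteq> 0}"
  unfolding A_def group_ring_carrier_iff F2_simps ..

lemma A_simps: "(f \<oplus>\<^bsub>A\<^esub> g) x = (f x + g x) mod 2" "\<one>\<^bsub>A\<^esub> = delta \<one>\<^bsub>G\<^esub>" "\<zero>\<^bsub>A\<^esub> = (\<lambda>x. 0)"
  unfolding A_def by (auto simp: group_ring_def F2_simps delta_def fun_eq_iff)

lemma delta_closed: "g \<in> carrier G \<Longrightarrow> delta g \<in> carrier A"
  by (auto simp: A_carrier delta_def)

lemma delta_mult:
  assumes "g \<in> carrier G" "h \<in> carrier G"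
  shows "delta g \<otimes>\<^bsub>A\<^esub> delta h = delta (g \<otimes>\<^bsub>G\<^esub> h)"
proof
  fix x
  show "(delta g \<otimes>\<^bsub>A\<^esub> delta h) x = delta (g \<otimes>\<^bsub>G\<^esub> h) x"
  proof (cases "x \<in> carrier G")
    case True
    have "(delta g \<otimes>\<^bsub>A\<^esub> delta h) x = (\<Oplus>\<^bsub>F2\<^esub>u\<in>{g}. delta g u \<otimes>\<^bsub>F2\<^esub> delta h (inv\<^bsub>G\<^esub> u \<otimes>\<^bsub>G\<^esub> x))"
      unfolding A_def
      by (rule group_ring_mult_apply[OF F2.ring_axioms G])
        (use assms True delta_closed in \<open>auto simp: A_def[symmetric] delta_def F2_simps split: if_splits\<close>)
    also have "\<dots> = delta h (inv\<^bsub>G\<^esub> g \<otimes>\<^bsub>G\<^esub> x)"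
      by (subst F2.finsum_insert) (auto simp: delta_def F2_simps)
    also have "\<dots> = delta (g \<otimes>\<^bsub>G\<^esub> h) x"
      using assms True by (auto simp: delta_def G.m_assoc[symmetric])
    finally show ?thesis .
  next
    case False
    have "delta g \<otimes>\<^bsub>A\<^esub> delta h \<in> carrier A" using delta_closed assms by simp
    then have "(delta g \<otimes>\<^bsub>A\<^esub> delta h) x = 0" using False by (simp add: A_carrier)
    moreover have "delta (g \<otimes>\<^bsub>G\<^esub> h) x = 0" using False assms by (auto simp: delta_def)
    ultimately show ?thesis by simp
  qed
qed

lemma group_ring_F2_induct [consumes 1, case_names zero delta add]:
  assumes "f \<in> carrier A"
    and "P \<zero>\<^bsub>A\<^esub>" "\<And>g. g \<in> carrier G \<Longrightarrow> P (delta g)"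
    and "\<And>f f'. f \<in> carrier A \<Longrightarrow> f' \<in> carrier A \<Longrightarrow> P f \<Longrightarrow> P f' \<Longrightarrow> P (f \<oplus>\<^bsub>A\<^esub> f')"
  shows "P f"
proof -
  have "P f" if "finite B" "f \<in> carrier A" "{x. f x \<noteq> 0} = B" for B f
    using that
  proof (induction B arbitrary: f)
    case empty
    then have "f = \<zero>\<^bsub>A\<^esub>" by (auto simp: A_simps)
    then show ?case using assms(2) by simp
  next
    case (insert g B)
    define f' where "f' = f(g := 0)"
    have supp: "{x. f' x \<noteq> 0} = B" using insert.hyps(2) insert.prems(2) by (auto simp: f'_def)
    have f': "f' \<in> carrier A"
      using insert.prems(1) supp insert.hyps(1) by (auto simp: A_carrier) (auto simp: f'_def)
    have fg: "f g = 1" using insert.prems by (auto simp: A_carrier)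
    then have g: "g \<in> carrier G" using insert.prems(1) by (auto simp: A_carrier)
    have "f = delta g \<oplus>\<^bsub>A\<^esub> f'"
    proof
      fix x
      have "f x = 0 \<or> f x = 1" using insert.prems(1) by (auto simp: A_carrier)
      then show "f x = (delta g \<oplus>\<^bsub>A\<^esub> f') x" using fg by (auto simp: A_simps f'_def delta_def)
    qed
    then show ?case using assms(3,4) delta_closed g f' insert.IH[OF f' supp] by simp
  qed
  then show ?thesis using assms(1) by (auto simp: A_carrier)
qed

lemma support_add:
  assumes "f \<in> carrier A" "f' \<in> carrier A"
  shows "{x. (f \<oplus>\<^bsub>A\<^esub> f') x \<noteq> 0} = ({x. f x \<noteq> 0} - {x. f' x \<noteq> 0}) \<union> ({x. f' x \<noteq> 0} - {x. f x \<noteq> 0})"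
proof -
  have "f x = 0 \<or> f x = 1" "f' x = 0 \<or> f' x = 1" for x using assms by (auto simp: A_carrier)
  then have "(f x + f' x) mod 2 \<noteq> 0 \<longleftrightarrow> (f x \<noteq> 0) \<noteq> (f' x \<noteq> 0)" for x
    by (metis add_0 add.right_neutral mod_self mod_0 one_add_one one_mod_two_eq_one zero_neq_one)
  then show ?thesis by (auto simp: A_simps)
qed

lemma extend_add:
  fixes \<phi> :: "'g \<Rightarrow> 'r::ring_char_2"
  assumes "f \<in> carrier A" "f' \<in> carrier A"
  shows "extend \<phi> (f \<oplus>\<^bsub>A\<^esub> f') = extend \<phi> f + extend \<phi> f'"
  unfolding extend_def support_add[OF assms]
  by (rule sum_insert_sym_diff) (use assms in \<open>auto simp: A_carrier\<close>)

lemma extend_delta: "extend \<phi> (delta g) = \<phi> g"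
  by (simp add: extend_def delta_def)

lemma extend_mult:
  fixes \<phi> :: "'g \<Rightarrow> 'r::ring_char_2"
  assumes \<phi>: "\<And>g h. g \<in> carrier G \<Longrightarrow> h \<in> carrier G \<Longrightarrow> \<phi> (g \<otimes>\<^bsub>G\<^esub> h) = \<phi> g * \<phi> h"
    and f: "f \<in> carrier A" and f': "f' \<in> carrier A"
  shows "extend \<phi> (f \<otimes>\<^bsub>A\<^esub> f') = extend \<phi> f * extend \<phi> f'"
  using f
proof (induction f rule: group_ring_F2_induct)
  case zero
  then show ?case using f' by (simp add: extend_def A_simps(3) A.l_null[unfolded A_simps(3)])
next
  case (delta g)
  show ?case using f'
  proof (induction f' rule: group_ring_F2_induct)
    case zero
    then show ?case using delta_closed[OF delta] A.r_null[OF delta_closed[OF delta]]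
      by (simp add: extend_def A_simps(3))
  next
    case (delta h)
    then show ?case using \<open>g \<in> carrier G\<close> by (simp add: delta_mult extend_delta \<phi>)
  next
    case (add u v)
    then show ?case using delta_closed[OF delta] by (simp add: A.r_distr extend_add distrib_left)
  qed
next
  case (add u v)
  then show ?case using f' by (simp add: A.l_distr extend_add distrib_right)
qed

lemma extend_inj:
  fixes \<phi> :: "'g \<Rightarrow> 'r::ring_char_2"
  assumes indep: "\<And>B. finite B \<Longrightarrow> B \<subseteq> carrier G \<Longrightarrow> sum \<phi> B = 0 \<Longrightarrow> B = {}"
  shows "inj_on (extend \<phi>) (carrier A)"
proof (rule inj_onI)
  fix f f' assume f: "f \<in> carrier A" "f' \<in> carrier A" and eq: "extend \<phi> f = extend \<phi> f'"
  have "extend \<phi> (f \<oplus>\<^bsub>A\<^esub> f') = 0" using f eq by (simp add: extend_add)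
  then have "sum \<phi> {x. (f \<oplus>\<^bsub>A\<^esub> f') x \<noteq> 0} = 0" by (simp only: extend_def)
  moreover have "f \<oplus>\<^bsub>A\<^esub> f' \<in> carrier A" using f by simp
  then have "finite {x. (f \<oplus>\<^bsub>A\<^esub> f') x \<noteq> 0}" "{x. (f \<oplus>\<^bsub>A\<^esub> f') x \<noteq> 0} \<subseteq> carrier G"
    by (auto simp: A_carrier)
  ultimately have "{x. (f \<oplus>\<^bsub>A\<^esub> f') x \<noteq> 0} = {}"
    by (intro indep)
  then have "(f x \<noteq> 0) = (f' x \<noteq> 0)" for x unfolding support_add[OF f] by blast
  moreover have "f x = 0 \<or> f x = 1" "f' x = 0 \<or> f' x = 1" for x using f by (auto simp: A_carrier)
  ultimately show "f = f'" by (metis ext)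
qed

end

lemma promislow_hom_mult:
  assumes "g \<in> carrier promislow_group" "h \<in> carrier promislow_group"
  shows "promislow_hom (g \<otimes>\<^bsub>promislow_group\<^esub> h) = promislow_hom g * promislow_hom h"
  using hom_mult[OF promislow_hom(1) assms] by (simp add: crossed_units_simps(2))

lemma promislow_hom_prep: "g \<in> carrier promislow_group \<Longrightarrow> promislow_hom g = prep (Abs_pgroup g)"
  by (simp add: prep_def Abs_pgroup_inverse)

text \<open>Distinct elements have distinct monomials as images, so the coefficient at the monomial
  of one chosen \<open>g\<close> receives a single contribution.\<close>

lemma promislow_hom_independent:
  assumes "finite B" "B \<subseteq> carrier promislow_group" "sum promislow_hom B = 0"
  shows "B = {}"
proof (rule ccontr)
  assume "B \<noteq> {}"
  then obtain g where g: "g \<in> B" by blast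
  obtain i j k e where e: "e < 4" "promislow_hom g = cmono i j k e"
    using normal_form_cases[of "Abs_pgroup g"] promislow_hom_prep g assms(2) by (metis subsetD)
  have coord_sum: "coord e (sum f B) = (\<Sum>h\<in>B. coord e (f h))" for f
    using assms(1) by induction (auto simp: coord_def)
  have eq: "Poly_Mapping.lookup (coord e (promislow_hom h)) (i, j, k) = (if h = g then 1 else 0)"
    if h: "h \<in> B" for h
  proof -
    obtain i' j' k' e' where e': "e' < 4" "promislow_hom h = cmono i' j' k' e'"
      using normal_form_cases[of "Abs_pgroup h"] promislow_hom_prep h assms(2) by (metis subsetD)
    have "h = g \<longleftrightarrow> promislow_hom h = promislow_hom g"
      using inj_prep promislow_hom_prep g h assms(2) by (metis Abs_pgroup_inject injD subsetD)
    then show ?thesis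
      unfolding e'(2) e(2) cmono_eq_iff[OF e'(1) e(1)] using e(1) e'(1)
      by (auto simp: coord_cmono lookup_single when_def)
  qed
  have "0 = Poly_Mapping.lookup (coord e (sum promislow_hom B)) (i, j, k)"
    by (simp add: assms(3) coord_def)
  also have "\<dots> = (\<Sum>h\<in>B. if h = g then 1 else 0)"
    unfolding coord_sum lookup_sum by (rule sum.cong) (simp_all add: eq)
  also have "\<dots> = 1" using g assms(1) by simp
  finally show False by simp
qed

abbreviation (input) "PR \<equiv> group_ring F2 promislow_group"
abbreviation "to_crossed \<equiv> extend promislow_hom"

lemma ring_PR: "ring PR"
  by (rule ring_group_ring[OF cring.axioms(1)[OF domain.axioms(1)[OF field.axioms(1)[OF field_F2]]] group_promislow_group])

lemma to_crossed_mult: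
  "f \<in> carrier PR \<Longrightarrow> f' \<in> carrier PR \<Longrightarrow> to_crossed (f \<otimes>\<^bsub>PR\<^esub> f') = to_crossed f * to_crossed f'"
  by (rule extend_mult[OF group_promislow_group]) (rule promislow_hom_mult)

lemmas to_crossed_add = extend_add[OF group_promislow_group, where \<phi> = promislow_hom]

lemma inj_to_crossed: "inj_on to_crossed (carrier PR)"
  by (rule extend_inj[OF group_promislow_group]) (rule promislow_hom_independent)

lemma to_crossed_1: "to_crossed \<one>\<^bsub>PR\<^esub> = 1"
proof -
  interpret P: group promislow_group by (rule group_promislow_group)
  have "promislow_hom \<one>\<^bsub>promislow_group\<^esub> = 1"
    using prep_1 by (simp add: prep_def one_pgroup_def Abs_pgroup_inverse)
  then show ?thesis by (simp add: A_simps(2)[OF group_promislow_group] extend_delta[OF group_promislow_group])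
qed

text \<open>Needed to pull units written down in the crossed product, such as Gardam's, back to the
  group ring.\<close>

lemma to_crossed_surj: "\<exists>f\<in>carrier PR. to_crossed f = w"
proof -
  interpret A: ring PR by (rule ring_PR)
  let ?T = "to_crossed ` carrier PR"
  have plus: "u + v \<in> ?T" if "u \<in> ?T" "v \<in> ?T" for u v
  proof -
    from that obtain f f' where f: "f \<in> carrier PR" "f' \<in> carrier PR" "u = to_crossed f" "v = to_crossed f'"
      by blast
    then show ?thesis by (intro image_eqI[of _ _ "f \<oplus>\<^bsub>PR\<^esub> f'"]) (simp_all add: to_crossed_add)
  qed
  have null: "0 \<in> ?T"
    using A.zero_closed by (intro image_eqI[of _ _ "\<zero>\<^bsub>PR\<^esub>"]) (auto simp: extend_def A_simps(3)[OF group_promislow_group])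
  have prep: "prep g \<in> ?T" for g
    using delta_closed[OF group_promislow_group Rep_pgroup[of g]]
    by (intro image_eqI[of _ _ "delta (Rep_pgroup g)"]) (auto simp: extend_delta[OF group_promislow_group] prep_def)
  have lmono: "cmono i j k e \<in> ?T" if "e < 4" for i j k e
  proof -
    have "cmono i j k 0 \<in> ?T" "cmono i j k 1 \<in> ?T" "cmono i j k 2 \<in> ?T" "cmono i j k 3 \<in> ?T"
      unfolding prep_normal_form[symmetric] by (rule prep)+
    then show ?thesis using less_4_cases[OF that] by (elim disjE) simp_all
  qed
  have scal: "scal r * unit_vec e \<in> ?T" if e: "e < 4" for r e
  proof (induction r rule: poly_mapping_bit_induct)
    case zero
    have "scal 0 * unit_vec e = 0" by (simp add: crossed_eq_iff)
    then show ?case using null by simp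
  next
    case (single k)
    show ?case using lmono[OF e] by (cases k) (simp add: cmono_def)
  next
    case (add r s)
    have "scal (r + s) * unit_vec e = scal r * unit_vec e + scal s * unit_vec e"
      by (simp add: scal_add distrib_right)
    then show ?case using plus[OF add.IH] by (simp only:)
  qed
  have "w = scal (ce w) * unit_vec 0 + scal (ca w) * unit_vec 1 + scal (cb w) * unit_vec 2
      + scal (cab w) * unit_vec 3"
    by (simp add: crossed_eq_iff unit_vec_def)
  moreover have "scal (ce w) * unit_vec 0 + scal (ca w) * unit_vec 1 + scal (cb w) * unit_vec 2
      + scal (cab w) * unit_vec 3 \<in> ?T"
    by (intro plus scal) simp_all
  ultimately have "w \<in> ?T" by (simp only:)
  then show ?thesis by auto
qed

section \<open>The group of units\<close>

interpretation PR: ring PR by (rule ring_PR)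

abbreviation (input) "UPR \<equiv> units_of PR"

interpretation U: group UPR by (rule PR.units_group)

lemma UPR_carrier: "u \<in> carrier UPR \<Longrightarrow> u \<in> carrier PR"
  by (simp add: units_of_carrier PR.Units_closed)

lemma to_crossed_UPR:
  "u \<in> carrier UPR \<Longrightarrow> v \<in> carrier UPR \<Longrightarrow> to_crossed (u \<otimes>\<^bsub>UPR\<^esub> v) = to_crossed u * to_crossed v"
  "to_crossed \<one>\<^bsub>UPR\<^esub> = 1"
  by (simp_all add: units_of_mult units_of_one UPR_carrier to_crossed_mult to_crossed_1)

lemma inj_to_crossed_UPR: "inj_on to_crossed (carrier UPR)"
  using UPR_carrier by (intro inj_on_subset[OF inj_to_crossed] subsetI)

lemma ex_unit_PR:
  assumes "w * w' = 1" "w' * w = 1"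
  shows "\<exists>u\<in>carrier UPR. to_crossed u = w"
proof -
  obtain u u' where u: "u \<in> carrier PR" "to_crossed u = w" "u' \<in> carrier PR" "to_crossed u' = w'"
    using to_crossed_surj by meson
  have e: "to_crossed (u \<otimes>\<^bsub>PR\<^esub> u') = to_crossed \<one>\<^bsub>PR\<^esub>" "to_crossed (u' \<otimes>\<^bsub>PR\<^esub> u) = to_crossed \<one>\<^bsub>PR\<^esub>"
    using u assms by (simp_all add: to_crossed_mult to_crossed_1)
  have "u \<otimes>\<^bsub>PR\<^esub> u' = \<one>\<^bsub>PR\<^esub>" "u' \<otimes>\<^bsub>PR\<^esub> u = \<one>\<^bsub>PR\<^esub>"
    using e u(1,3) by (simp_all add: inj_on_eq_iff[OF inj_to_crossed])
  then have "u \<in> carrier UPR" using u unfolding units_of_carrier Units_def by blast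
  then show ?thesis using u by blast
qed

definition unit_rep where "unit_rep u = dihedral_rep (to_crossed u)"

lemma unit_rep_mult: "u \<in> carrier UPR \<Longrightarrow> v \<in> carrier UPR \<Longrightarrow> unit_rep (u \<otimes>\<^bsub>UPR\<^esub> v) = unit_rep u * unit_rep v"
  by (simp add: unit_rep_def to_crossed_UPR dihedral_rep_mult)

lemma unit_rep_1: "unit_rep \<one>\<^bsub>UPR\<^esub> = 1"
  by (simp add: unit_rep_def to_crossed_UPR dihedral_rep_1)

lemma unit_rep_inv: "u \<in> carrier UPR \<Longrightarrow> unit_rep u * unit_rep (inv\<^bsub>UPR\<^esub> u) = 1"
  using unit_rep_mult[of u "inv\<^bsub>UPR\<^esub> u"] by (simp add: unit_rep_1)

lemma torsion_free_UPR: "torsion_free UPR"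
  unfolding torsion_free_def
proof (intro ballI allI impI)
  fix u and n :: nat assume u: "u \<in> carrier UPR" "n > 0" "u [^]\<^bsub>UPR\<^esub> n = \<one>\<^bsub>UPR\<^esub>"
  have "to_crossed (u [^]\<^bsub>UPR\<^esub> m) = to_crossed u ^ m" for m :: nat
    by (induction m) (simp_all add: to_crossed_UPR u(1) power_commutes)
  from this[of n] have "to_crossed u ^ n = 1" by (simp only: u(3) to_crossed_UPR)
  then have "to_crossed u = to_crossed \<one>\<^bsub>UPR\<^esub>"
    using crossed_torsion_free u(2) by (simp only: to_crossed_UPR)
  then show "u = \<one>\<^bsub>UPR\<^esub>" using u(1) by (simp add: inj_on_eq_iff[OF inj_to_crossed_UPR])
qed

lemma linear_group_UPR: "linear_group UPR"
  by (rule linear_group_crossedI[where \<phi> = to_crossed])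
    (fact U.is_group inj_to_crossed_UPR to_crossed_UPR)+

lemma not_finitely_generated_UPR: "\<not> finitely_generated UPR"
proof (rule U.not_finitely_generatedI)
  fix u v assume uv: "u \<in> carrier UPR" "v \<in> carrier UPR"
  show "euclid_hom (unit_rep (u \<otimes>\<^bsub>UPR\<^esub> v)) = euclid_hom (unit_rep u) + euclid_hom (unit_rep v)"
    unfolding unit_rep_mult[OF uv]
    by (rule euclid_hom_mult; rule det2_unit[OF unit_rep_inv], fact)
next
  let ?e = "\<lambda>n. euclid_hom (dihedral_rep (gardam (int n)))"
  have "?e n \<in> (\<lambda>u. euclid_hom (unit_rep u)) ` carrier UPR" for n
    using ex_unit_PR[OF gardam_mult[of "int n"] gardam_inv_mult] unfolding unit_rep_def by force
  then have "range ?e \<subseteq> (\<lambda>u. euclid_hom (unit_rep u)) ` carrier UPR"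
    by blast
  moreover have "inj ?e"
  proof (rule injI)
    fix m n assume "?e m = ?e n"
    from arg_cong[OF this, of Polynomial.degree] show "m = n"
      unfolding degree_euclid_hom_gardam by simp
  qed
  then have "infinite (range ?e)" by (rule range_inj_infinite)
  ultimately show "infinite ((\<lambda>u. euclid_hom (unit_rep u)) ` carrier UPR)"
    using finite_subset by blast
qed

lemma free_subgroup_UPR:
  "\<exists>H. subgroup H UPR \<and> is_free_group (UPR\<lparr>carrier := H\<rparr>) \<and> \<not> comm_group (UPR\<lparr>carrier := H\<rparr>)"
proof -
  \<comment> \<open>The scalar x is a^2, so its image is already the square of
    \<open>dt = swap * shear svar\<close>.\<close>
  have "scal (lmono 1 0 0) * scal (lmono (- 1) 0 0) = 1" "scal (lmono (- 1) 0 0) * scal (lmono 1 0 0) = 1"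
    by (simp_all add: crossed_eq_iff mono_mult)
  then obtain X where X: "X \<in> carrier UPR" "to_crossed X = scal (lmono 1 0 0)"
    using ex_unit_PR by blast
  obtain Y' where Y': "Y' \<in> carrier UPR" "to_crossed Y' = gardam 0"
    using ex_unit_PR[OF gardam_mult gardam_inv_mult] by blast
  define Y where "Y = Y' \<otimes>\<^bsub>UPR\<^esub> Y'"
  have Y: "Y \<in> carrier UPR" using Y' by (simp add: Y_def)
  have rep_X: "unit_rep X = swap * shear svar * (swap * shear svar)"
    using tpow_add[of 1 1] by (simp add: unit_rep_def X dihedral_rep_def lmat_0 lmat_mono flip: dt_eq)
  have "dickson 2 = svar * svar" by (simp add: numeral_2_eq_2)
  then have "dihedral_rep (gardam 0) = dt * shear ((1 + svar * svar) * svar)"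
    using dihedral_rep_gardam[of 0] by simp
  \<comment> \<open>Since \<open>dt\<close> contributes \<open>shear svar\<close>, the shears add up
    to s + (1 + s^2) s = s^3.\<close>
  also have "\<dots> = swap * shear (svar ^ 3)"
    by (simp add: dt_eq mat2_eq_iff power3_eq_cube one_pCons)
  finally have rep_Y: "unit_rep Y = swap * shear (svar ^ 3) * (swap * shear (svar ^ 3))"
    by (simp add: Y_def unit_rep_mult Y') (simp add: unit_rep_def Y')
  have "unit_rep X \<noteq> unit_rep Y"
    unfolding rep_X rep_Y by (simp add: mat2_eq_iff power3_eq_cube)
  then have XY: "X \<noteq> Y" by auto
  define F where "F g = (if g = X then svar else svar ^ 3)" for g
  let ?S = "{X, Y}"
  have S: "?S \<subseteq> carrier UPR" using X Y by simp
  have letter: "unit_rep (letter_eval UPR id l) = letter_mat F l" if "fst l \<in> ?S" for l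
  proof -
    obtain g e where l: "l = (g, e)" by (cases l)
    have g: "g \<in> carrier UPR" using that S by (auto simp: l)
    have pos: "unit_rep g = letter_mat F (g, True)"
      using that XY rep_X rep_Y by (auto simp: l letter_mat_def F_def)
    have inv: "letter_mat F (g, False) * letter_mat F (g, True) = 1"
    proof -
      have ss: "shear (F g) * shear (F g) = 1" "swap * swap = 1" by (simp_all add: mat2_eq_iff)
      then have "swap * (swap * B) = B" "shear (F g) * (shear (F g) * B) = B" for B
        by (simp_all flip: mult.assoc)
      with ss show ?thesis by (simp add: letter_mat_def mult.assoc)
    qed
    have "letter_mat F (g, False) = letter_mat F (g, False) * (unit_rep g * unit_rep (inv\<^bsub>UPR\<^esub> g))"
      by (simp add: unit_rep_inv[OF g])
    also have "\<dots> = unit_rep (inv\<^bsub>UPR\<^esub> g)"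
      unfolding pos mult.assoc[symmetric] inv by simp
    finally show ?thesis using pos by (cases e) (simp_all add: l letter_eval_def)
  qed
  have word: "unit_rep (word_eval UPR id w) = foldr (\<lambda>l B. letter_mat F l * B) w 1" if "fst ` set w \<subseteq> ?S" for w
    using that
  proof (induction w)
    case Nil
    then show ?case by (simp add: unit_rep_1)
  next
    case (Cons l w)
    have id: "id \<in> ?S \<rightarrow> carrier UPR" using S by auto
    have "letter_eval UPR id l \<in> carrier UPR"
      by (rule U.letter_eval_closed[OF id]) (use Cons.prems in simp)
    moreover have "word_eval UPR id w \<in> carrier UPR"
      by (rule U.word_eval_closed[OF id]) (use Cons.prems in simp)
    moreover have "unit_rep (letter_eval UPR id l) = letter_mat F l"
      by (rule letter) (use Cons.prems in simp)
    moreover have "unit_rep (word_eval UPR id w) = foldr (\<lambda>l B. letter_mat F l * B) w 1"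
      by (rule Cons.IH) (use Cons.prems in simp)
    ultimately show ?case by (simp only: word_eval_simps unit_rep_mult foldr_Cons o_apply)
  qed
  have deg: "Polynomial.degree (F g) > 0" if "g \<in> ?S" for g
    by (simp add: F_def Polynomial.degree_power_eq)
  have deg2: "Polynomial.degree (F g + F h) > 0" if "g \<in> ?S" "h \<in> ?S" "g \<noteq> h" for g h
  proof -
    have "Polynomial.degree (svar + svar ^ 3) = 3"
      by (subst Polynomial.degree_add_eq_right) (simp_all add: Polynomial.degree_power_eq)
    then show ?thesis using that XY by (auto simp: F_def add.commute)
  qed
  have ne: "word_eval UPR id w \<noteq> \<one>\<^bsub>UPR\<^esub>" if "reduced w" "w \<noteq> []" "fst ` set w \<subseteq> ?S" for w
  proof
    assume "word_eval UPR id w = \<one>\<^bsub>UPR\<^esub>"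
    then have "foldr (\<lambda>l B. letter_mat F l * B) w 1 = 1" using word[OF that(3)] unit_rep_1 by (simp only:)
    moreover have "foldr (\<lambda>l B. letter_mat F l * B) w 1 \<noteq> 1"
      by (rule reduced_word_ne_1[where S = ?S]) (fact deg deg2 that)+
    ultimately show False by contradiction
  qed
  show ?thesis
  proof (intro exI conjI)
    show "subgroup (word_eval UPR id ` carrier (free_group ?S)) UPR"
      by (rule U.free_subgroupI(1)[OF S]) (fact ne)
    show "is_free_group (UPR\<lparr>carrier := word_eval UPR id ` carrier (free_group ?S)\<rparr>)"
      by (rule U.free_subgroupI(2)[OF S]) (fact ne)
    show "\<not> comm_group (UPR\<lparr>carrier := word_eval UPR id ` carrier (free_group ?S)\<rparr>)"
      by (rule U.not_comm_free_subgroup[OF S _ _ XY]) (simp, simp, fact ne)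
  qed
qed

theorem corollary2:
  "let U = units_of (group_ring F2 promislow_group) in
     torsion_free U \<and> linear_group U \<and> \<not> finitely_generated U \<and>
     (\<exists>H. subgroup H U \<and> is_free_group (U\<lparr>carrier := H\<rparr>) \<and> \<not> comm_group (U\<lparr>carrier := H\<rparr>))"
  unfolding Let_def
  using torsion_free_UPR linear_group_UPR not_finitely_generated_UPR free_subgroup_UPR by blast

end
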